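(* Let $d\ge 1$, $0\le r\le d$, let $\Gamma$ be a discrete subgroup of rank $r$ of $(\mathbb{R}^d,+)$, let $\nu>0$, and let $\chi$ be a character of $\Gamma$ with values in the unit circle, written $\chi(\gamma)=e^{2i\pi\langle \gamma,v_\chi\rangle}$ for $\gamma\in\Gamma$, with $v_\chi\in\mathbb{V}_\Gamma$. For $\gamma^*\in\Gamma^*$ and $\mathbf{k}\in(\mathbb{Z}_{\ge 0})^{d-r}$ define, for $x=x_1+x_2$ with $(x_1,x_2)\in\mathbb{V}_\Gamma\times\mathbb{V}_\Gamma^{\perp}$, $$e_{\gamma^*,\mathbf{k}}(x)=e_{\gamma^*,\mathbf{k}}(x_1,x_2):=e^{\frac{\nu}{2}\langle x_1,x_1\rangle+2\pi i\langle v_\chi+\gamma^*,x_1\rangle}\,\mathbf{H}^\nu_{\mathbf{k}}(x_2).$$ Then the family $(e_{\gamma^*,\mathbf{k}})_{\gamma^*\in\Gamma^*,\ \mathbf{k}\in(\mathbb{Z}_{\ge0})^{d-r}}$ is an orthogonal basis of the Hilbert space $L^{2,\nu}_{\Gamma,\chi}(\mathbb{R}^d)$, and $$\|e_{\gamma^*,\mathbf{k}}\|_{\Gamma,\nu}^2=\mathrm{vol}(\Lambda_1(\Gamma))\left(\frac{\pi}{\nu}\right)^{(d-r)/2}2^{|\mathbf{k}|}\,\mathbf{k}!.$$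
   Context: $\langle\cdot,\cdot\rangle$ and $\|\cdot\|$ are the usual scalar product and norm on $\mathbb{R}^d$. $\mathbb{V}_\Gamma=\mathrm{Span}_{\mathbb{R}}(\Gamma)$ (of dimension $r$), $\mathbb{V}_\Gamma^{\perp}$ is its orthogonal complement, so every $x\in\mathbb{R}^d$ is uniquely $x=x_1+x_2$ with $x_1\in\mathbb{V}_\Gamma$, $x_2\in\mathbb{V}_\Gamma^\perp$; one writes $f(x_1,x_2)=f(x_1+x_2)$. $\Lambda(\Gamma)=\Lambda_1(\Gamma)\times\mathbb{V}_\Gamma^\perp$ is a fundamental domain of $\Gamma$ in $\mathbb{R}^d$, where $\Lambda_1(\Gamma)$ is a compact fundamental domain of $\Gamma$ in $\mathbb{V}_\Gamma$ (e.g. $\{\sum_j t_j\omega_j: t_j\in[0,1]\}$ for a $\mathbb{Z}$-basis $\omega_1,\dots,\omega_r$ of $\Gamma$), and $\mathrm{vol}$ is $r$-dimensional Lebesgue measure on $\mathbb{V}_\Gamma$ ($\mathrm{vol}=1$ if $r=0$). $d\lambda$ denotes Lebesgue measure. $L^{2,\nu}_{\Gamma,\chi}(\mathbb{R}^d)$ is the space of (classes, modulo a.e. equality, of) Borel measurable functions $f:\mathbb{R}^d\to\mathbb{C}$ such that $f(x+\gamma)=\chi(\gamma)e^{\nu\langle x+\gamma/2,\gamma\rangle}f(x)$ for almost every $x\in\mathbb{R}^d$ and every $\gamma\in\Gamma$, and $\|f\|_{\Gamma,\nu}^2:=\int_{\Lambda(\Gamma)}|f(x)|^2e^{-\nu\|x\|^2}d\lambda(x)<\infty$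 (independent of the choice of fundamental domain). Its scalar product is $\langle f,g\rangle_{\Gamma,\nu}=\int_{\Lambda(\Gamma)}f\,\overline{g}\,e^{-\nu\|x\|^2}d\lambda(x)$. A character satisfies $\chi(\gamma+\gamma')=\chi(\gamma)\chi(\gamma')$. $\Gamma^*=\{\gamma^*\in\mathbb{V}_\Gamma:\langle\gamma^*,\gamma\rangle\in\mathbb{Z}\ \text{for all }\gamma\in\Gamma\}$ is the dual of $\Gamma$. Fix an orthonormal basis of $\mathbb{V}_\Gamma^\perp$ and identify $x_2\in\mathbb{V}_\Gamma^\perp$ with its coordinates in $\mathbb{R}^{d-r}$. $\mathbf{H}^\nu_{\mathbf{k}}(x_2)=\mathbf{H}_{\mathbf{k}}(\sqrt{\nu}\,x_2)$, where for a multi-index $\mathbf{k}=(k_1,\dots,k_{d-r})$ of nonnegative integers $\mathbf{H}_{\mathbf{k}}(\xi)=(-1)^{|\mathbf{k}|}e^{\|\xi\|^2}\partial_\xi^{\mathbf{k}}\left(e^{-\|\xi\|^2}\right)$, $\xi\in\mathbb{R}^{d-r}$, with $|\mathbf{k}|=\sum_j k_j$ and $\mathbf{k}!=\prod_j k_j!$. *)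

theory Defs
  imports "HOL-Analysis.Analysis"
begin

section \<open>Discrete subgroups, characters, dual lattice\<close>

definition additive_subgroup :: "'a::ab_group_add set \<Rightarrow> bool" where
  "additive_subgroup \<Gamma> \<longleftrightarrow> 0 \<in> \<Gamma> \<and> (\<forall>x\<in>\<Gamma>. \<forall>y\<in>\<Gamma>. x + y \<in> \<Gamma>) \<and> (\<forall>x\<in>\<Gamma>. - x \<in> \<Gamma>)"

definition unitary_character :: "'a::ab_group_add set \<Rightarrow> ('a \<Rightarrow> complex) \<Rightarrow> bool" where
  "unitary_character \<Gamma> chi \<longleftrightarrow>
     (\<forall>\<gamma>\<in>\<Gamma>. cmod (chi \<gamma>) = 1) \<and> (\<forall>\<gamma>\<in>\<Gamma>. \<forall>\<gamma>'\<in>\<Gamma>. chi (\<gamma> + \<gamma>') = chi \<gamma> * chi \<gamma>')"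

definition dual_lattice :: "'a::euclidean_space set \<Rightarrow> 'a set" where
  "dual_lattice \<Gamma> = {\<delta> \<in> span \<Gamma>. \<forall>\<gamma>\<in>\<Gamma>. \<delta> \<bullet> \<gamma> \<in> \<int>}"


section \<open>Lebesgue measure on a subspace and fundamental domains\<close>

text \<open>The \<open>dim V\<close>-dimensional Lebesgue measure on a linear subspace \<open>V\<close>, regarded as a measure on
  the ambient space concentrated on \<open>V\<close>: transport the product measure through the coordinates of
  an orthonormal basis.  By rotation invariance the choice of the basis is immaterial; for
  \<open>V = {0}\<close> this is the unit mass at \<open>0\<close>.\<close>

definition orthonormal_basis_of :: "'a::euclidean_space set \<Rightarrow> 'a set \<Rightarrow> bool" where
  "orthonormal_basis_of B V \<longleftrightarrow> pairwise orthogonal B \<and> (\<forall>b\<in>B. norm b = 1) \<and> span B = V"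

definition subspace_lebesgue :: "'a::euclidean_space set \<Rightarrow> 'a measure" where
  "subspace_lebesgue V =
     (let B = (SOME B. orthonormal_basis_of B V)
      in distr (\<Pi>\<^sub>M b\<in>B. lborel) borel (\<lambda>c. \<Sum>b\<in>B. c b *\<^sub>R b))"

text \<open>Translates of a fundamental domain cover \<open>span \<Gamma>\<close> and overlap only in null sets, so that the
  closed parallelepiped spanned by a \<open>\<int>\<close>-basis of \<open>\<Gamma>\<close> qualifies.\<close>

definition compact_fundamental_domain :: "'a::euclidean_space set \<Rightarrow> 'a set \<Rightarrow> bool" where
  "compact_fundamental_domain \<Gamma> L \<longleftrightarrow>
     compact L \<and> (\<Union>\<gamma>\<in>\<Gamma>. (+) \<gamma> ` L) = span \<Gamma> \<and>
     (\<forall>\<gamma>\<in>\<Gamma>. \<forall>\<gamma>'\<in>\<Gamma>. \<gamma> \<noteq> \<gamma>' \<longrightarrow>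
        emeasure (subspace_lebesgue (span \<Gamma>)) ((+) \<gamma> ` L \<inter> (+) \<gamma>' ` L) = 0)"

definition full_domain :: "'a::euclidean_space set \<Rightarrow> 'a set \<Rightarrow> 'a set" where
  "full_domain \<Gamma> L = {x1 + x2 | x1 x2. x1 \<in> L \<and> x2 \<in> orthogonal_comp (span \<Gamma>)}"


section \<open>Borel functions modulo equality almost everywhere\<close>

quotient_type (overloaded) 'a ae_fun = "'a::euclidean_space \<Rightarrow> complex" / partial:
  "\<lambda>f g. f \<in> borel_measurable borel \<and> g \<in> borel_measurable borel \<and> (AE x in lborel. f x = g x)"
proof (rule part_equivpI)
  show "\<exists>f::'a \<Rightarrow> complex. f \<in> borel_measurable borel \<and> f \<in> borel_measurable borel
          \<and> (AE x in lborel. f x = f x)"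
    by (rule exI[of _ "\<lambda>_. 0"]) simp
next
  show "symp (\<lambda>f g::'a \<Rightarrow> complex. f \<in> borel_measurable borel \<and> g \<in> borel_measurable borel
          \<and> (AE x in lborel. f x = g x))"
    by (auto simp: symp_def eq_commute)
next
  show "transp (\<lambda>f g::'a \<Rightarrow> complex. f \<in> borel_measurable borel \<and> g \<in> borel_measurable borel
          \<and> (AE x in lborel. f x = g x))"
    unfolding transp_def
    by (intro allI impI, elim conjE, intro conjI, assumption, assumption, erule (1) eventually_elim2, simp)
qed

instantiation ae_fun :: (euclidean_space) ab_group_add
begin

lift_definition zero_ae_fun :: "'a ae_fun" is "\<lambda>_. 0"
  by simp

lift_definition plus_ae_fun :: "'a ae_fun \<Rightarrow> 'a ae_fun \<Rightarrow> 'a ae_fun" is "\<lambda>f g x. f x + g x"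
  by (elim conjE, intro conjI, simp, simp, erule (1) eventually_elim2, simp)

lift_definition minus_ae_fun :: "'a ae_fun \<Rightarrow> 'a ae_fun \<Rightarrow> 'a ae_fun" is "\<lambda>f g x. f x - g x"
  by (elim conjE, intro conjI, simp, simp, erule (1) eventually_elim2, simp)

lift_definition uminus_ae_fun :: "'a ae_fun \<Rightarrow> 'a ae_fun" is "\<lambda>f x. - f x"
  by (elim conjE, intro conjI, simp, simp, erule eventually_mono, simp)

instance
  by standard (transfer; simp add: algebra_simps)+

end

lift_definition scale_ae :: "complex \<Rightarrow> 'a::euclidean_space ae_fun \<Rightarrow> 'a ae_fun"
  is "\<lambda>c f x. c * f x"
  by (elim conjE, intro conjI, simp, simp, erule eventually_mono, simp)

interpretation ae: vector_space scale_ae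
  by standard (transfer; simp add: algebra_simps)+


section \<open>The space of \<open>(\<Gamma>, chi)\<close>-quasi-periodic square integrable functions\<close>

lemma (in complete_measure) measurable_cong_AE_complete:
  assumes eq: "AE x in M. f x = g x" and f: "f \<in> measurable M N"
    and g: "g \<in> space M \<rightarrow> space N"
  shows "g \<in> measurable M N"
proof (rule measurableI)
  fix A assume A: "A \<in> sets N"
  have "AE x in M. x \<in> f -` A \<inter> space M \<longleftrightarrow> x \<in> g -` A \<inter> space M"
    using eq by eventually_elim auto
  moreover have "f -` A \<inter> space M \<in> sets M"
    using f A by (rule measurable_sets)
  ultimately show "g -` A \<inter> space M \<in> sets M"
    by (rule in_sets_AE) blast
qed (use g in auto)

lemma AE_lebesgue_cong:
  fixes u v :: "'a::euclidean_space \<Rightarrow> 'b::{banach, second_countable_topology}"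
  assumes "AE x in lborel. u x = v x"
  shows integral_lebesgue_AE_cong: "integral\<^sup>L lebesgue u = integral\<^sup>L lebesgue v"
    and integrable_lebesgue_AE_cong: "integrable lebesgue u \<longleftrightarrow> integrable lebesgue v"
proof -
  have cm: "complete_measure (lebesgue :: 'a measure)" ..
  have uv: "AE x in lebesgue. u x = v x"
    by (rule AE_completion[OF assms])
  then have vu: "AE x in lebesgue. v x = u x"
    by eventually_elim simp
  consider "u \<in> borel_measurable lebesgue" "v \<in> borel_measurable lebesgue"
    | "u \<notin> borel_measurable lebesgue" "v \<notin> borel_measurable lebesgue"
    using complete_measure.measurable_cong_AE_complete[OF cm uv, of borel]
      complete_measure.measurable_cong_AE_complete[OF cm vu, of borel]
    by fastforce
  then have "(integrable lebesgue u \<longleftrightarrow> integrable lebesgue v) \<and>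
      integral\<^sup>L lebesgue u = integral\<^sup>L lebesgue v"
  proof cases
    case 1
    then show ?thesis
      using integrable_cong_AE[OF 1 uv] integral_cong_AE[OF 1 uv] by blast
  next
    case 2
    then have "\<not> integrable lebesgue u" "\<not> integrable lebesgue v"
      using borel_measurable_integrable by blast+
    then show ?thesis by (simp add: not_integrable_integral_eq)
  qed
  then show "integral\<^sup>L lebesgue u = integral\<^sup>L lebesgue v"
    and "integrable lebesgue u \<longleftrightarrow> integrable lebesgue v"
    by blast+
qed

lift_definition quasi_periodic ::
    "real \<Rightarrow> 'a::euclidean_space set \<Rightarrow> ('a \<Rightarrow> complex) \<Rightarrow> 'a ae_fun \<Rightarrow> bool"
  is "\<lambda>\<nu> \<Gamma> chi f. \<forall>\<gamma>\<in>\<Gamma>. AE x in lborel.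
        f (x + \<gamma>) = chi \<gamma> * complex_of_real (exp (\<nu> * ((x + \<gamma> /\<^sub>R 2) \<bullet> \<gamma>))) * f x"
proof -
  fix \<nu> :: real and \<Gamma> :: "'a set" and chi f g :: "'a \<Rightarrow> complex"
  assume fg: "f \<in> borel_measurable borel \<and> g \<in> borel_measurable borel \<and> (AE x in lborel. f x = g x)"
  have shift: "AE x in lborel. f (x + \<gamma>) = g (x + \<gamma>)" for \<gamma> :: 'a
  proof -
    have "AE x in distr lborel borel ((+) \<gamma>). f x = g x"
      unfolding lborel_distr_plus using fg by blast
    from AE_distrD[OF _ this] have "AE x in lborel. f (\<gamma> + x) = g (\<gamma> + x)"
      by simp
    then show ?thesis
      by (simp add: add.commute)
  qed
  have "(AE x in lborel. f (x + \<gamma>) = k x * f x) \<longleftrightarrow> (AE x in lborel. g (x + \<gamma>) = k x * g x)"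
    for \<gamma> and k :: "'a \<Rightarrow> complex"
  proof (rule eventually_subst)
    show "AE x in lborel. (f (x + \<gamma>) = k x * f x) = (g (x + \<gamma>) = k x * g x)"
      using shift[of \<gamma>] conjunct2[OF conjunct2[OF fg]] by eventually_elim simp
  qed
  then show "(\<forall>\<gamma>\<in>\<Gamma>. AE x in lborel.
        f (x + \<gamma>) = chi \<gamma> * complex_of_real (exp (\<nu> * ((x + \<gamma> /\<^sub>R 2) \<bullet> \<gamma>))) * f x) =
      (\<forall>\<gamma>\<in>\<Gamma>. AE x in lborel.
        g (x + \<gamma>) = chi \<gamma> * complex_of_real (exp (\<nu> * ((x + \<gamma> /\<^sub>R 2) \<bullet> \<gamma>))) * g x)"
    by simp
qed

lift_definition square_integrable_on :: "real \<Rightarrow> 'a::euclidean_space set \<Rightarrow> 'a ae_fun \<Rightarrow> bool"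
  is "\<lambda>\<nu> D f. set_integrable lebesgue D (\<lambda>x. (cmod (f x))\<^sup>2 * exp (- \<nu> * (norm x)\<^sup>2))"
  unfolding set_integrable_def by (rule integrable_lebesgue_AE_cong) (elim conjE, erule eventually_mono, simp)

lift_definition L2_inner :: "real \<Rightarrow> 'a::euclidean_space set \<Rightarrow> 'a ae_fun \<Rightarrow> 'a ae_fun \<Rightarrow> complex"
  is "\<lambda>\<nu> D f g. set_lebesgue_integral lebesgue D
        (\<lambda>x. f x * cnj (g x) * complex_of_real (exp (- \<nu> * (norm x)\<^sup>2)))"
  unfolding set_lebesgue_integral_def
  by (rule integral_lebesgue_AE_cong) (elim conjE, erule (1) eventually_elim2, simp)

lift_definition L2_norm :: "real \<Rightarrow> 'a::euclidean_space set \<Rightarrow> 'a ae_fun \<Rightarrow> real"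
  is "\<lambda>\<nu> D f. sqrt (set_lebesgue_integral lebesgue D
        (\<lambda>x. (cmod (f x))\<^sup>2 * exp (- \<nu> * (norm x)\<^sup>2)))"
  unfolding set_lebesgue_integral_def
  by (rule arg_cong[where f = sqrt], rule integral_lebesgue_AE_cong) (elim conjE, erule eventually_mono, simp)

definition L2_space ::
    "real \<Rightarrow> 'a::euclidean_space set \<Rightarrow> ('a \<Rightarrow> complex) \<Rightarrow> 'a set \<Rightarrow> 'a ae_fun set" where
  "L2_space \<nu> \<Gamma> chi D = {f. quasi_periodic \<nu> \<Gamma> chi f \<and> square_integrable_on \<nu> D f}"


section \<open>Complex Hilbert spaces and orthogonal bases\<close>

definition ip_dist :: "('v::ab_group_add \<Rightarrow> 'v \<Rightarrow> complex) \<Rightarrow> 'v \<Rightarrow> 'v \<Rightarrow> real" where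
  "ip_dist ip f g = sqrt (Re (ip (f - g) (f - g)))"

definition hilbert_space ::
    "(complex \<Rightarrow> 'v::ab_group_add \<Rightarrow> 'v) \<Rightarrow> 'v set \<Rightarrow> ('v \<Rightarrow> 'v \<Rightarrow> complex) \<Rightarrow> bool" where
  "hilbert_space smul H ip \<longleftrightarrow>
     vector_space smul \<and> module.subspace smul H \<and>
     (\<forall>f\<in>H. \<forall>g\<in>H. \<forall>h\<in>H. ip (f + g) h = ip f h + ip g h) \<and>
     (\<forall>c. \<forall>f\<in>H. \<forall>g\<in>H. ip (smul c f) g = c * ip f g) \<and>
     (\<forall>f\<in>H. \<forall>g\<in>H. ip g f = cnj (ip f g)) \<and>
     (\<forall>f\<in>H. f \<noteq> 0 \<longrightarrow> Re (ip f f) > 0) \<and>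
     Metric_space.mcomplete H (ip_dist ip)"

definition orthogonal_basis ::
    "(complex \<Rightarrow> 'v::ab_group_add \<Rightarrow> 'v) \<Rightarrow> 'v set \<Rightarrow> ('v \<Rightarrow> 'v \<Rightarrow> complex) \<Rightarrow>
     'i set \<Rightarrow> ('i \<Rightarrow> 'v) \<Rightarrow> bool" where
  "orthogonal_basis smul H ip I e \<longleftrightarrow>
     (\<forall>i\<in>I. e i \<in> H \<and> e i \<noteq> 0) \<and>
     (\<forall>i\<in>I. \<forall>j\<in>I. i \<noteq> j \<longrightarrow> ip (e i) (e j) = 0) \<and>
     (\<forall>f\<in>H. \<forall>\<epsilon>>0. \<exists>g \<in> module.span smul (e ` I). ip_dist ip f g < \<epsilon>)"


section \<open>Multivariate Hermite polynomials and the functions \<open>e\<close>\<close>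

text \<open>Points of \<open>\<real>\<^sup>m\<close> are functions \<open>nat \<Rightarrow> real\<close> of which only the values at indices \<open>< m\<close> matter;
  multi-indices are extensional functions on \<open>{..<m}\<close>.\<close>

definition multi_indices :: "nat \<Rightarrow> (nat \<Rightarrow> nat) set" where
  "multi_indices m = {..<m} \<rightarrow>\<^sub>E UNIV"

definition partial_deriv :: "nat \<Rightarrow> ((nat \<Rightarrow> real) \<Rightarrow> real) \<Rightarrow> (nat \<Rightarrow> real) \<Rightarrow> real" where
  "partial_deriv j F \<xi> = deriv (\<lambda>t. F (\<xi>(j := t))) (\<xi> j)"

primrec multi_deriv ::
    "nat \<Rightarrow> (nat \<Rightarrow> nat) \<Rightarrow> ((nat \<Rightarrow> real) \<Rightarrow> real) \<Rightarrow> (nat \<Rightarrow> real) \<Rightarrow> real" where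
  "multi_deriv 0 k F = F"
| "multi_deriv (Suc m) k F = multi_deriv m k ((partial_deriv m ^^ k m) F)"

definition hermite :: "nat \<Rightarrow> (nat \<Rightarrow> nat) \<Rightarrow> (nat \<Rightarrow> real) \<Rightarrow> real" where
  "hermite m k \<xi> = (-1) ^ (\<Sum>j<m. k j) * exp (\<Sum>j<m. (\<xi> j)\<^sup>2) *
     multi_deriv m k (\<lambda>\<eta>. exp (- (\<Sum>j<m. (\<eta> j)\<^sup>2))) \<xi>"

definition orth_proj :: "'a::euclidean_space set \<Rightarrow> 'a \<Rightarrow> 'a" where
  "orth_proj V x = (THE x1. x1 \<in> V \<and> x - x1 \<in> orthogonal_comp V)"

text \<open>\<open>b 0, \<dots>, b (m - 1)\<close> is the chosen orthonormal basis of the orthogonal complement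
  of \<open>span \<Gamma>\<close>.\<close>

definition e_fun :: "real \<Rightarrow> 'a::euclidean_space set \<Rightarrow> 'a \<Rightarrow> nat \<Rightarrow> (nat \<Rightarrow> 'a) \<Rightarrow>
    'a \<Rightarrow> (nat \<Rightarrow> nat) \<Rightarrow> 'a \<Rightarrow> complex" where
  "e_fun \<nu> \<Gamma> v m b \<delta> k x =
     (let x1 = orth_proj (span \<Gamma>) x; x2 = x - x1 in
      exp (complex_of_real (\<nu> / 2 * (x1 \<bullet> x1)) + 2 * complex_of_real pi * \<i> * complex_of_real ((v + \<delta>) \<bullet> x1))
      * complex_of_real (hermite m k (\<lambda>j. sqrt \<nu> * (x2 \<bullet> b j))))"

text \<open>The class of \<open>e_fun\<close>; \<open>abs_ae_fun\<close> is meaningful on Borel functions only, and \<open>e_fun\<close> is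
  continuous.\<close>

definition e_class :: "real \<Rightarrow> 'a::euclidean_space set \<Rightarrow> 'a \<Rightarrow> nat \<Rightarrow> (nat \<Rightarrow> 'a) \<Rightarrow>
    'a \<Rightarrow> (nat \<Rightarrow> nat) \<Rightarrow> 'a ae_fun" where
  "e_class \<nu> \<Gamma> v m b \<delta> k = abs_ae_fun (e_fun \<nu> \<Gamma> v m b \<delta> k)"

end

theory Submission
  imports Defs "HOL-Probability.Distributions"
begin

text \<open>The set \<open>L\<close> is only known to be compact, with translates that cover the
  span and overlap in null sets, so no coordinates adapted to it are available. Integrals over two
  domains are compared instead by counting: almost every x is moved into a given domain by exactly
  one lattice vector. The measure on the span is transported along an unspecified orthonormal basis,
  so separating x1 from x2 rests on the rotation invariance of Lebesgue measure. That is derived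
  from the uniqueness of translation-invariant measures, with the Gaussian fixing the constant.
  Elements of the space are classes on the whole space, whereas the norm sees only \<open>D\<close>:
  countability of \<Gamma> and the quasi-periodicity law carry almost-everywhere statements from
  \<open>D\<close> to all points, which gives definiteness and completeness. The density argument
  keeps the full weight exp (- \<nu> |x|^2), because exp (\<nu> / 2 |x1|^2) is at least 1 everywhere
  and, by compactness of \<open>L\<close>, bounded on \<open>D\<close>; dividing or multiplying by
  it therefore never leaves the square integrable functions of one fixed finite measure.\<close>

text \<open>Write \<open>x = x1 + x2\<close> with \<open>x1\<close> in the span of \<open>\<Gamma>\<close>. Division by \<open>exp (\<nu> / 2 * |x1|\<^sup>2 + 2 \<pi> i v x1)\<close>
  turns the quasi-periodic functions into the functions that are \<open>\<Gamma>\<close>-periodic in \<open>x1\<close>, and the weight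
  into the Gaussian \<open>exp (- \<nu> |x2|\<^sup>2)\<close>. Orthogonality of the characters holds because the integral of a
  periodic function over a fundamental domain does not change when the domain is translated;
  orthogonality of the Hermite polynomials follows from integration by parts.

  For totality, Hermite polynomials span all polynomials, so the closed span contains the exponentials
  \<open>exp (i \<xi> x2)\<close>, dominated by the Gaussian, and hence the algebra of trigonometric polynomials
  \<open>exp (2 \<pi> i \<delta> x1 + i \<xi> x2)\<close>. By Weierstrass approximation and a \<open>\<pi>\<close>-\<open>\<lambda>\<close> argument, a bounded
  algebra is dense among the square integrable functions measurable with respect to the
  \<open>\<sigma>\<close>-algebra it generates. That \<open>\<sigma>\<close>-algebra makes the fractional parts of the lattice
  coordinates of \<open>x1\<close> and the coordinates of \<open>x2\<close> measurable, and every periodic function factors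
  through these.\<close>

section \<open>Bases of discrete subgroups\<close>

lemma additive_subgroup_diff:
  assumes "additive_subgroup \<Gamma>" "x \<in> \<Gamma>" "y \<in> \<Gamma>"
  shows "x - y \<in> \<Gamma>"
  using assms by (metis additive_subgroup_def diff_conv_add_uminus)

lemma additive_subgroup_of_int_scaleR:
  fixes \<Gamma> :: "'a::real_vector set"
  assumes "additive_subgroup \<Gamma>" "x \<in> \<Gamma>"
  shows "of_int n *\<^sub>R x \<in> \<Gamma>"
proof -
  have nat: "of_nat k *\<^sub>R x \<in> \<Gamma>" for k
    using assms by (induction k) (auto simp: additive_subgroup_def algebra_simps)
  show ?thesis
  proof (cases "n \<ge> 0")
    case True
    then show ?thesis using nat[of "nat n"] by simp
  next
    case False
    then have "of_int n *\<^sub>R x = - (of_nat (nat (- n)) *\<^sub>R x)" by simp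
    then show ?thesis
      using nat[of "nat (- n)"] assms(1) by (simp only: additive_subgroup_def)
  qed
qed

lemma additive_subgroup_sum:
  assumes "additive_subgroup \<Gamma>" "\<And>i. i \<in> I \<Longrightarrow> f i \<in> \<Gamma>"
  shows "sum f I \<in> \<Gamma>"
  using assms(2) by (induction I rule: infinite_finite_induct)
    (use assms(1) in \<open>auto simp: additive_subgroup_def\<close>)

text \<open>Differences stay in \<Gamma>, so a radius isolating 0 separates every pair of
  points.\<close>

lemma discrete_subgroup_uniform_discrete:
  fixes \<Gamma> :: "'a::real_normed_vector set"
  assumes \<Gamma>: "additive_subgroup \<Gamma>" and d: "discrete \<Gamma>"
  shows "uniform_discrete \<Gamma>"
proof -
  have "0 isolated_in \<Gamma>"
    using \<Gamma> d by (auto simp: additive_subgroup_def discrete_def)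
  then obtain e where e: "e > 0" "\<And>y. y \<in> \<Gamma> \<Longrightarrow> dist 0 y < e \<Longrightarrow> y = 0"
    unfolding isolated_in_dist_Ex_iff by auto
  show ?thesis
  proof (rule uniformI1[OF e(1)])
    fix x y assume "x \<in> \<Gamma>" "y \<in> \<Gamma>" "dist x y < e"
    then show "x = y"
      using e(2)[of "x - y"] additive_subgroup_diff[OF \<Gamma>, of x y]
      by (simp add: dist_norm norm_minus_commute)
  qed
qed

lemma uniform_discrete_finite_bounded:
  fixes \<Gamma> :: "'a::euclidean_space set"
  assumes "uniform_discrete \<Gamma>"
  shows "finite {x \<in> \<Gamma>. norm x \<le> R}"
proof -
  have "bounded {x \<in> \<Gamma>. norm x \<le> R}"
    by (auto simp: bounded_iff)
  then show ?thesis
    using assms uniform_discrete_finite_iff uniform_discrete_subset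
    by (metis (no_types, lifting) mem_Collect_eq subsetI)
qed

lemma countable_uniform_discrete:
  fixes \<Gamma> :: "'a::euclidean_space set"
  assumes "uniform_discrete \<Gamma>"
  shows "countable \<Gamma>"
proof -
  have "\<Gamma> = (\<Union>n::nat. {x \<in> \<Gamma>. norm x \<le> real n})"
    using real_arch_simple by auto
  moreover have "countable (\<Union>n::nat. {x \<in> \<Gamma>. norm x \<le> real n})"
    by (rule countable_UN) (auto intro: countable_finite uniform_discrete_finite_bounded[OF assms])
  ultimately show ?thesis by metis
qed

abbreviation int_comb :: "'a::real_vector set \<Rightarrow> 'a \<Rightarrow> bool" where
  "int_comb W x \<equiv> \<exists>c::'a \<Rightarrow> int. x = (\<Sum>w\<in>W. of_int (c w) *\<^sub>R w)"

text \<open>Among the coefficients of b modulo \<open>span W\<close> that occur in \<Gamma> and lie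
  in (0, 1] there is a least one, and a lattice vector a attaining it replaces b. Division with
  remainder by this least coefficient leaves a smaller one, which must vanish, so what remains lies
  in \<open>span W\<close>.\<close>

lemma integral_basis_step:
  fixes \<Gamma> :: "'a::euclidean_space set"
  assumes \<Gamma>: "additive_subgroup \<Gamma>" and ud: "uniform_discrete \<Gamma>"
    and W: "finite W" "independent W" "W \<subseteq> \<Gamma>"
    and rep: "\<And>x. x \<in> \<Gamma> \<Longrightarrow> x \<in> span W \<Longrightarrow> int_comb W x"
    and b: "b \<in> \<Gamma>" "b \<notin> span W"
  obtains a where "a \<in> \<Gamma>" "a \<notin> span W" "span (insert a W) = span (insert b W)"
    "\<And>x. x \<in> \<Gamma> \<Longrightarrow> x \<in> span (insert b W) \<Longrightarrow> int_comb (insert a W) x"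
proof -
  define T where "T = {t. 0 < t \<and> t \<le> 1 \<and> (\<exists>x\<in>\<Gamma>. x - t *\<^sub>R b \<in> span W)}"
  \<comment> \<open>Replacing the W-coefficients by their fractional parts keeps the coefficient of
    b and stays in \<Gamma>, and the resulting vector obeys this norm bound. Finiteness of X thus
    makes T finite.\<close>
  define X where "X = {x \<in> \<Gamma>. norm x \<le> norm b + (\<Sum>w\<in>W. norm w)}"
  have "finite X"
    unfolding X_def by (rule uniform_discrete_finite_bounded[OF ud])
  have uniq: "s = t" if "x - s *\<^sub>R b \<in> span W" "x - t *\<^sub>R b \<in> span W" for x s t
  proof (rule ccontr)
    assume "s \<noteq> t"
    have "(t - s) *\<^sub>R b \<in> span W"
      using span_diff[OF that] by (simp add: algebra_simps)
    then have "inverse (t - s) *\<^sub>R ((t - s) *\<^sub>R b) \<in> span W"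
      by (rule span_scale)
    then show False using b \<open>s \<noteq> t\<close> by simp
  qed
  have "T \<subseteq> (\<Union>x\<in>X. {t. x - t *\<^sub>R b \<in> span W})"
  proof
    fix t assume "t \<in> T"
    then obtain x where t: "0 < t" "t \<le> 1" "x \<in> \<Gamma>" "x - t *\<^sub>R b \<in> span W"
      unfolding T_def by auto
    obtain u where u: "x - t *\<^sub>R b = (\<Sum>w\<in>W. u w *\<^sub>R w)"
      using t(4) unfolding span_finite[OF W(1)] by auto
    define y where "y = x - (\<Sum>w\<in>W. of_int \<lfloor>u w\<rfloor> *\<^sub>R w)"
    have y: "y \<in> \<Gamma>"
      unfolding y_def using W(3) t(3)
      by (intro additive_subgroup_diff[OF \<Gamma>] additive_subgroup_sum[OF \<Gamma>]
          additive_subgroup_of_int_scaleR[OF \<Gamma>]) auto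
    have yeq: "y = t *\<^sub>R b + (\<Sum>w\<in>W. frac (u w) *\<^sub>R w)"
      using u by (simp add: y_def frac_def algebra_simps sum_subtractf)
    have "norm y \<le> norm (t *\<^sub>R b) + norm (\<Sum>w\<in>W. frac (u w) *\<^sub>R w)"
      unfolding yeq by (rule norm_triangle_ineq)
    also have "norm (t *\<^sub>R b) \<le> norm b"
      using t by (simp add: mult_left_le_one_le)
    also have "norm (\<Sum>w\<in>W. frac (u w) *\<^sub>R w) \<le> (\<Sum>w\<in>W. norm w)"
    proof (rule sum_norm_le)
      fix w show "norm (frac (u w) *\<^sub>R w) \<le> norm w"
        using frac_ge_0[of "u w"] frac_lt_1[of "u w"] by (simp add: mult_left_le_one_le)
    qed
    finally have "y \<in> X" using y by (simp add: X_def)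
    moreover have "y - t *\<^sub>R b \<in> span W"
      by (simp add: yeq span_sum span_scale span_base)
    ultimately show "t \<in> (\<Union>x\<in>X. {t. x - t *\<^sub>R b \<in> span W})" by blast
  qed
  moreover have "finite {t. x - t *\<^sub>R b \<in> span W}" for x
  proof (cases "{t. x - t *\<^sub>R b \<in> span W} = {}")
    case False
    then obtain s where "x - s *\<^sub>R b \<in> span W" by auto
    then have "{t. x - t *\<^sub>R b \<in> span W} \<subseteq> {s}" using uniq by auto
    then show ?thesis by (rule finite_subset) simp
  qed simp
  ultimately have "finite T"
    using \<open>finite X\<close> by (meson finite_UN_I finite_subset)
  have "1 \<in> T"
    unfolding T_def using b(1) by (auto intro!: bexI[of _ b] simp: span_zero)
  define t where "t = Min T"
  have "t \<in> T" unfolding t_def using \<open>finite T\<close> \<open>1 \<in> T\<close> by (auto intro!: Min_in)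
  then obtain a where t: "0 < t" "t \<le> 1" "a \<in> \<Gamma>" "a - t *\<^sub>R b \<in> span W"
    unfolding T_def by auto
  have t_le: "t \<le> s" if "s \<in> T" for s
    unfolding t_def using \<open>finite T\<close> that by simp
  have aW: "a \<notin> span W"
    using uniq[of a t 0] t by auto
  have sub: "W \<subseteq> span (insert b W)" "W \<subseteq> span (insert a W)"
    using span_superset by fastforce+
  have a_in: "a \<in> span (insert b W)"
    using t(4) span_breakdown_eq by blast
  have "a \<in> span (insert a W)" "a - t *\<^sub>R b \<in> span (insert a W)"
    using t(4) span_mono[of W "insert a W"] by (auto simp: span_base)
  then have "(1 / t) *\<^sub>R (a - (a - t *\<^sub>R b)) \<in> span (insert a W)"
    by (rule span_scale[OF span_diff])
  then have b_in: "b \<in> span (insert a W)"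
    using t(1) by simp
  have sp: "span (insert a W) = span (insert b W)"
    unfolding span_eq using a_in b_in sub by auto
  show thesis
  proof (rule that[OF t(3) aW sp])
    fix x assume x: "x \<in> \<Gamma>" "x \<in> span (insert b W)"
    then obtain s where s: "x - s *\<^sub>R b \<in> span W"
      using span_breakdown_eq by blast
    \<comment> \<open>The floor puts the new coefficient of b into [0, t); since t \<le> 1, a
      nonzero one would belong to T and contradict minimality.\<close>
    define n where "n = \<lfloor>s / t\<rfloor>"
    define y where "y = x - of_int n *\<^sub>R a"
    have y: "y \<in> \<Gamma>"
      unfolding y_def using x t(3)
      by (intro additive_subgroup_diff[OF \<Gamma>] additive_subgroup_of_int_scaleR[OF \<Gamma>])
    have "y - (s - of_int n * t) *\<^sub>R b = (x - s *\<^sub>R b) - of_int n *\<^sub>R (a - t *\<^sub>R b)"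
      by (simp add: y_def algebra_simps)
    also have "\<dots> \<in> span W"
      by (rule span_diff[OF s span_scale[OF t(4)]])
    finally have yW: "y - (s - of_int n * t) *\<^sub>R b \<in> span W" .
    have bounds: "0 \<le> s - of_int n * t" "s - of_int n * t < t"
      using t(1) floor_correct[of "s / t"] unfolding n_def[symmetric]
      by (simp_all add: field_simps)
    have "s - of_int n * t = 0"
    proof (rule ccontr)
      assume "s - of_int n * t \<noteq> 0"
      then have "s - of_int n * t \<in> T"
        using bounds t(2) y yW by (auto simp: T_def)
      then show False using t_le bounds by fastforce
    qed
    then have "y \<in> span W" using yW by simp
    then obtain c :: "'a \<Rightarrow> int" where c: "y = (\<Sum>w\<in>W. of_int (c w) *\<^sub>R w)"
      using rep[OF y] by blast
    have "a \<notin> W" using aW span_base by blast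
    have "(\<Sum>w\<in>W. of_int ((c(a := n)) w) *\<^sub>R w) = y"
      unfolding c by (rule sum.cong) (use \<open>a \<notin> W\<close> in auto)
    then have "(\<Sum>w\<in>insert a W. of_int ((c(a := n)) w) *\<^sub>R w) = of_int n *\<^sub>R a + y"
      by (subst sum.insert[OF W(1) \<open>a \<notin> W\<close>]) (simp only: fun_upd_same)
    then have "x = (\<Sum>w\<in>insert a W. of_int ((c(a := n)) w) *\<^sub>R w)"
      by (simp add: y_def)
    then show "int_comb (insert a W) x" by blast
  qed
qed

text \<open>A real basis of the span chosen inside \<Gamma> is processed vector by vector.
  Integrality is asserted only for the lattice points in the span reached so far, which is all of
  \<Gamma> once the basis is exhausted.\<close>

lemma discrete_subgroup_integral_basis:
  fixes \<Gamma> :: "'a::euclidean_space set"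
  assumes \<Gamma>: "additive_subgroup \<Gamma>" and ud: "uniform_discrete \<Gamma>"
  obtains W where "finite W" "independent W" "W \<subseteq> \<Gamma>" "span W = span \<Gamma>"
    "\<And>x. x \<in> \<Gamma> \<Longrightarrow> int_comb W x"
proof -
  have "\<exists>W. finite W \<and> independent W \<and> W \<subseteq> \<Gamma> \<and> span W = span B \<and>
      (\<forall>x\<in>\<Gamma> \<inter> span B. int_comb W x)"
    if "finite B" "independent B" "B \<subseteq> \<Gamma>" for B
    using that
  proof (induction B)
    case empty
    then show ?case by (intro exI[of _ "{}"]) auto
  next
    case (insert b B)
    then obtain W where W: "finite W" "independent W" "W \<subseteq> \<Gamma>" "span W = span B"
      "\<And>x. x \<in> \<Gamma> \<Longrightarrow> x \<in> span W \<Longrightarrow> int_comb W x"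
      by (auto simp: independent_insert)
    have b: "b \<in> \<Gamma>" "b \<notin> span W"
      using insert W(4) by (auto simp: independent_insert)
    obtain a where a: "a \<in> \<Gamma>" "a \<notin> span W" "span (insert a W) = span (insert b W)"
      "\<And>x. x \<in> \<Gamma> \<Longrightarrow> x \<in> span (insert b W) \<Longrightarrow> int_comb (insert a W) x"
      using integral_basis_step[OF \<Gamma> ud W(1-3,5) b] by blast
    have sp: "span (insert b W) = span (insert b B)"
      using W(4) by (simp add: span_insert)
    show ?case
      using a W b unfolding sp
      by (intro exI[of _ "insert a W"]) (auto simp: independent_insertI)
  qed
  note basis = this
  obtain B where B: "B \<subseteq> \<Gamma>" "independent B" "\<Gamma> \<subseteq> span B"
    using maximal_independent_subset[of \<Gamma>] by blast
  have sp: "span B = span \<Gamma>"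
    using B by (metis span_mono span_span subset_antisym)
  obtain W where W: "finite W" "independent W" "W \<subseteq> \<Gamma>" "span W = span B"
    "\<forall>x\<in>\<Gamma> \<inter> span B. int_comb W x"
    using basis[OF independent_imp_finite[OF B(2)] B(2,1)] by blast
  show thesis
  proof (rule that[OF W(1-3)])
    show "span W = span \<Gamma>" using W(4) sp by simp
    show "int_comb W x" if "x \<in> \<Gamma>" for x
      using W(5) B(3) that by blast
  qed
qed

section \<open>Dual bases and lattice coordinates\<close>

text \<open>Riesz representation: the coordinate functional of w, extended to the ambient space, is
  the inner product with \<open>adjoint g 1\<close>. Projecting this vector to \<open>span W\<close>
  does not change its pairing with W.\<close>

lemma dual_basis_exists:
  fixes W :: "'a::euclidean_space set"
  assumes W: "independent W"
  obtains d where "\<And>w. d w \<in> span W" "\<And>w w'. w' \<in> W \<Longrightarrow> d w \<bullet> w' = (if w = w' then 1 else 0)"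
proof -
  have "\<exists>y\<in>span W. \<forall>w'\<in>W. y \<bullet> w' = (if w = w' then 1 else 0)" for w
  proof -
    obtain g :: "'a \<Rightarrow> real" where g: "linear g" "\<And>w'. w' \<in> W \<Longrightarrow> g w' = (if w = w' then 1 else 0)"
      using linear_independent_extend[OF W, of "\<lambda>w'. if w = w' then 1 else 0 :: real"] by auto
    obtain y z where yz: "y \<in> span W" "\<And>w'. w' \<in> span W \<Longrightarrow> orthogonal z w'" "adjoint g 1 = y + z"
      using orthogonal_subspace_decomp_exists[of W "adjoint g 1"] by metis
    have "y \<bullet> w' = (if w = w' then 1 else 0)" if "w' \<in> W" for w'
    proof -
      have "w' \<bullet> adjoint g 1 = g w'"
        using adjoint_works[OF g(1), of w' 1] by simp
      then show ?thesis
        using yz(2)[OF span_base[OF that]] g(2)[OF that] unfolding yz(3)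
        by (simp add: inner_simps orthogonal_def inner_commute)
    qed
    then show ?thesis using yz(1) by blast
  qed
  then show thesis using that by metis
qed

text \<open>Lattice points have integer coordinates in a \<int>-basis, so the vectors of the dual
  basis pair integrally with \<Gamma>. They read off the lattice coordinates of any point of the
  span, which is what \<open>retract\<close> is built from.\<close>

lemma lattice_dual_basis:
  fixes \<Gamma> :: "'a::euclidean_space set"
  assumes \<Gamma>: "additive_subgroup \<Gamma>" and ud: "uniform_discrete \<Gamma>"
  obtains W d where "finite W" "W \<subseteq> \<Gamma>" "\<And>w. w \<in> W \<Longrightarrow> d w \<in> dual_lattice \<Gamma>"
    "\<And>x. x \<in> span \<Gamma> \<Longrightarrow> x = (\<Sum>w\<in>W. (d w \<bullet> x) *\<^sub>R w)"
proof -
  obtain W where W: "finite W" "independent W" "W \<subseteq> \<Gamma>" "span W = span \<Gamma>"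
    "\<And>x. x \<in> \<Gamma> \<Longrightarrow> int_comb W x"
    using discrete_subgroup_integral_basis[OF \<Gamma> ud] by blast
  obtain d where d: "\<And>w. d w \<in> span W" "\<And>w w'. w' \<in> W \<Longrightarrow> d w \<bullet> w' = (if w = w' then 1 else 0)"
    using dual_basis_exists[OF W(2)] by blast
  have coeff: "d w \<bullet> (\<Sum>w\<in>W. c w *\<^sub>R w) = c w" if "w \<in> W" for w c
    using that W(1) by (simp add: inner_sum_right d(2) if_distrib[of "(*) _"] sum.delta cong: if_cong)
  show thesis
  proof (rule that[OF W(1,3)])
    show "d w \<in> dual_lattice \<Gamma>" if "w \<in> W" for w
      using d(1) W(4,5) coeff[OF that] unfolding dual_lattice_def by (fastforce simp: Ints_def)
    show "x = (\<Sum>w\<in>W. (d w \<bullet> x) *\<^sub>R w)" if x_in: "x \<in> span \<Gamma>" for x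
    proof -
      obtain c where x: "x = (\<Sum>w\<in>W. c w *\<^sub>R w)"
        using x_in unfolding W(4)[symmetric] span_finite[OF W(1)] by auto
      show ?thesis by (subst (1) x, intro sum.cong refl) (simp add: x coeff)
    qed
  qed
qed

section \<open>Lebesgue measure in orthonormal coordinates\<close>

lemma has_bochner_integral_gaussian:
  "has_bochner_integral lborel (\<lambda>x::real. exp (- x\<^sup>2)) (sqrt pi)"
  using has_bochner_integral_even_function[OF gaussian_moment_0] by simp

lemma gaussian_nn_integral:
  "(\<integral>\<^sup>+(x::'a). ennreal (exp (- (norm x)\<^sup>2)) \<partial>lborel) = ennreal (sqrt pi ^ DIM('a::euclidean_space))"
proof -
  have "(norm x)\<^sup>2 = (\<Sum>b\<in>Basis. (x \<bullet> b)\<^sup>2)" for x :: 'a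
    unfolding power2_norm_eq_inner by (subst euclidean_inner) (simp add: power2_eq_square)
  then have "(\<integral>\<^sup>+(x::'a). ennreal (exp (- (norm x)\<^sup>2)) \<partial>lborel) =
      (\<integral>\<^sup>+(x::'a). (\<Prod>b\<in>Basis. ennreal (exp (- (x \<bullet> b)\<^sup>2))) \<partial>lborel)"
    by (simp add: prod_ennreal sum_negf[symmetric] exp_sum)
  also have "\<dots> = (\<Prod>b\<in>(Basis::'a set). \<integral>\<^sup>+(t::real). ennreal (exp (- t\<^sup>2)) \<partial>lborel)"
    by (rule nn_integral_lborel_prod) auto
  also have "(\<integral>\<^sup>+(t::real). ennreal (exp (- t\<^sup>2)) \<partial>lborel) = ennreal (sqrt pi)"
    using has_bochner_integral_gaussian
    by (subst nn_integral_eq_integral) (auto simp: has_bochner_integral_iff)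
  finally show ?thesis by (simp add: ennreal_power)
qed

lemma integrable_gaussian:
  assumes "c > 0"
  shows "integrable lborel (\<lambda>x::'a::euclidean_space. exp (- c * (norm x)\<^sup>2))"
proof -
  have "integrable lborel (\<lambda>x::'a. exp (- (norm x)\<^sup>2))"
    by (rule integrableI_nonneg) (auto simp: gaussian_nn_integral)
  moreover have "(\<integral>\<^sup>+(x::'a). ennreal (exp (- (norm x)\<^sup>2)) \<partial>lborel) < \<infinity>"
    by (simp add: gaussian_nn_integral)
  moreover have "(lborel :: 'a measure) = density (distr lborel borel (\<lambda>x. 0 + sqrt c *\<^sub>R x)) (\<lambda>_. \<bar>sqrt c\<bar>^DIM('a))"
    using assms by (intro lborel_affine) simp
  ultimately have "(\<integral>\<^sup>+(x::'a). ennreal (exp (- (norm x)\<^sup>2))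
      \<partial>density (distr lborel borel (\<lambda>x. 0 + sqrt c *\<^sub>R x)) (\<lambda>_. \<bar>sqrt c\<bar>^DIM('a))) < \<infinity>"
    by simp
  then have "ennreal (\<bar>sqrt c\<bar>^DIM('a)) * (\<integral>\<^sup>+(x::'a). ennreal (exp (- (norm (sqrt c *\<^sub>R x))\<^sup>2)) \<partial>lborel) < \<infinity>"
    by (simp add: nn_integral_density nn_integral_distr nn_integral_cmult)
  then have "(\<integral>\<^sup>+(x::'a). ennreal (exp (- c * (norm x)\<^sup>2)) \<partial>lborel) < \<infinity>"
    using assms by (auto simp: ennreal_mult_less_top power_mult_distrib)
  then show ?thesis
    by (intro integrableI_nonneg) auto
qed

lemma nn_integral_lborel_shift:
  fixes h :: "'a::euclidean_space \<Rightarrow> ennreal"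
  assumes [measurable]: "h \<in> borel_measurable borel"
  shows "(\<integral>\<^sup>+x. h (a + x) \<partial>lborel) = (\<integral>\<^sup>+x. h x \<partial>lborel)"
  by (subst (2) lborel_distr_plus[of a, symmetric]) (simp add: nn_integral_distr)

text \<open>Fubini applied to \<open>f x * g (x + y)\<close>.\<close>

lemma translation_invariant_proportional:
  fixes M :: "'a::euclidean_space measure" and f g :: "'a \<Rightarrow> ennreal"
  assumes "sigma_finite_measure M" and sets: "sets M = sets borel"
    and inv: "\<And>a. distr M borel ((+) a) = M"
    and [measurable]: "f \<in> borel_measurable borel" "g \<in> borel_measurable borel"
  shows "(\<integral>\<^sup>+x. f x \<partial>M) * (\<integral>\<^sup>+x. g x \<partial>lborel) = (\<integral>\<^sup>+x. g x \<partial>M) * (\<integral>\<^sup>+x. f (- x) \<partial>lborel)"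
proof -
  interpret M: sigma_finite_measure M by fact
  interpret pair_sigma_finite M "lborel :: 'a measure" ..
  note [measurable_cong] = sets
  have shift_M: "(\<integral>\<^sup>+x. h (x + a) \<partial>M) = (\<integral>\<^sup>+x. h x \<partial>M)" if [measurable]: "h \<in> borel_measurable borel"
    for h :: "'a \<Rightarrow> ennreal" and a
    by (subst (2) inv[of a, symmetric]) (simp add: nn_integral_distr add.commute)
  have reflect: "(\<integral>\<^sup>+x. h (- x) \<partial>lborel) = (\<integral>\<^sup>+x. h x \<partial>lborel)" if [measurable]: "h \<in> borel_measurable borel"
    for h :: "'a \<Rightarrow> ennreal"
    by (subst (2) lborel_affine[of "-1" 0]) (simp_all add: nn_integral_density nn_integral_distr)
  have "(\<integral>\<^sup>+x. f x \<partial>M) * (\<integral>\<^sup>+x. g x \<partial>lborel) = (\<integral>\<^sup>+x. f x * (\<integral>\<^sup>+y. g (x + y) \<partial>lborel) \<partial>M)"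
    by (simp add: nn_integral_lborel_shift nn_integral_multc)
  also have "\<dots> = (\<integral>\<^sup>+x. (\<integral>\<^sup>+y. f x * g (x + y) \<partial>lborel) \<partial>M)"
    by (simp add: nn_integral_cmult)
  also have "\<dots> = (\<integral>\<^sup>+y. (\<integral>\<^sup>+x. f x * g (x + y) \<partial>M) \<partial>lborel)"
    by (rule Fubini'[symmetric]) simp
  also have "\<dots> = (\<integral>\<^sup>+y. (\<integral>\<^sup>+x. f (x - y) * g x \<partial>M) \<partial>lborel)"
  proof (rule nn_integral_cong)
    show "(\<integral>\<^sup>+x. f x * g (x + y) \<partial>M) = (\<integral>\<^sup>+x. f (x - y) * g x \<partial>M)" for y
      using shift_M[of "\<lambda>x. f (x - y) * g x" y] by simp
  qed
  also have "\<dots> = (\<integral>\<^sup>+x. (\<integral>\<^sup>+y. f (x - y) * g x \<partial>lborel) \<partial>M)"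
    by (rule Fubini') simp
  also have "\<dots> = (\<integral>\<^sup>+x. (\<integral>\<^sup>+y. f (x - y) \<partial>lborel) * g x \<partial>M)"
    by (simp add: nn_integral_multc)
  also have "\<dots> = (\<integral>\<^sup>+x. (\<integral>\<^sup>+y. f (- y) \<partial>lborel) * g x \<partial>M)"
  proof (rule nn_integral_cong)
    fix x
    have "(\<integral>\<^sup>+y. f (x - y) \<partial>lborel) = (\<integral>\<^sup>+y. f (x + y) \<partial>lborel)"
      using reflect[of "\<lambda>y. f (x + y)"] by simp
    then show "(\<integral>\<^sup>+y. f (x - y) \<partial>lborel) * g x = (\<integral>\<^sup>+y. f (- y) \<partial>lborel) * g x"
      by (simp add: nn_integral_lborel_shift reflect)
  qed
  also have "\<dots> = (\<integral>\<^sup>+y. f (- y) \<partial>lborel) * (\<integral>\<^sup>+x. g x \<partial>M)"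
    by (rule nn_integral_cmult) simp
  finally show ?thesis by (simp only: mult.commute)
qed

text \<open>Both measures agree on boxes, which determine a finite product measure. This permits
  coordinates to be indexed by numbers, by the vectors of an orthonormal basis or by the standard
  basis.\<close>

lemma distr_PiM_lborel_reindex:
  fixes h :: "'i \<Rightarrow> 'j"
  assumes h: "bij_betw h I J" and fin: "finite I"
  shows "distr (\<Pi>\<^sub>M j\<in>J. lborel) (\<Pi>\<^sub>M i\<in>I. lborel) (\<lambda>c. \<lambda>i\<in>I. c (h i)) = (\<Pi>\<^sub>M i\<in>I. (lborel :: real measure))"
proof -
  let ?D = "distr (\<Pi>\<^sub>M j\<in>J. lborel) (\<Pi>\<^sub>M i\<in>I. lborel) (\<lambda>c. \<lambda>i\<in>I. c (h i)) :: ('i \<Rightarrow> real) measure"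
  interpret product_sigma_finite "\<lambda>_::'i. lborel :: real measure" ..
  interpret J: product_sigma_finite "\<lambda>_::'j. lborel :: real measure" ..
  have J: "finite J" using h fin bij_betw_finite by blast
  have hJ: "h i \<in> J" if "i \<in> I" for i using h that bij_betwE by blast
  have meas: "(\<lambda>c. \<lambda>i\<in>I. c (h i)) \<in> measurable (\<Pi>\<^sub>M j\<in>J. lborel) (\<Pi>\<^sub>M i\<in>I. (lborel :: real measure))"
    by (intro measurable_restrict measurable_component_singleton hJ)
  show ?thesis
  proof (rule PiM_eqI[OF fin])
    fix A :: "'i \<Rightarrow> real set" assume A: "\<And>i. i \<in> I \<Longrightarrow> A i \<in> sets lborel"
    define B where "B j = A (inv_into I h j)" for j
    have B: "B (h i) = A i" if "i \<in> I" for i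
      using h that by (simp add: B_def bij_betw_inv_into_left)
    have BJ: "B j \<in> sets lborel" if "j \<in> J" for j
      unfolding B_def using h that by (intro A) (metis bij_betw_def inv_into_into)
    have "(\<lambda>c. \<lambda>i\<in>I. c (h i)) -` Pi\<^sub>E I A \<inter> space (\<Pi>\<^sub>M j\<in>J. lborel) = Pi\<^sub>E J B"
      using h B by (auto simp: space_PiM PiE_iff bij_betw_def)
    then have "emeasure (?D) (Pi\<^sub>E I A)
        = (\<Prod>j\<in>J. emeasure lborel (B j))"
      using A fin J BJ by (simp add: emeasure_distr[OF meas] sets_PiM_I_finite J.emeasure_PiM)
    also have "\<dots> = (\<Prod>i\<in>I. emeasure lborel (A i))"
      using h B by (subst prod.reindex_bij_betw[OF h, symmetric]) simp
    finally show "emeasure (?D) (Pi\<^sub>E I A)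
        = (\<Prod>i\<in>I. emeasure lborel (A i))" .
  qed simp
qed

lemma orthonormal_basis_of_finite:
  fixes B :: "'a::euclidean_space set"
  assumes "orthonormal_basis_of B V"
  shows "finite B" "independent B" "card B = dim V"
proof -
  have B: "pairwise orthogonal B" "0 \<notin> B" "span B = V"
    using assms by (auto simp: orthonormal_basis_of_def)
  then show "independent B" using pairwise_orthogonal_independent by blast
  then show "finite B" by (rule independent_imp_finite)
  show "card B = dim V" using \<open>independent B\<close> B(3) by (metis dim_eq_card dim_span)
qed

lemma orthonormal_inner:
  assumes "orthonormal_basis_of B V" "b \<in> B" "b' \<in> B"
  shows "b \<bullet> b' = (if b = b' then 1 else 0)"
  using assms by (auto simp: orthonormal_basis_of_def pairwise_def orthogonal_def norm_eq_1)

abbreviation basis_lebesgue :: "'a::euclidean_space set \<Rightarrow> 'a measure" where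
  "basis_lebesgue B \<equiv> distr (\<Pi>\<^sub>M b\<in>B. lborel) borel (\<lambda>c. \<Sum>b\<in>B. c b *\<^sub>R b)"

text \<open>The coordinate map \<Phi> is a linear isometry onto the space, so the image of Lebesgue
  measure is translation invariant and hence proportional to Lebesgue measure. The Gaussian depends
  on the norm only and has the same finite nonzero integral for both, so the constant is 1.\<close>

lemma lborel_eq_orthonormal:
  fixes C :: "'a::euclidean_space set"
  assumes C: "orthonormal_basis_of C UNIV"
  shows "lborel = basis_lebesgue C"
proof -
  note fin = orthonormal_basis_of_finite(1)[OF C]
  have "card (Basis :: 'a set) = card C"
    using orthonormal_basis_of_finite(3)[OF C] by simp
  then obtain h where h: "bij_betw h C (Basis :: 'a set)"
    using fin by (metis finite_Basis finite_same_card_bij)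
  define k where "k = inv_into C h"
  define \<Phi> where "\<Phi> x = (\<Sum>c\<in>C. (x \<bullet> h c) *\<^sub>R c)" for x :: 'a
  have \<Phi>_add: "\<Phi> (x + y) = \<Phi> x + \<Phi> y" for x y
    by (simp add: \<Phi>_def inner_add_left scaleR_add_left sum.distrib)
  have \<Phi>_cont: "continuous_on UNIV \<Phi>"
    unfolding \<Phi>_def by (intro continuous_intros)
  have [measurable]: "\<Phi> \<in> borel_measurable borel"
    by (rule borel_measurable_continuous_onI[OF \<Phi>_cont])
  have \<Phi>_inner: "\<Phi> x \<bullet> c = x \<bullet> h c" if "c \<in> C" for x c
    using that fin
    by (simp add: \<Phi>_def inner_sum_left orthonormal_inner[OF C] if_distrib[of "(*) _"] cong: if_cong)
  have \<Phi>_norm: "norm (\<Phi> x) = norm x" for x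
  proof -
    have "\<Phi> x \<bullet> \<Phi> x = (\<Sum>c\<in>C. (x \<bullet> h c) * (\<Phi> x \<bullet> c))"
      by (subst (2) \<Phi>_def) (simp add: inner_sum_right)
    also have "\<dots> = (\<Sum>c\<in>C. (x \<bullet> h c) * (x \<bullet> h c))"
      by (intro sum.cong refl) (simp add: \<Phi>_inner)
    also have "\<dots> = (\<Sum>b\<in>Basis. (x \<bullet> b) * (x \<bullet> b))"
      by (rule sum.reindex_bij_betw[OF h])
    also have "\<dots> = x \<bullet> x" by (rule euclidean_inner[symmetric])
    finally show ?thesis by (simp add: norm_eq_sqrt_inner)
  qed
  have \<Phi>_surj: "\<exists>y. \<Phi> y = x" for x
  proof -
    have "x \<in> span C" using C by (simp add: orthonormal_basis_of_def)
    then obtain u where u: "x = (\<Sum>c\<in>C. u c *\<^sub>R c)"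
      using span_finite[OF fin] by auto
    have "(\<Sum>c\<in>C. u c *\<^sub>R h c) \<bullet> h c' = u c'" if "c' \<in> C" for c'
    proof -
      have "h c \<bullet> h c' = (if c = c' then 1 else 0)" if "c \<in> C" for c
        using that \<open>c' \<in> C\<close> inner_Basis[of "h c" "h c'"] bij_betwE[OF h]
          inj_on_eq_iff[OF bij_betw_imp_inj_on[OF h]] by simp
      then show ?thesis using that fin
        by (simp add: inner_sum_left if_distrib[of "(*) _"] cong: if_cong)
    qed
    then have "\<Phi> (\<Sum>c\<in>C. u c *\<^sub>R h c) = x"
      by (simp add: \<Phi>_def u)
    then show ?thesis by blast
  qed
  define M where "M = basis_lebesgue C"
  have M_eq: "M = distr lborel borel \<Phi>"
  proof -
    have 1: "(\<Pi>\<^sub>M i\<in>C. (lborel :: real measure)) =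
        distr (\<Pi>\<^sub>M j\<in>Basis. lborel) (\<Pi>\<^sub>M i\<in>C. lborel) (\<lambda>c. \<lambda>i\<in>C. c (h i))"
      by (rule distr_PiM_lborel_reindex[OF h fin, symmetric])
    have 2: "(\<lambda>c. \<lambda>i\<in>C. c (h i)) \<in> measurable (\<Pi>\<^sub>M j\<in>Basis. lborel) (\<Pi>\<^sub>M i\<in>C. (lborel :: real measure))"
      using h by (intro measurable_restrict measurable_component_singleton) (auto simp: bij_betw_def)
    have "M = distr (\<Pi>\<^sub>M j\<in>Basis. lborel) borel
        ((\<lambda>c. \<Sum>b\<in>C. c b *\<^sub>R b) \<circ> (\<lambda>c. \<lambda>i\<in>C. c (h i)))"
      unfolding M_def by (subst 1, rule distr_distr[OF _ 2]) simp
    also have "\<dots> = distr (\<Pi>\<^sub>M j\<in>Basis. lborel) borel (\<lambda>c. \<Sum>b\<in>C. c (h b) *\<^sub>R b)"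
      by (simp add: o_def cong: sum.cong)
    also have "\<dots> = distr lborel borel \<Phi>"
    proof -
      have "\<Phi> (\<Sum>b\<in>Basis. f b *\<^sub>R b) = (\<Sum>b\<in>C. f (h b) *\<^sub>R b)" for f
        unfolding \<Phi>_def using bij_betwE[OF h] by (intro sum.cong refl) (simp add: inner_sum_left_Basis)
      then show ?thesis
        by (subst lborel_eq) (simp add: distr_distr o_def)
    qed
    finally show ?thesis .
  qed
  have M_inv: "distr M borel ((+) a) = M" for a
  proof -
    obtain y where y: "\<Phi> y = a" using \<Phi>_surj by blast
    have "distr M borel ((+) a) = distr lborel borel (\<lambda>x. \<Phi> (y + x))"
      unfolding M_eq by (simp add: distr_distr o_def \<Phi>_add y)
    also have "\<dots> = distr (distr lborel borel ((+) y)) borel \<Phi>"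
      by (simp add: distr_distr o_def)
    finally show ?thesis unfolding lborel_distr_plus M_eq .
  qed
  have gauss: "(\<integral>\<^sup>+x. ennreal (exp (- (norm x)\<^sup>2)) \<partial>M) = ennreal (sqrt pi ^ DIM('a))"
    unfolding M_eq by (simp add: nn_integral_distr \<Phi>_norm gaussian_nn_integral)
  \<comment> \<open>Balls centred at 0 are their own preimages under \<Phi> and have finite Lebesgue
    measure.\<close>
  have sf: "sigma_finite_measure M"
  proof
    show "\<exists>A. countable A \<and> A \<subseteq> sets M \<and> \<Union>A = space M \<and> (\<forall>a\<in>A. emeasure M a \<noteq> \<infinity>)"
    proof (intro exI[of _ "range (\<lambda>n::nat. ball 0 (real n))"] conjI ballI)
      show "\<Union> (range (\<lambda>n. ball 0 (real n))) = space M"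
        using reals_Archimedean2 by (auto simp: M_def)
      fix a assume "a \<in> range (\<lambda>n. ball (0::'a) (real n))"
      then obtain n where n: "a = ball 0 (real n)" by auto
      have "\<Phi> -` ball 0 (real n) = ball 0 (real n)" by (auto simp: \<Phi>_norm)
      then have "emeasure M a = emeasure lborel (ball (0::'a) (real n))"
        unfolding n M_eq by (simp add: emeasure_distr)
      then show "emeasure M a \<noteq> \<infinity>"
        using emeasure_lborel_ball_finite[of "0::'a" "real n"] by simp
    qed (auto simp: M_def)
  qed
  show ?thesis
  proof (rule measure_eqI)
    fix A :: "'a set" assume "A \<in> sets lborel"
    then have [measurable]: "A \<in> sets borel" by simp
    have "(\<integral>\<^sup>+x. ennreal (exp (- (norm x)\<^sup>2)) \<partial>M) * (\<integral>\<^sup>+x. indicator A x \<partial>lborel) =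
        (\<integral>\<^sup>+x. indicator A x \<partial>M) * (\<integral>\<^sup>+x. ennreal (exp (- (norm (- x))\<^sup>2)) \<partial>(lborel :: 'a measure))"
      by (rule translation_invariant_proportional[OF sf _ M_inv]) (auto simp: M_def)
    moreover have "A \<in> sets M" by (simp add: M_def)
    ultimately have "ennreal (sqrt pi ^ DIM('a)) * emeasure lborel A = emeasure M A * ennreal (sqrt pi ^ DIM('a))"
      by (simp add: gauss gaussian_nn_integral)
    then have "emeasure lborel A = emeasure M A"
      by (simp add: mult.commute[of "emeasure M A"] ennreal_mult_cancel_left)
    then show "emeasure lborel A = emeasure (basis_lebesgue C) A"
      by (simp add: M_def)
  qed (simp add: M_def)
qed

section \<open>Hermite polynomials\<close>

text \<open>The recursion is the one produced by differentiating H_n(t) exp (- t^2): up to sign the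
  new polynomial factor is 2 t H_n - H_n'. The leading coefficient is 2^n.\<close>

primrec hermite_poly :: "nat \<Rightarrow> real poly" where
  "hermite_poly 0 = 1"
| "hermite_poly (Suc n) = [:0, 2:] * hermite_poly n - pderiv (hermite_poly n)"

lemma degree_hermite_poly_le: "degree (hermite_poly n) \<le> n"
proof (induction n)
  case (Suc n)
  have "degree ([:0, 2:] * hermite_poly n) \<le> Suc n"
    using Suc degree_mult_le[of "[:0, 2:] :: real poly" "hermite_poly n"] by simp
  moreover have "degree (pderiv (hermite_poly n)) \<le> Suc n"
    using Suc by (simp add: degree_pderiv)
  ultimately show ?case by (simp add: degree_diff_le)
qed simp

lemma coeff_hermite_poly: "coeff (hermite_poly n) n = 2 ^ n"
proof (induction n)
  case (Suc n)
  have "coeff (pderiv (hermite_poly n)) (Suc n) = 0"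
    using degree_hermite_poly_le[of n] by (intro coeff_eq_0) (simp add: degree_pderiv)
  then show ?case using Suc by simp
qed simp

lemma degree_hermite_poly [simp]: "degree (hermite_poly n) = n"
  using degree_hermite_poly_le[of n] coeff_hermite_poly[of n]
  by (intro antisym le_degree) simp_all

text \<open>The Rodrigues formula in one variable.\<close>

lemma higher_deriv_gaussian:
  "(deriv ^^ n) (\<lambda>t::real. exp (- t\<^sup>2)) = (\<lambda>t. (-1) ^ n * poly (hermite_poly n) t * exp (- t\<^sup>2))"
proof (induction n)
  case (Suc n)
  have "((\<lambda>t. (-1) ^ n * poly (hermite_poly n) t * exp (- t\<^sup>2)) has_real_derivative
      (-1) ^ Suc n * poly (hermite_poly (Suc n)) t * exp (- t\<^sup>2)) (at t)" for t
    by (rule derivative_eq_intros poly_DERIV refl | simp add: algebra_simps)+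
  then show ?case
    using Suc by (auto intro!: ext DERIV_imp_deriv)
qed simp

lemma gaussian_differentiable:
  "(deriv ^^ n) (\<lambda>t::real. exp (- t\<^sup>2)) field_differentiable at t"
proof -
  have "((\<lambda>t. (-1) ^ n * poly (hermite_poly n) t * exp (- t\<^sup>2)) has_real_derivative
      (-1) ^ Suc n * poly (hermite_poly (Suc n)) t * exp (- t\<^sup>2)) (at t)"
    by (rule derivative_eq_intros poly_DERIV refl | simp add: algebra_simps)+
  then show ?thesis
    unfolding higher_deriv_gaussian field_differentiable_def by blast
qed

text \<open>Only one factor depends on coordinate j; the others form a constant. Differentiability
  of every iterated derivative is what lets this constant be pulled out of the total operator
  \<open>deriv\<close>.\<close>

lemma partial_deriv_funpow_prod:
  fixes g :: "nat \<Rightarrow> real \<Rightarrow> real"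
  assumes "finite J" "j \<in> J"
    and diff: "\<And>i t. (deriv ^^ i) (g j) field_differentiable at t"
  shows "(partial_deriv j ^^ n) (\<lambda>\<eta>. \<Prod>i\<in>J. g i (\<eta> i)) = (\<lambda>\<eta>. \<Prod>i\<in>J. (g(j := (deriv ^^ n) (g j))) i (\<eta> i))"
proof (induction n)
  case (Suc n)
  let ?h = "(deriv ^^ n) (g j)"
  have split: "(\<Prod>i\<in>J. (g(j := h)) i (\<eta> i)) = h (\<eta> j) * (\<Prod>i\<in>J - {j}. g i (\<eta> i))" for h \<eta>
    using assms(1,2) by (simp add: prod.remove)
  have "partial_deriv j (\<lambda>\<eta>. \<Prod>i\<in>J. (g(j := ?h)) i (\<eta> i)) \<xi> = deriv ?h (\<xi> j) * (\<Prod>i\<in>J - {j}. g i (\<xi> i))" for \<xi>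
  proof -
    have "(\<lambda>t. \<Prod>i\<in>J. (g(j := ?h)) i ((\<xi>(j := t)) i)) = (\<lambda>t. ?h t * (\<Prod>i\<in>J - {j}. g i (\<xi> i)))"
      unfolding split by (intro ext) simp
    then show ?thesis
      unfolding partial_deriv_def using deriv_cmult_right[OF diff, of n] by simp
  qed
  then show ?case
    using Suc by (simp only: funpow.simps comp_apply split)
qed simp

text \<open>\<open>multi_deriv\<close> differentiates in the highest coordinate first, so the
  induction must allow g to change: the last factor has already been replaced when the lower
  coordinates are treated.\<close>

lemma multi_deriv_prod:
  fixes g :: "nat \<Rightarrow> real \<Rightarrow> real"
  assumes "n \<le> m" and diff: "\<And>i j t. (deriv ^^ i) (g j) field_differentiable at t"
  shows "multi_deriv n k (\<lambda>\<eta>. \<Prod>j<m. g j (\<eta> j)) = (\<lambda>\<eta>. \<Prod>j<m. (if j < n then (deriv ^^ k j) (g j) else g j) (\<eta> j))"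
  using assms
proof (induction n arbitrary: g)
  case (Suc n)
  let ?g = "g(n := (deriv ^^ k n) (g n))"
  have "(deriv ^^ i) (?g j) field_differentiable at t" for i j t
    using Suc.prems(2)[of "i + k n" n t] Suc.prems(2)[of i j t] by (cases "j = n") (simp_all add: funpow_add)
  then have "multi_deriv n k (\<lambda>\<eta>. \<Prod>j<m. ?g j (\<eta> j)) =
      (\<lambda>\<eta>. \<Prod>j<m. (if j < n then (deriv ^^ k j) (?g j) else ?g j) (\<eta> j))"
    using Suc.IH[of ?g] Suc.prems(1) by simp
  moreover have "(partial_deriv n ^^ k n) (\<lambda>\<eta>. \<Prod>j<m. g j (\<eta> j)) = (\<lambda>\<eta>. \<Prod>j<m. ?g j (\<eta> j))"
    using Suc.prems by (intro partial_deriv_funpow_prod) auto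
  moreover have "(if j < n then (deriv ^^ k j) (?g j) else ?g j) = (if j < Suc n then (deriv ^^ k j) (g j) else g j)" for j
    by (auto simp: less_Suc_eq)
  ultimately show ?case by simp
qed simp

text \<open>The Gaussian factors over the coordinates, hence so do its derivatives; the signs and
  exponentials they produce cancel the prefactors in \<open>hermite\<close>.\<close>

lemma hermite_eq_prod: "hermite m k \<xi> = (\<Prod>j<m. poly (hermite_poly (k j)) (\<xi> j))"
proof -
  have "(\<lambda>\<eta>::nat \<Rightarrow> real. exp (- (\<Sum>j<m. (\<eta> j)\<^sup>2))) = (\<lambda>\<eta>. \<Prod>j<m. exp (- (\<eta> j)\<^sup>2))"
    by (simp add: exp_sum sum_negf[symmetric])
  then have "multi_deriv m k (\<lambda>\<eta>. exp (- (\<Sum>j<m. (\<eta> j)\<^sup>2))) \<xi> =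
      (\<Prod>j<m. (-1) ^ k j * poly (hermite_poly (k j)) (\<xi> j) * exp (- (\<xi> j)\<^sup>2))"
    using multi_deriv_prod[OF order_refl gaussian_differentiable, of m k]
    by (simp add: higher_deriv_gaussian)
  also have "\<dots> = (-1) ^ (\<Sum>j<m. k j) * (\<Prod>j<m. poly (hermite_poly (k j)) (\<xi> j)) * exp (- (\<Sum>j<m. (\<xi> j)\<^sup>2))"
    by (simp add: prod.distrib power_sum exp_sum sum_negf[symmetric])
  finally have "hermite m k \<xi> = ((-1) ^ (\<Sum>j<m. k j) * (-1) ^ (\<Sum>j<m. k j)) *
      (exp (\<Sum>j<m. (\<xi> j)\<^sup>2) * exp (- (\<Sum>j<m. (\<xi> j)\<^sup>2))) * (\<Prod>j<m. poly (hermite_poly (k j)) (\<xi> j))"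
    by (simp only: hermite_def ac_simps)
  then show ?thesis
    by (simp add: exp_minus power_mult_distrib[symmetric])
qed

section \<open>Gaussian moments and orthogonality of the Hermite polynomials\<close>

lemma gaussian_moment:
  "has_bochner_integral lborel (\<lambda>t::real. t ^ n * exp (- t\<^sup>2))
    (if even n then sqrt pi * (fact n / (2 ^ n * fact (n div 2))) else 0)"
proof (cases "even n")
  case True
  then obtain k where "n = 2 * k" by (rule evenE)
  then show ?thesis
    using has_bochner_integral_even_function[OF gaussian_moment_even_pos[where k = k]]
    by (simp add: mult.commute)
next
  case False
  then obtain k where n: "n = 2 * k + 1" by (rule oddE)
  have "has_bochner_integral lborel (\<lambda>x. exp (- x\<^sup>2) * x ^ (2 * k + 1)::real) 0"
    using gaussian_moment_odd_pos by (rule has_bochner_integral_odd_function) simp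
  then show ?thesis using n by (simp add: mult.commute)
qed

lemma integrable_poly_gaussian:
  "integrable lborel (\<lambda>t::real. poly p t * exp (- t\<^sup>2))"
  using gaussian_moment unfolding poly_altdef sum_distrib_right mult.assoc
  by (intro Bochner_Integration.integrable_sum integrable_mult_right)
    (auto simp: has_bochner_integral_iff)

abbreviation gauss_integral :: "real poly \<Rightarrow> real" where
  "gauss_integral p \<equiv> (\<integral>t. poly p t * exp (- t\<^sup>2) \<partial>lborel)"

text \<open>By linearity it suffices to treat monomials, where the identity is the moment recursion
  n m_(n-1) = 2 m_(n+1). Explicit moments take the place of boundary terms.\<close>

lemma gaussian_integration_by_parts:
  fixes p :: "real poly"
  shows "gauss_integral (pderiv p) = gauss_integral ([:0, 2:] * p)"
    (is "?Q p")
proof -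
  have add: "?Q (p + q)" if "?Q p" "?Q q" for p q
    using that integrable_poly_gaussian[of "pderiv p"] integrable_poly_gaussian[of "pderiv q"]
      integrable_poly_gaussian[of "[:0, 2:] * p"] integrable_poly_gaussian[of "[:0, 2:] * q"]
    by (simp only: pderiv_add distrib_left poly_add distrib_right Bochner_Integration.integral_add)
  have monom: "?Q (monom c n)" for c n
  proof -
    have "gauss_integral (pderiv (monom c n))
        = (real n * c) * (\<integral>t. t ^ (n - 1) * exp (- t\<^sup>2) \<partial>lborel)"
      by (simp add: pderiv_monom poly_monom mult.assoc)
    moreover have "gauss_integral ([:0, 2:] * monom c n)
        = (2 * c) * (\<integral>t. t ^ Suc n * exp (- t\<^sup>2) \<partial>lborel)"
      unfolding integral_mult_right_zero[symmetric]
      by (intro Bochner_Integration.integral_cong refl) (simp add: poly_monom)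
    \<comment> \<open>At n = 0 the exponent n - 1 is truncated to 0, but the factor n makes the left
      side vanish, in agreement with the vanishing first moment on the right.\<close>
    moreover have "real n * (\<integral>t. t ^ (n - 1) * exp (- t\<^sup>2) \<partial>lborel) = 2 * (\<integral>t. t ^ Suc n * exp (- t\<^sup>2) \<partial>lborel)"
    proof (cases "odd n")
      case True
      then obtain k where "n = 2 * k + 1" by (rule oddE)
      moreover have "sqrt pi * (fact (Suc (Suc (2 * k))) / (2 ^ Suc (Suc (2 * k)) * fact (Suc k)))
          = real (2 * k + 1) / 2 * (sqrt pi * (fact (2 * k) / (2 ^ (2 * k) * fact k)))"
        unfolding times_divide_eq_left times_divide_eq_right divide_divide_eq_left
        by (subst frac_eq_eq) (simp, simp, simp add: algebra_simps)
      ultimately show ?thesis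
        using gaussian_moment[of "n - 1"] gaussian_moment[of "Suc n"]
        by (simp add: has_bochner_integral_iff del: fact_Suc power_Suc)
    next
      case False
      then show ?thesis
        using gaussian_moment[of "n - 1"] gaussian_moment[of "Suc n"]
        by (cases n) (auto simp: has_bochner_integral_iff)
    qed
    ultimately show ?thesis by (simp add: mult.assoc mult.left_commute)
  qed
  have "?Q (\<Sum>i\<in>I. monom (coeff p i) i)" for I
    by (induction I rule: infinite_finite_induct) (simp_all add: add monom del: mult_pCons_left)
  from this[of "{..degree p}"] show ?thesis
    by (simp add: poly_as_sum_of_monoms del: mult_pCons_left)
qed

text \<open>Multiplication by 2 t minus differentiation is the adjoint of differentiation for the
  Gaussian weight, so each step of the Hermite recursion moves one derivative onto p.\<close>

lemma gaussian_integral_hermite: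
  "gauss_integral (p * hermite_poly n)
    = gauss_integral ((pderiv ^^ n) p)"
proof (induction n arbitrary: p)
  case (Suc n)
  have "p * hermite_poly (Suc n) = [:0, 2:] * (p * hermite_poly n) - p * pderiv (hermite_poly n)"
    by (simp add: algebra_simps)
  then have "gauss_integral (p * hermite_poly (Suc n)) =
      gauss_integral ([:0, 2:] * (p * hermite_poly n))
      - gauss_integral (p * pderiv (hermite_poly n))"
    by (simp only: poly_diff left_diff_distrib Bochner_Integration.integral_diff[OF integrable_poly_gaussian integrable_poly_gaussian])
  also have "gauss_integral ([:0, 2:] * (p * hermite_poly n)) =
      gauss_integral (p * pderiv (hermite_poly n))
      + gauss_integral (pderiv p * hermite_poly n)"
    unfolding gaussian_integration_by_parts[symmetric] pderiv_mult
    by (simp only: poly_add distrib_right Bochner_Integration.integral_add[OF integrable_poly_gaussian integrable_poly_gaussian] mult.commute[of _ "pderiv p"])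
  finally show ?case
    using Suc.IH[of "pderiv p"] by (simp add: funpow_swap1 del: hermite_poly.simps)
qed simp

text \<open>For n < k the k-fold derivative annihilates a polynomial of degree n. For equal indices
  it is the constant 2^n n! coming from the leading coefficient, and sqrt pi is the mass of the
  Gaussian.\<close>

lemma hermite_orthogonal:
  "(\<integral>t. poly (hermite_poly n) t * poly (hermite_poly k) t * exp (- t\<^sup>2) \<partial>lborel)
    = (if n = k then sqrt pi * 2 ^ n * fact n else 0)"
proof -
  have gt: "(\<integral>t. poly (hermite_poly n) t * poly (hermite_poly k) t * exp (- t\<^sup>2) \<partial>lborel) = 0" if "n < k" for n k
  proof -
    have "(pderiv ^^ k) (hermite_poly n) = 0"
      using that by (intro poly_eqI) (simp add: coeff_higher_pderiv coeff_eq_0)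
    then show ?thesis using gaussian_integral_hermite[of "hermite_poly n" k] by simp
  qed
  have eq: "(\<integral>t. poly (hermite_poly n) t * poly (hermite_poly n) t * exp (- t\<^sup>2) \<partial>lborel) = sqrt pi * 2 ^ n * fact n"
  proof -
    have "(pderiv ^^ n) (hermite_poly n) = [:2 ^ n * fact n:]"
    proof (intro poly_eqI)
      show "coeff ((pderiv ^^ n) (hermite_poly n)) i = coeff [:2 ^ n * fact n:] i" for i
        by (cases i) (simp_all add: coeff_higher_pderiv coeff_eq_0 coeff_hermite_poly pochhammer_fact)
    qed
    then show ?thesis
      using gaussian_integral_hermite[of "hermite_poly n" n] has_bochner_integral_gaussian
      by (simp add: has_bochner_integral_iff)
  qed
  show ?thesis
    using gt[of n k] gt[of k n] eq by (cases n k rule: linorder_cases) (simp_all add: mult.commute)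
qed

lemma hermite_orthogonal_scaled:
  assumes "\<nu> > 0"
  shows "(\<integral>t. poly (hermite_poly n) (sqrt \<nu> * t) * poly (hermite_poly k) (sqrt \<nu> * t) * exp (- \<nu> * t\<^sup>2) \<partial>lborel)
      = (if n = k then sqrt (pi / \<nu>) * 2 ^ n * fact n else 0)" (is "?I = ?R")
    and "integrable lborel (\<lambda>t. poly (hermite_poly n) (sqrt \<nu> * t) * poly (hermite_poly k) (sqrt \<nu> * t) * exp (- \<nu> * t\<^sup>2))" (is "integrable _ ?g")
proof -
  have s: "sqrt \<nu> \<noteq> 0" "(sqrt \<nu>)\<^sup>2 = \<nu>" using assms by auto
  let ?f = "\<lambda>t. poly (hermite_poly n) t * poly (hermite_poly k) t * exp (- t\<^sup>2)"
  have f: "?f (0 + sqrt \<nu> * t) = ?g t" for t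
    using s by (simp add: power_mult_distrib)
  have "integrable lborel ?f"
    using integrable_poly_gaussian[of "hermite_poly n * hermite_poly k"] by simp
  from lborel_integrable_real_affine[OF this s(1), of 0]
  show "integrable lborel ?g"
    unfolding f .
  have "integral\<^sup>L lborel ?f = \<bar>sqrt \<nu>\<bar> *\<^sub>R ?I"
    unfolding f[symmetric] by (rule lborel_integral_real_affine[OF s(1)])
  then show "?I = ?R"
    using assms s unfolding hermite_orthogonal by (auto simp: field_simps real_sqrt_divide split: if_splits)
qed

text \<open>\<open>hermite_poly n\<close> has degree exactly n and leading coefficient 2^n, so
  subtracting the top coefficient divided by 2^n times it lowers the degree.\<close>

lemma hermite_poly_expansion:
  "degree p \<le> n \<Longrightarrow> \<exists>a. p = (\<Sum>i\<le>n. smult (a i) (hermite_poly i))"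
proof (induction n arbitrary: p)
  case 0
  then have "p = smult (coeff p 0) (hermite_poly 0)"
    by (metis degree_0_id hermite_poly.simps(1) le_0_eq smult_one)
  then show ?case by (intro exI[of _ "coeff p"]) simp
next
  case (Suc n)
  define q where "q = p - smult (coeff p (Suc n) / 2 ^ Suc n) (hermite_poly (Suc n))"
  have "degree q \<le> n"
  proof (rule degree_le, intro allI impI)
    fix i assume "n < i"
    then consider "i = Suc n" | "Suc n < i" by linarith
    then show "coeff q i = 0"
      using Suc.prems coeff_hermite_poly[of "Suc n"]
      by cases (simp_all add: q_def coeff_eq_0 del: hermite_poly.simps)
  qed
  then obtain a where a: "q = (\<Sum>i\<le>n. smult (a i) (hermite_poly i))"
    using Suc.IH by blast
  let ?a = "a(Suc n := coeff p (Suc n) / 2 ^ Suc n)"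
  have "p = q + smult (coeff p (Suc n) / 2 ^ Suc n) (hermite_poly (Suc n))"
    by (simp add: q_def)
  also have "q = (\<Sum>i\<le>n. smult (?a i) (hermite_poly i))"
    unfolding a by (intro sum.cong) auto
  finally have "p = (\<Sum>i\<le>Suc n. smult (?a i) (hermite_poly i))"
    by (simp del: hermite_poly.simps)
  then show ?case by blast
qed

section \<open>Square integrable functions\<close>

definition sq_integrable :: "'a measure \<Rightarrow> ('a \<Rightarrow> complex) \<Rightarrow> bool" where
  "sq_integrable M f \<longleftrightarrow> f \<in> borel_measurable M \<and> integrable M (\<lambda>x. (cmod (f x))\<^sup>2)"

definition L2_seminorm :: "'a measure \<Rightarrow> ('a \<Rightarrow> complex) \<Rightarrow> real" where
  "L2_seminorm M f = sqrt (\<integral>x. (cmod (f x))\<^sup>2 \<partial>M)"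

text \<open>Closure for the seminorm, formed among functions rather than classes. Each approximant
  has to be square integrable, so E may be given as a set for which this has not been
  established.\<close>

definition L2_closure :: "'a measure \<Rightarrow> ('a \<Rightarrow> complex) set \<Rightarrow> ('a \<Rightarrow> complex) set" where
  "L2_closure M E = {f. sq_integrable M f \<and>
     (\<forall>\<epsilon>>0. \<exists>g\<in>E. sq_integrable M g \<and> L2_seminorm M (\<lambda>x. f x - g x) < \<epsilon>)}"

lemma L2_seminorm_nonneg [simp]: "L2_seminorm M f \<ge> 0"
  by (simp add: L2_seminorm_def)

lemma sq_integrable_measurable [measurable_dest]:
  "sq_integrable M f \<Longrightarrow> f \<in> borel_measurable M"
  by (simp add: sq_integrable_def)

lemma sq_integrable_bound:
  assumes "integrable M h" "f \<in> borel_measurable M" "AE x in M. (cmod (f x))\<^sup>2 \<le> h x"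
  shows "sq_integrable M f"
  unfolding sq_integrable_def
proof (intro conjI assms(2) Bochner_Integration.integrable_bound[OF assms(1)])
  show "(\<lambda>x. (cmod (f x))\<^sup>2) \<in> borel_measurable M"
    using assms(2) by measurable
  show "AE x in M. norm ((cmod (f x))\<^sup>2) \<le> norm (h x)"
    using assms(3) by eventually_elim simp
qed

text \<open>Young's inequality with a free weight s. The choice s = 1 gives the crude bound by twice
  the squares, an adapted s gives the sharp triangle inequality.\<close>

lemma norm_add_square_le:
  fixes a b :: "'a::real_normed_vector"
  assumes "s > 0"
  shows "(norm (a + b))\<^sup>2 \<le> (1 + s) * (norm a)\<^sup>2 + (1 + 1 / s) * (norm b)\<^sup>2"
proof -
  have "(norm (a + b))\<^sup>2 \<le> (norm a + norm b)\<^sup>2"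
    by (intro power_mono norm_triangle_ineq) simp
  moreover have "0 \<le> (sqrt s * norm a - norm b / sqrt s)\<^sup>2" by simp
  then have "2 * norm a * norm b \<le> s * (norm a)\<^sup>2 + (norm b)\<^sup>2 / s"
    using assms by (simp add: power2_diff power_mult_distrib power_divide)
  ultimately show ?thesis by (simp add: power2_sum algebra_simps)
qed

lemma sq_integrable_add:
  assumes "sq_integrable M f" "sq_integrable M g"
  shows "sq_integrable M (\<lambda>x. f x + g x)"
proof (rule sq_integrable_bound)
  show "integrable M (\<lambda>x. 2 * (cmod (f x))\<^sup>2 + 2 * (cmod (g x))\<^sup>2)"
    using assms by (auto simp: sq_integrable_def)
  show "AE x in M. (cmod (f x + g x))\<^sup>2 \<le> 2 * (cmod (f x))\<^sup>2 + 2 * (cmod (g x))\<^sup>2"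
    by (intro AE_I2 order_trans[OF norm_add_square_le[of 1]]) simp_all
qed (use assms in simp)

lemma sq_integrable_cmult:
  assumes "sq_integrable M f"
  shows "sq_integrable M (\<lambda>x. c * f x)"
  using assms by (auto simp: sq_integrable_def norm_mult power_mult_distrib)

lemma sq_integrable_diff:
  assumes "sq_integrable M f" "sq_integrable M g"
  shows "sq_integrable M (\<lambda>x. f x - g x)"
  using sq_integrable_add[OF assms(1) sq_integrable_cmult[OF assms(2), of "-1"]] by simp

lemma sq_integrable_zero [simp]: "sq_integrable M (\<lambda>x. 0)"
  by (simp add: sq_integrable_def)

lemma sq_integrable_mult_integrable:
  assumes f: "sq_integrable M f" and g: "sq_integrable M g"
  shows "integrable M (\<lambda>x. f x * cnj (g x))"
proof (rule Bochner_Integration.integrable_bound)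
  show "integrable M (\<lambda>x. (cmod (f x))\<^sup>2 + (cmod (g x))\<^sup>2)"
    using assms by (auto simp: sq_integrable_def)
  have "a * b \<le> a\<^sup>2 + b\<^sup>2" for a b :: real
    using sum_squares_bound[of a b] sum_power2_ge_zero[of a b] by linarith
  then show "AE x in M. cmod (f x * cnj (g x)) \<le> norm ((cmod (f x))\<^sup>2 + (cmod (g x))\<^sup>2)"
    by (simp add: norm_mult)
  show "(\<lambda>x. f x * cnj (g x)) \<in> borel_measurable M"
    using f g by (intro borel_measurable_times measurable_compose[OF _ borel_measurable_continuous_onI[OF continuous_on_cnj]])
      (auto simp: sq_integrable_def)
qed

lemma L2_seminorm_power2: "(L2_seminorm M f)\<^sup>2 = (\<integral>x. (cmod (f x))\<^sup>2 \<partial>M)"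
  by (simp add: L2_seminorm_def)

lemma L2_seminorm_cmult: "L2_seminorm M (\<lambda>x. c * f x) = cmod c * L2_seminorm M f"
  by (simp add: L2_seminorm_def norm_mult power_mult_distrib real_sqrt_mult)

text \<open>With a and b upper bounds for the two seminorms, the weight s = b / a turns the
  pointwise inequality into the bound (a + b)^2 after integration. Enlarging both by e / 2 keeps
  them positive, so the quotient is meaningful.\<close>

lemma L2_seminorm_triangle:
  assumes f: "sq_integrable M f" and g: "sq_integrable M g"
  shows "L2_seminorm M (\<lambda>x. f x + g x) \<le> L2_seminorm M f + L2_seminorm M g"
proof (rule field_le_epsilon)
  fix e :: real assume e: "e > 0"
  define a where "a = L2_seminorm M f + e / 2"
  define b where "b = L2_seminorm M g + e / 2"
  have ab: "a > 0" "b > 0" "L2_seminorm M f \<le> a" "L2_seminorm M g \<le> b"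
    using e by (auto simp: a_def b_def intro: add_nonneg_pos)
  have "(L2_seminorm M (\<lambda>x. f x + g x))\<^sup>2 \<le>
      (\<integral>x. (1 + b / a) * (cmod (f x))\<^sup>2 + (1 + 1 / (b / a)) * (cmod (g x))\<^sup>2 \<partial>M)"
    unfolding L2_seminorm_power2 using f g sq_integrable_add[OF f g] ab
    by (intro integral_mono norm_add_square_le) (auto simp: sq_integrable_def)
  also have "\<dots> = (1 + b / a) * (L2_seminorm M f)\<^sup>2 + (1 + a / b) * (L2_seminorm M g)\<^sup>2"
    using f g unfolding L2_seminorm_power2 by (simp add: sq_integrable_def)
  also have "\<dots> \<le> (1 + b / a) * a\<^sup>2 + (1 + a / b) * b\<^sup>2"
    using ab by (intro add_mono mult_left_mono power_mono) auto
  also have "\<dots> = (a + b)\<^sup>2"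
    using ab by (simp add: field_simps power2_eq_square)
  finally have "L2_seminorm M (\<lambda>x. f x + g x) \<le> a + b"
    by (rule power2_le_imp_le) (use ab in simp)
  then show "L2_seminorm M (\<lambda>x. f x + g x) \<le> L2_seminorm M f + L2_seminorm M g + e"
    by (simp add: a_def b_def)
qed

lemma L2_seminorm_triangle_diff:
  assumes "sq_integrable M f" "sq_integrable M g" "sq_integrable M h"
  shows "L2_seminorm M (\<lambda>x. f x - h x) \<le> L2_seminorm M (\<lambda>x. f x - g x) + L2_seminorm M (\<lambda>x. g x - h x)"
  using L2_seminorm_triangle[OF sq_integrable_diff[OF assms(1,2)] sq_integrable_diff[OF assms(2,3)]]
  by simp

lemma L2_seminorm_cong_AE:
  assumes "AE x in M. f x = g x" "f \<in> borel_measurable M" "g \<in> borel_measurable M"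
  shows "L2_seminorm M f = L2_seminorm M g"
  unfolding L2_seminorm_def
proof (intro arg_cong[where f = sqrt] integral_cong_AE)
  show "AE x in M. (cmod (f x))\<^sup>2 = (cmod (g x))\<^sup>2"
    using assms(1) by eventually_elim simp
qed (use assms in measurable)

lemma sq_integrable_cong_AE:
  assumes "AE x in M. f x = g x" "sq_integrable M f" "g \<in> borel_measurable M"
  shows "sq_integrable M g"
proof (rule sq_integrable_bound[OF _ assms(3)])
  show "integrable M (\<lambda>x. (cmod (f x))\<^sup>2)"
    using assms(2) by (simp add: sq_integrable_def)
  show "AE x in M. (cmod (g x))\<^sup>2 \<le> (cmod (f x))\<^sup>2"
    using assms(1) by eventually_elim simp
qed

lemma L2_dominated_convergence:
  assumes u: "\<And>i. u i \<in> borel_measurable M" and f: "f \<in> borel_measurable M"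
    and lim: "AE x in M. (\<lambda>i. u i x) \<longlonglongrightarrow> f x"
    and h: "integrable M h" and bound: "\<And>i. AE x in M. (cmod (u i x))\<^sup>2 \<le> h x"
  shows "sq_integrable M f" and "\<And>i. sq_integrable M (u i)"
    and "(\<lambda>i. L2_seminorm M (\<lambda>x. f x - u i x)) \<longlonglongrightarrow> 0"
proof -
  show u2: "sq_integrable M (u i)" for i
    by (rule sq_integrable_bound[OF h u bound])
  have all: "AE x in M. \<forall>i. (cmod (u i x))\<^sup>2 \<le> h x"
    unfolding AE_all_countable using bound by blast
  have fh: "AE x in M. (cmod (f x))\<^sup>2 \<le> h x"
    using all lim
  proof eventually_elim
    case (elim x)
    have "(\<lambda>i. (cmod (u i x))\<^sup>2) \<longlonglongrightarrow> (cmod (f x))\<^sup>2"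
      using elim(2) by (intro tendsto_intros)
    then show ?case
      by (rule LIMSEQ_le_const2) (use elim(1) in auto)
  qed
  show f2: "sq_integrable M f"
    by (rule sq_integrable_bound[OF h f fh])
  have "(\<lambda>i. \<integral>x. (cmod (f x - u i x))\<^sup>2 \<partial>M) \<longlonglongrightarrow> (\<integral>x. 0 \<partial>M)"
  \<comment> \<open>The squares of f and of u i are both at most h, so the square of the difference
    is at most 2 h + 2 h.\<close>
  proof (rule integral_dominated_convergence[where w = "\<lambda>x. 4 * h x"])
    show "integrable M (\<lambda>x. 4 * h x)" using h by simp
    show "AE x in M. (\<lambda>i. (cmod (f x - u i x))\<^sup>2) \<longlonglongrightarrow> 0"
      using lim
    proof eventually_elim
      case (elim x)
      have "(\<lambda>i. (cmod (f x - u i x))\<^sup>2) \<longlonglongrightarrow> (cmod (f x - f x))\<^sup>2"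
        by (intro tendsto_intros elim)
      then show ?case by simp
    qed
    show "AE x in M. norm ((cmod (f x - u i x))\<^sup>2) \<le> 4 * h x" for i
      using bound[of i] fh
    proof eventually_elim
      case (elim x)
      then show ?case
        using norm_add_square_le[of 1 "f x" "- u i x"] by simp
    qed
  qed (use u f in \<open>measurable\<close>)
  then have "(\<lambda>i. sqrt (\<integral>x. (cmod (f x - u i x))\<^sup>2 \<partial>M)) \<longlonglongrightarrow> sqrt 0"
    by (intro tendsto_real_sqrt) simp
  then show "(\<lambda>i. L2_seminorm M (\<lambda>x. f x - u i x)) \<longlonglongrightarrow> 0"
    by (simp add: L2_seminorm_def)
qed

section \<open>Closed spans in the L2 seminorm\<close>

lemma L2_closure_sq_integrable: "f \<in> L2_closure M E \<Longrightarrow> sq_integrable M f"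
  by (simp add: L2_closure_def)

lemma L2_closure_base:
  "f \<in> E \<Longrightarrow> sq_integrable M f \<Longrightarrow> f \<in> L2_closure M E"
  unfolding L2_closure_def by (auto intro!: bexI[of _ f] simp: L2_seminorm_def)

lemma L2_closure_closed:
  assumes f: "sq_integrable M f"
    and approx: "\<And>\<epsilon>. \<epsilon> > 0 \<Longrightarrow> \<exists>g\<in>L2_closure M E. L2_seminorm M (\<lambda>x. f x - g x) < \<epsilon>"
  shows "f \<in> L2_closure M E"
  unfolding L2_closure_def
proof (intro CollectI conjI allI impI f)
  fix \<epsilon> :: real assume "\<epsilon> > 0"
  then obtain g where g: "g \<in> L2_closure M E" "L2_seminorm M (\<lambda>x. f x - g x) < \<epsilon> / 2"
    using approx[of "\<epsilon> / 2"] by auto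
  then obtain h where h: "h \<in> E" "sq_integrable M h" "L2_seminorm M (\<lambda>x. g x - h x) < \<epsilon> / 2"
    using \<open>\<epsilon> > 0\<close> unfolding L2_closure_def by (auto dest: spec[of _ "\<epsilon> / 2"])
  have "L2_seminorm M (\<lambda>x. f x - h x) < \<epsilon>"
    using L2_seminorm_triangle_diff[OF f L2_closure_sq_integrable[OF g(1)] h(2)] g(2) h(3) by simp
  then show "\<exists>g\<in>E. sq_integrable M g \<and> L2_seminorm M (\<lambda>x. f x - g x) < \<epsilon>"
    using h by blast
qed

lemma L2_closure_mono_closure:
  assumes "\<And>g. g \<in> E \<Longrightarrow> g \<in> L2_closure M F"
  shows "L2_closure M E \<subseteq> L2_closure M F"
proof
  fix f assume f: "f \<in> L2_closure M E"
  show "f \<in> L2_closure M F"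
  proof (rule L2_closure_closed)
    show "sq_integrable M f" using f by (rule L2_closure_sq_integrable)
    show "\<exists>g\<in>L2_closure M F. L2_seminorm M (\<lambda>x. f x - g x) < \<epsilon>" if "\<epsilon> > 0" for \<epsilon>
      using f that assms unfolding L2_closure_def[of M E] by blast
  qed
qed

lemma L2_closure_cong_AE:
  assumes f: "f \<in> L2_closure M E" and eq: "AE x in M. f x = g x" and g: "g \<in> borel_measurable M"
  shows "g \<in> L2_closure M E"
proof (rule L2_closure_closed)
  have fm: "f \<in> borel_measurable M"
    using L2_closure_sq_integrable[OF f] by (simp add: sq_integrable_def)
  show "sq_integrable M g"
    by (rule sq_integrable_cong_AE[OF eq L2_closure_sq_integrable[OF f] g])
  have "L2_seminorm M (\<lambda>x. g x - f x) = L2_seminorm M (\<lambda>x. 0)"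
    using eq fm g by (intro L2_seminorm_cong_AE) (auto elim: eventually_mono)
  then show "\<exists>h\<in>L2_closure M E. L2_seminorm M (\<lambda>x. g x - h x) < \<epsilon>" if "\<epsilon> > 0" for \<epsilon>
    using f that by (intro bexI[of _ f]) (auto simp: L2_seminorm_def)
qed

text \<open>The device by which closures are enlarged below: polynomial, simple and Taylor
  approximations all enter through pointwise limits whose squares have an integrable
  majorant.\<close>

lemma L2_closure_dominated:
  assumes u: "\<And>i. u i \<in> L2_closure M E" and f: "f \<in> borel_measurable M"
    and lim: "AE x in M. (\<lambda>i. u i x) \<longlonglongrightarrow> f x"
    and h: "integrable M h" and bound: "\<And>i. AE x in M. (cmod (u i x))\<^sup>2 \<le> h x"
  shows "f \<in> L2_closure M E"
proof -
  have um: "u i \<in> borel_measurable M" for i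
    using L2_closure_sq_integrable[OF u] by (simp add: sq_integrable_def)
  note conv = L2_dominated_convergence[OF um f lim h bound]
  show ?thesis
  proof (rule L2_closure_closed[OF conv(1)])
    fix \<epsilon> :: real assume "\<epsilon> > 0"
    then obtain i where "L2_seminorm M (\<lambda>x. f x - u i x) < \<epsilon>"
      using conv(3) by (metis (no_types, lifting) eventually_sequentially order_refl order_tendstoD(2))
    then show "\<exists>g\<in>L2_closure M E. L2_seminorm M (\<lambda>x. f x - g x) < \<epsilon>"
      using u by blast
  qed
qed

lemma L2_closure_cmult:
  assumes f: "f \<in> L2_closure M E" and E: "\<And>g. g \<in> E \<Longrightarrow> (\<lambda>x. c * g x) \<in> E"
  shows "(\<lambda>x. c * f x) \<in> L2_closure M E"
  unfolding L2_closure_def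
proof (intro CollectI conjI allI impI)
  show "sq_integrable M (\<lambda>x. c * f x)"
    by (intro sq_integrable_cmult L2_closure_sq_integrable[OF f])
  fix \<epsilon> :: real assume "\<epsilon> > 0"
  \<comment> \<open>The added 1 keeps the denominator positive when c = 0.\<close>
  then obtain g where g: "g \<in> E" "sq_integrable M g" "L2_seminorm M (\<lambda>x. f x - g x) < \<epsilon> / (cmod c + 1)"
    using f unfolding L2_closure_def by (auto dest!: spec[of _ "\<epsilon> / (cmod c + 1)"] simp: add_nonneg_pos)
  have "L2_seminorm M (\<lambda>x. c * f x - c * g x) = cmod c * L2_seminorm M (\<lambda>x. f x - g x)"
    unfolding L2_seminorm_cmult[symmetric] by (simp add: algebra_simps)
  also have "\<dots> \<le> (cmod c + 1) * L2_seminorm M (\<lambda>x. f x - g x)"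
    by (intro mult_right_mono) auto
  also have "\<dots> < \<epsilon>"
    using g(3) by (simp add: pos_less_divide_eq add_nonneg_pos mult.commute)
  finally show "\<exists>g\<in>E. sq_integrable M g \<and> L2_seminorm M (\<lambda>x. c * f x - g x) < \<epsilon>"
    using g E by (intro bexI[of _ "\<lambda>x. c * g x"]) (auto intro: sq_integrable_cmult)
qed

lemma L2_closure_add:
  assumes f: "f \<in> L2_closure M E" and g: "g \<in> L2_closure M E"
    and E: "\<And>f g. f \<in> E \<Longrightarrow> g \<in> E \<Longrightarrow> (\<lambda>x. f x + g x) \<in> E"
  shows "(\<lambda>x. f x + g x) \<in> L2_closure M E"
  unfolding L2_closure_def
proof (intro CollectI conjI allI impI)
  show "sq_integrable M (\<lambda>x. f x + g x)"
    by (rule sq_integrable_add[OF L2_closure_sq_integrable[OF f] L2_closure_sq_integrable[OF g]])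
  fix \<epsilon> :: real assume "\<epsilon> > 0"
  then have half: "\<epsilon> / 2 > 0" by simp
  obtain f' where f': "f' \<in> E" "sq_integrable M f'" "L2_seminorm M (\<lambda>x. f x - f' x) < \<epsilon> / 2"
    using f half unfolding L2_closure_def by blast
  obtain g' where g': "g' \<in> E" "sq_integrable M g'" "L2_seminorm M (\<lambda>x. g x - g' x) < \<epsilon> / 2"
    using g half unfolding L2_closure_def by blast
  have "L2_seminorm M (\<lambda>x. (f x - f' x) + (g x - g' x)) < \<epsilon>"
    using L2_seminorm_triangle[OF sq_integrable_diff[OF L2_closure_sq_integrable[OF f] f'(2)]
        sq_integrable_diff[OF L2_closure_sq_integrable[OF g] g'(2)]] f'(3) g'(3) by simp
  then show "\<exists>h\<in>E. sq_integrable M h \<and> L2_seminorm M (\<lambda>x. f x + g x - h x) < \<epsilon>"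
    using E[OF f'(1) g'(1)] sq_integrable_add[OF f'(2) g'(2)]
    by (intro bexI[of _ "\<lambda>x. f' x + g' x"]) (simp_all add: algebra_simps)
qed

lemma L2_closure_sum:
  assumes f: "\<And>i. i \<in> I \<Longrightarrow> f i \<in> L2_closure M E" and zero: "(\<lambda>x. 0) \<in> E"
    and E: "\<And>f g. f \<in> E \<Longrightarrow> g \<in> E \<Longrightarrow> (\<lambda>x. f x + g x) \<in> E"
  shows "(\<lambda>x. \<Sum>i\<in>I. f i x) \<in> L2_closure M E"
  using f
proof (induction I rule: infinite_finite_induct)
  case (insert i I)
  have "(\<lambda>x. f i x + (\<Sum>i\<in>I. f i x)) \<in> L2_closure M E"
    by (rule L2_closure_add[OF _ _ E]) (use insert in auto)
  then show ?case using insert.hyps by simp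
qed (simp_all add: L2_closure_base[OF zero])

section \<open>Density of bounded function algebras\<close>

text \<open>Finiteness of the measure makes every bounded member square integrable. Members of the
  form \<open>of_real (g x)\<close> are the ones that will produce sets, through their superlevel
  sets.\<close>

locale bounded_function_algebra = finite_measure +
  fixes A :: "('a \<Rightarrow> complex) set"
  assumes const: "(\<lambda>x. c) \<in> A"
    and add: "f \<in> A \<Longrightarrow> g \<in> A \<Longrightarrow> (\<lambda>x. f x + g x) \<in> A"
    and mult: "f \<in> A \<Longrightarrow> g \<in> A \<Longrightarrow> (\<lambda>x. f x * g x) \<in> A"
    and measurable: "f \<in> A \<Longrightarrow> f \<in> borel_measurable M"
    and bounded: "f \<in> A \<Longrightarrow> \<exists>C. \<forall>x\<in>space M. cmod (f x) \<le> C"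
begin

lemma cmult: "f \<in> A \<Longrightarrow> (\<lambda>x. c * f x) \<in> A"
  using mult[OF const] .

lemma power: "f \<in> A \<Longrightarrow> (\<lambda>x. f x ^ n) \<in> A"
proof (induction n)
  case 0
  then show ?case using const[of 1] by simp
next
  case (Suc n)
  then show ?case using mult[of f "\<lambda>x. f x ^ n"] by simp
qed

lemma sum_closed: "(\<And>i. i \<in> I \<Longrightarrow> f i \<in> A) \<Longrightarrow> (\<lambda>x. \<Sum>i\<in>I. f i x) \<in> A"
proof (induction I rule: infinite_finite_induct)
  case (insert i I)
  have "(\<lambda>x. f i x + (\<Sum>i\<in>I. f i x)) \<in> A"
    using add[OF insert.prems[OF insertI1] insert.IH[OF insert.prems[OF insertI2]]] .
  then show ?case using insert.hyps by simp
qed (use const[of 0] in simp_all)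

lemma sq_integrable:
  assumes f: "f \<in> A"
  shows "sq_integrable M f"
proof -
  obtain C where C: "\<forall>x\<in>space M. cmod (f x) \<le> C" using bounded[OF f] by blast
  have "(cmod (f x))\<^sup>2 \<le> C\<^sup>2" if "x \<in> space M" for x
    using C that by (intro power_mono) auto
  then show ?thesis
    by (intro sq_integrable_bound[OF integrable_const measurable[OF f]] AE_I2)
qed

text \<open>Uniformly bounded pointwise limits are used rather than L2 limits: they are preserved by
  products, so the family is stable under intersections, as a generator for a Dynkin argument must
  be.\<close>

definition bd_approximable :: "'a set set" where
  "bd_approximable = {X. X \<subseteq> space M \<and> (\<exists>F C. (\<forall>n::nat. F n \<in> A) \<and>
     (\<forall>n. \<forall>x\<in>space M. cmod (F n x) \<le> C) \<and> (\<forall>x\<in>space M. (\<lambda>n. F n x) \<longlonglongrightarrow> indicator X x))}"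

lemma Int_stable_bd_approximable: "Int_stable bd_approximable"
proof (rule Int_stableI)
  fix X Y assume X: "X \<in> bd_approximable" and Y: "Y \<in> bd_approximable"
  from X obtain F C where F: "X \<subseteq> space M" "\<And>n::nat. F n \<in> A"
    "\<And>n x. x \<in> space M \<Longrightarrow> cmod (F n x) \<le> C" "\<And>x. x \<in> space M \<Longrightarrow> (\<lambda>n. F n x) \<longlonglongrightarrow> indicator X x"
    unfolding bd_approximable_def by blast
  from Y obtain G K where G: "Y \<subseteq> space M" "\<And>n::nat. G n \<in> A"
    "\<And>n x. x \<in> space M \<Longrightarrow> cmod (G n x) \<le> K" "\<And>x. x \<in> space M \<Longrightarrow> (\<lambda>n. G n x) \<longlonglongrightarrow> indicator Y x"
    unfolding bd_approximable_def by blast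
  show "X \<inter> Y \<in> bd_approximable"
    unfolding bd_approximable_def
  proof (intro CollectI conjI exI[of _ "\<lambda>n x. F n x * G n x"] exI[of _ "C * K"] allI ballI)
    show "cmod (F n x * G n x) \<le> C * K" if "x \<in> space M" for n x
      using F(3)[OF that, of n] G(3)[OF that, of n] order_trans[OF norm_ge_zero F(3)[OF that, of n]]
      unfolding norm_mult by (intro mult_mono) auto
    show "(\<lambda>n. F n x * G n x) \<longlonglongrightarrow> indicator (X \<inter> Y) x" if "x \<in> space M" for x
      unfolding indicator_inter_arith by (intro tendsto_mult F(4) G(4) that)
  qed (use F G mult in auto)
qed

text \<open>The ramps \<phi> n climb from 0 to 1 on [a, a + 1/n] and converge to the indicator of
  (a, \<infinity>). Weierstrass replaces each by a polynomial up to 1/(n + 1) on an interval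
  containing the range of g, and a polynomial in g stays in the algebra. The bound 2 is 1 for the
  ramp plus at most 1 for the error.\<close>

lemma superlevel_bd_approximable:
  assumes g: "(\<lambda>x. of_real (g x)) \<in> A"
  shows "{x\<in>space M. g x > a} \<in> bd_approximable"
proof -
  obtain C where C: "\<And>x. x \<in> space M \<Longrightarrow> \<bar>g x\<bar> \<le> C"
    using bounded[OF g] by auto
  define \<phi> where "\<phi> n t = min 1 (max 0 (real n * (t - a)))" for n t
  have "\<exists>q. real_polynomial_function q \<and> (\<forall>t\<in>{-C..C}. \<bar>\<phi> n t - q t\<bar> < 1 / (real n + 1))" for n
  proof -
    have "continuous_on {-C..C} (\<phi> n)"
      unfolding \<phi>_def by (intro continuous_intros)
    then show ?thesis
      using Stone_Weierstrass_real_polynomial_function[of "{-C..C}" "\<phi> n" "1 / (real n + 1)"]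
      by (metis compact_Icc divide_pos_pos of_nat_0_le_iff add_nonneg_pos zero_less_one)
  qed
  then obtain q where q: "\<And>n. real_polynomial_function (q n)"
    "\<And>n t. t \<in> {-C..C} \<Longrightarrow> \<bar>\<phi> n t - q n t\<bar> < 1 / (real n + 1)"
    by metis
  have q_in: "(\<lambda>x. of_real (q n (g x))) \<in> A" for n
  proof -
    obtain c k where "q n = (\<lambda>x. \<Sum>i\<le>k. c i * x ^ i)"
      using q(1) real_polynomial_function_iff_sum by blast
    then have "(\<lambda>x. of_real (q n (g x))) = (\<lambda>x. \<Sum>i\<le>k. of_real (c i) * (of_real (g x) :: complex) ^ i)"
      by simp
    then show ?thesis by (simp only:) (intro sum_closed cmult power g)
  qed
  have lim: "(\<lambda>n. q n t) \<longlonglongrightarrow> (if t > a then 1 else 0)" if "t \<in> {-C..C}" for t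
  proof -
    have "(\<lambda>n. q n t - \<phi> n t) \<longlonglongrightarrow> 0"
    proof (rule Lim_null_comparison)
      show "eventually (\<lambda>n. norm (q n t - \<phi> n t) \<le> 1 / (real n + 1)) sequentially"
        using q(2)[OF that] by (intro always_eventually) (simp add: abs_minus_commute less_imp_le)
      show "(\<lambda>n. 1 / (real n + 1)) \<longlonglongrightarrow> 0"
        using LIMSEQ_inverse_real_of_nat by (simp add: inverse_eq_divide add.commute)
    qed
    moreover have "(\<lambda>n. \<phi> n t) \<longlonglongrightarrow> (if t > a then 1 else 0)"
    proof (cases "t > a")
      case True
      then obtain N where N: "1 / (t - a) \<le> real N" using real_arch_simple by blast
      have "eventually (\<lambda>n. \<phi> n t = 1) sequentially"
        using eventually_ge_at_top[of N]
      proof eventually_elim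
        case (elim n)
        have "1 / (t - a) \<le> real n" using N elim by simp
        then have "1 \<le> real n * (t - a)" using True by (simp add: divide_le_eq)
        then show ?case by (simp add: \<phi>_def)
      qed
      then show ?thesis using True by (simp add: tendsto_eventually)
    next
      case False
      then have "\<phi> n t = 0" for n by (simp add: \<phi>_def mult_nonneg_nonpos)
      then show ?thesis using False by simp
    qed
    ultimately show ?thesis using tendsto_add by fastforce
  qed
  have bnd: "\<bar>q n t\<bar> \<le> 2" if "t \<in> {-C..C}" for n t
  proof -
    have "\<bar>\<phi> n t\<bar> \<le> 1" by (auto simp: \<phi>_def)
    moreover have "1 / (real n + 1) \<le> 1" by (simp add: field_simps)
    ultimately show ?thesis using q(2)[OF that, of n] by linarith
  qed
  have in_C: "g x \<in> {-C..C}" if "x \<in> space M" for x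
    using C[OF that] by auto
  show ?thesis
    unfolding bd_approximable_def
  proof (intro CollectI conjI exI[of _ "\<lambda>n x. of_real (q n (g x))"] exI[of _ 2] allI ballI q_in)
    show "cmod (of_real (q n (g x))) \<le> 2" if "x \<in> space M" for n x
      using bnd[OF in_C[OF that]] by simp
    show "(\<lambda>n. of_real (q n (g x))) \<longlonglongrightarrow> (indicator {x\<in>space M. g x > a} x :: complex)" if "x \<in> space M" for x
      using tendsto_of_real[OF lim[OF in_C[OF that]], where 'a = complex] that by (auto simp: indicator_def)
  qed auto
qed

text \<open>Dominated convergence, with constants as integrable majorants, gives the generating sets
  and the countable disjoint unions; complements follow because constants lie in the
  algebra.\<close>

lemma indicator_in_L2_closure:
  assumes "X \<in> sigma_sets (space M) bd_approximable"
  shows "indicator X \<in> L2_closure M A"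
proof -
  have sub: "bd_approximable \<subseteq> Pow (space M)"
    by (auto simp: bd_approximable_def)
  show ?thesis
    using Int_stable_bd_approximable sub assms
  proof (induction rule: sigma_sets_induct_disjoint)
    case (basic X)
    then obtain F C where F: "\<And>n::nat. F n \<in> A"
      "\<And>n x. x \<in> space M \<Longrightarrow> cmod (F n x) \<le> C" "\<And>x. x \<in> space M \<Longrightarrow> (\<lambda>n. F n x) \<longlonglongrightarrow> indicator X x"
      unfolding bd_approximable_def by blast
    show ?case
    proof (rule L2_closure_dominated[of F M A _ "\<lambda>_. C\<^sup>2"])
      show "F n \<in> L2_closure M A" for n
        using F(1) sq_integrable by (intro L2_closure_base) auto
      show "(indicator X :: 'a \<Rightarrow> complex) \<in> borel_measurable M"
        by (rule borel_measurable_LIMSEQ_metric[of F]) (use F measurable in auto)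
    qed (use F in \<open>auto intro!: AE_I2 power_mono\<close>)
  next
    case empty
    show ?case using sq_integrable[OF const[of 0]] const[of 0] by (auto intro: L2_closure_base)
  next
    case (compl X)
    have "(\<lambda>x. 1 + (-1) * indicator X x) \<in> L2_closure M A"
      by (rule L2_closure_add[OF L2_closure_base[OF const sq_integrable[OF const]]
            L2_closure_cmult[OF compl.IH cmult] add])
    then show ?case
    proof (rule L2_closure_cong_AE)
      show eq: "AE x in M. 1 + (-1) * indicator X x = (indicator (space M - X) x :: complex)"
        by (rule AE_I2) (auto simp: indicator_def)
      have "(indicator X :: 'a \<Rightarrow> complex) \<in> borel_measurable M"
        using L2_closure_sq_integrable[OF compl.IH] by (simp add: sq_integrable_def)
      then have "(\<lambda>x. 1 + (-1) * indicator X x :: complex) \<in> borel_measurable M" by measurable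
      then show "(indicator (space M - X) :: 'a \<Rightarrow> complex) \<in> borel_measurable M"
        by (rule measurable_cong[THEN iffD1, rotated]) (auto simp: indicator_def)
    qed
  next
    case (union X)
    have lim: "(\<lambda>n. \<Sum>i<n. indicator (X i) x) \<longlonglongrightarrow> (indicator (\<Union>i. X i) x :: complex)" for x
    proof -
      have "(\<lambda>n. of_real (\<Sum>i<n. indicator (X i) x)) \<longlonglongrightarrow> (of_real (indicator (\<Union>i. X i) x) :: complex)"
        using indicator_sums[of X x] union.hyps unfolding sums_def disjoint_family_on_def
        by (intro tendsto_of_real) auto
      moreover have "of_real (indicator Y x) = (indicator Y x :: complex)" for Y
        by (simp add: indicator_def)
      ultimately show ?thesis by simp
    qed
    have m: "(indicator (X i) :: 'a \<Rightarrow> complex) \<in> borel_measurable M" for i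
      using L2_closure_sq_integrable[OF union.IH] by (simp add: sq_integrable_def)
    show ?case
    proof (rule L2_closure_dominated[of "\<lambda>n x. \<Sum>i<n. indicator (X i) x" M A _ "\<lambda>_. 1"])
      show "(\<lambda>x. \<Sum>i<n. indicator (X i) x) \<in> L2_closure M A" for n
        using union.IH by (intro L2_closure_sum const add) auto
      show "(indicator (\<Union> (range X)) :: 'a \<Rightarrow> complex) \<in> borel_measurable M"
        by (rule borel_measurable_LIMSEQ_metric[OF _ lim]) (use m in auto)
      have "(\<Sum>i<n. indicator (X i) x :: complex) = indicator (\<Union>i<n. X i) x" for n x
        using union.hyps by (intro indicator_UN_disjoint[symmetric]) (auto simp: disjoint_family_on_def)
      then show "AE x in M. (cmod (\<Sum>i<n. indicator (X i) x))\<^sup>2 \<le> 1" for n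
        by (auto simp: indicator_def)
    qed (use lim in auto)
  qed
qed

text \<open>Simple functions converging to f can be chosen with modulus at most 2 |f|, which makes 4
  |f|^2 an integrable majorant. Their level sets lie in the generated \<sigma>-algebra, so their
  indicators are already in the closure.\<close>

theorem dense_in_L2:
  assumes f: "f \<in> borel_measurable (sigma (space M) bd_approximable)"
    and f2: "sq_integrable M f"
  shows "f \<in> L2_closure M A"
proof -
  let ?N = "sigma (space M) bd_approximable"
  have sub: "bd_approximable \<subseteq> Pow (space M)"
    by (auto simp: bd_approximable_def)
  have N: "sets ?N = sigma_sets (space M) bd_approximable" "space ?N = space M"
    using sub by simp_all
  obtain s where s: "\<And>i. simple_function ?N (s i)" "\<And>x. x \<in> space M \<Longrightarrow> (\<lambda>i. s i x) \<longlonglongrightarrow> f x"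
    "\<And>i x. x \<in> space M \<Longrightarrow> dist (s i x) 0 \<le> 2 * dist (f x) 0"
    using borel_measurable_implies_sequence_metric[OF f, of 0] unfolding N(2) by blast
  \<comment> \<open>A simple function has finitely many values, so this is a finite combination of
    indicators; it reproduces \<open>s i\<close> on the space.\<close>
  let ?s = "\<lambda>i x. \<Sum>y\<in>s i ` space M. y * indicator (s i -` {y} \<inter> space M) x"
  have in_closure: "(\<lambda>x. ?s i x) \<in> L2_closure M A" for i
  proof (intro L2_closure_sum L2_closure_cmult indicator_in_L2_closure const add cmult)
    fix y assume "y \<in> s i ` space M"
    show "s i -` {y} \<inter> space M \<in> sigma_sets (space M) bd_approximable"
      using simple_functionD(2)[OF s(1), of i "{y}"] unfolding N .
  qed
  have rep: "?s i x = s i x" if "x \<in> space M" for i x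
    using simple_function_indicator_representation_banach[OF s(1), of x i] that unfolding N(2)
    by (simp add: scaleR_conv_of_real mult.commute indicator_def of_bool_def if_distrib[of complex_of_real] cong: if_cong)
  show ?thesis
  proof (rule L2_closure_dominated[OF in_closure, where h = "\<lambda>x. 4 * (cmod (f x))\<^sup>2"])
    show "f \<in> borel_measurable M" "integrable M (\<lambda>x. 4 * (cmod (f x))\<^sup>2)"
      using f2 by (auto simp: sq_integrable_def)
    show "AE x in M. (\<lambda>i. ?s i x) \<longlonglongrightarrow> f x"
      by (rule AE_I2) (simp add: rep s(2))
    show "AE x in M. (cmod (?s i x))\<^sup>2 \<le> 4 * (cmod (f x))\<^sup>2" for i
    proof (rule AE_I2)
      fix x assume x: "x \<in> space M"
      have "(cmod (s i x))\<^sup>2 \<le> (2 * cmod (f x))\<^sup>2"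
        using s(3)[OF x, of i] by (intro power_mono) auto
      then show "(cmod (?s i x))\<^sup>2 \<le> 4 * (cmod (f x))\<^sup>2"
        by (simp add: rep[OF x] power_mult_distrib)
    qed
  qed
qed

end

section \<open>Splitting off the orthogonal complement\<close>

lemma orthonormal_basis_exists:
  fixes V :: "'a::euclidean_space set"
  assumes "subspace V"
  shows "\<exists>B. orthonormal_basis_of B V"
proof -
  obtain B where "pairwise orthogonal B" "\<And>x. x \<in> B \<Longrightarrow> norm x = 1" "span B = V"
    using orthonormal_basis_subspace[OF assms] by metis
  then show ?thesis by (auto simp: orthonormal_basis_of_def)
qed

text \<open>Restricted to the index set so that the values are points of the product measure space
  over {..<m}.\<close>

definition coords :: "nat \<Rightarrow> (nat \<Rightarrow> 'a::euclidean_space) \<Rightarrow> 'a \<Rightarrow> nat \<Rightarrow> real" where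
  "coords m b x = (\<lambda>j\<in>{..<m}. x \<bullet> b j)"

locale split_space =
  fixes V :: "'a::euclidean_space set" and m :: nat and b :: "nat \<Rightarrow> 'a"
  assumes subspace_V: "subspace V"
    and inj_b: "inj_on b {..<m}"
    and basis_b: "orthonormal_basis_of (b ` {..<m}) (orthogonal_comp V)"
begin

abbreviation N where "N \<equiv> (\<Pi>\<^sub>M j\<in>{..<m}. (lborel :: real measure))"
abbreviation crd where "crd \<equiv> coords m b"

definition perp :: "'a \<Rightarrow> 'a" where
  "perp x = (\<Sum>j<m. (x \<bullet> b j) *\<^sub>R b j)"

lemma b_inner: "i < m \<Longrightarrow> j < m \<Longrightarrow> b i \<bullet> b j = (if i = j then 1 else 0)"
  using orthonormal_inner[OF basis_b, of "b i" "b j"] inj_b by (auto simp: inj_on_eq_iff)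

lemma b_orthogonal: "j < m \<Longrightarrow> x \<in> V \<Longrightarrow> x \<bullet> b j = 0"
proof -
  assume j: "j < m" and x: "x \<in> V"
  have "b j \<in> orthogonal_comp V"
    using basis_b j span_base[of "b j" "b ` {..<m}"] by (auto simp: orthonormal_basis_of_def)
  then show ?thesis using x by (simp add: orthogonal_comp_def orthogonal_def)
qed

lemma perp_add: "perp (x + y) = perp x + perp y"
  by (simp add: perp_def inner_add_left scaleR_add_left sum.distrib)

lemma perp_diff: "perp (x - y) = perp x - perp y"
  by (simp add: perp_def inner_diff_left scaleR_diff_left sum_subtractf)

lemma perp_V: "x \<in> V \<Longrightarrow> perp x = 0"
  by (simp add: perp_def b_orthogonal)

lemma perp_inner: "j < m \<Longrightarrow> perp x \<bullet> b j = x \<bullet> b j"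
  by (simp add: perp_def inner_sum_left b_inner if_distrib[of "(*) _"] cong: if_cong)

lemma perp_in: "perp x \<in> orthogonal_comp V"
proof -
  have "perp x \<in> span (b ` {..<m})"
    unfolding perp_def by (intro span_sum span_scale span_base) auto
  then show ?thesis using basis_b by (simp add: orthonormal_basis_of_def)
qed

lemma V_orthogonal_perp: "y \<in> V \<Longrightarrow> y \<bullet> perp x = 0"
  using perp_in[of x] by (simp add: orthogonal_comp_def orthogonal_def)

text \<open>The difference is orthogonal to a basis of the complement, hence lies in the double
  complement, which is V.\<close>

lemma diff_perp_in: "x - perp x \<in> V"
proof -
  have "orthogonal (x - perp x) y" if "y \<in> span (b ` {..<m})" for y
    using that
  proof (rule orthogonal_to_span)
    show "orthogonal (x - perp x) y" if "y \<in> b ` {..<m}" for y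
      using that by (auto simp: orthogonal_def inner_diff_left perp_inner)
  qed
  then have "x - perp x \<in> orthogonal_comp (orthogonal_comp V)"
    using basis_b by (auto simp: orthonormal_basis_of_def orthogonal_comp_def orthogonal_commute)
  then show ?thesis using orthogonal_comp_self[OF subspace_V] by simp
qed

text \<open>Two admissible components differ by a vector lying both in V and in its complement,
  hence orthogonal to itself; this resolves the definite description.\<close>

lemma orth_proj_eq: "orth_proj V x = x - perp x"
  unfolding orth_proj_def
proof (rule the_equality)
  show "x - perp x \<in> V \<and> x - (x - perp x) \<in> orthogonal_comp V"
    using diff_perp_in perp_in by simp
  fix y assume y: "y \<in> V \<and> x - y \<in> orthogonal_comp V"
  have "(x - perp x) - y \<in> V"
    using y diff_perp_in subspace_V by (auto intro: subspace_diff)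
  moreover have "(x - y) - perp x \<in> orthogonal_comp V"
    using y perp_in subspace_orthogonal_comp by (auto intro: subspace_diff)
  moreover have "(x - y) - perp x = (x - perp x) - y" by simp
  ultimately have "orthogonal ((x - perp x) - y) ((x - perp x) - y)"
    by (auto simp: orthogonal_comp_def)
  then show "y = x - perp x" by (simp add: orthogonal_self)
qed

lemma norm_split: "(norm x)\<^sup>2 = (norm (x - perp x))\<^sup>2 + (\<Sum>j<m. (x \<bullet> b j)\<^sup>2)"
proof -
  have "(x - perp x) \<bullet> perp x = 0"
    by (rule V_orthogonal_perp[OF diff_perp_in])
  moreover have "perp x \<bullet> perp x = (\<Sum>j<m. (x \<bullet> b j)\<^sup>2)"
    by (subst (2) perp_def) (simp add: inner_sum_right perp_inner power2_eq_square)
  ultimately show ?thesis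
    by (simp add: power2_norm_eq_inner inner_diff_left inner_diff_right inner_commute)
qed

lemma continuous_perp: "continuous_on S perp"
  unfolding perp_def by (intro continuous_intros)

lemma measurable_perp [measurable]: "perp \<in> borel_measurable borel"
  by (rule borel_measurable_continuous_onI[OF continuous_perp])

lemma measurable_coords [measurable]: "crd \<in> measurable borel N"
  unfolding coords_def by (intro measurable_restrict) simp

lemma coords_add_V: "y \<in> V \<Longrightarrow> crd (x + y) = crd x"
  by (auto simp: coords_def inner_add_left b_orthogonal)

text \<open>Names the basis selected by the choice operator, of which only orthonormality is
  known.\<close>

lemma subspace_lebesgue_basis:
  obtains B where "orthonormal_basis_of B V"
    "subspace_lebesgue V = basis_lebesgue B"
  using someI_ex[OF orthonormal_basis_exists[OF subspace_V]] that
  unfolding subspace_lebesgue_def Let_def by blast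

text \<open>The hidden basis of V together with the vectors b j is an orthonormal basis of the whole
  space. Lebesgue measure is a product in its coordinates, and Fubini separates the two groups of
  coordinates, on which the two conditions depend separately.\<close>

lemma emeasure_lborel_split:
  assumes [measurable]: "Z \<in> sets borel" "A \<in> sets N"
  shows "emeasure lborel {x. x - perp x \<in> Z \<and> crd x \<in> A} =
      emeasure (subspace_lebesgue V) Z * emeasure N A"
    (is "emeasure _ ?S = _")
proof -
  obtain B where B: "orthonormal_basis_of B V"
    "subspace_lebesgue V = basis_lebesgue B"
    by (rule subspace_lebesgue_basis)
  define b' where "b' = b ` {..<m}"
  have BV: "x \<in> V" if "x \<in> B" for x
    using that B(1) span_base[of x B] by (simp add: orthonormal_basis_of_def)
  have b'V: "orthogonal x y" if "x \<in> V" "y \<in> b'" for x y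
    using that b_orthogonal by (auto simp: b'_def orthogonal_def)
  let ?B = "\<Pi>\<^sub>M x\<in>B. (lborel :: real measure)" and ?B' = "\<Pi>\<^sub>M x\<in>b'. (lborel :: real measure)"
  have disj: "B \<inter> b' = {}"
  proof (rule ccontr)
    assume "B \<inter> b' \<noteq> {}"
    then obtain x where x: "x \<in> B" "x \<in> b'" by auto
    then have "x = 0" using b'V[OF BV, of x x] by (simp add: orthogonal_self)
    then show False using x B(1) by (auto simp: orthonormal_basis_of_def)
  qed
  have fin: "finite B" "finite b'"
    using orthonormal_basis_of_finite(1)[OF B(1)] by (auto simp: b'_def)
  have C: "orthonormal_basis_of (B \<union> b') UNIV"
    unfolding orthonormal_basis_of_def
  proof (intro conjI ballI)
    show "pairwise orthogonal (B \<union> b')"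
      using B(1) basis_b b'V[OF BV] b'V[OF BV, THEN orthogonal_commute[THEN iffD1]]
      unfolding orthonormal_basis_of_def b'_def[symmetric] pairwise_def
      by auto
    show "norm c = 1" if "c \<in> B \<union> b'" for c
      using that B(1) basis_b unfolding orthonormal_basis_of_def b'_def[symmetric] by auto
    have "x \<in> span (B \<union> b')" for x
    proof -
      have "x - perp x \<in> span (B \<union> b')"
        using diff_perp_in[of x] B(1) span_mono[of B "B \<union> b'"] by (auto simp: orthonormal_basis_of_def)
      moreover have "perp x \<in> span (B \<union> b')"
        using perp_in[of x] basis_b span_mono[of b' "B \<union> b'"] by (auto simp: orthonormal_basis_of_def b'_def)
      ultimately have "(x - perp x) + perp x \<in> span (B \<union> b')" by (rule span_add)
      then show ?thesis by simp
    qed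
    then show "span (B \<union> b') = UNIV" by blast
  qed
  interpret product_sigma_finite "\<lambda>_::'a. lborel :: real measure" ..
  define \<Psi> where "\<Psi> c = (\<Sum>x\<in>B \<union> b'. c x *\<^sub>R x)" for c :: "'a \<Rightarrow> real"
  have \<Psi>_merge: "\<Psi> (merge B b' (y, z)) = (\<Sum>x\<in>B. y x *\<^sub>R x) + (\<Sum>j<m. z (b j) *\<^sub>R b j)" for y z
  proof -
    have "\<Psi> (merge B b' (y, z)) = (\<Sum>x\<in>B. y x *\<^sub>R x) + (\<Sum>x\<in>b'. z x *\<^sub>R x)"
      unfolding \<Psi>_def using fin disj
      by (subst sum.union_disjoint) (auto intro!: arg_cong2[where f = "(+)"] sum.cong simp: merge_def)
    then show ?thesis by (simp add: b'_def sum.reindex[OF inj_b])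
  qed
  have sum_in_V: "(\<Sum>x\<in>B. y x *\<^sub>R x) \<in> V" for y
    using subspace_V BV by (intro subspace_sum subspace_scale) auto
  have inner_merge: "\<Psi> (merge B b' (y, z)) \<bullet> b j = z (b j)" if "j < m" for y z j
    using that b_orthogonal[OF that sum_in_V]
    by (simp add: \<Psi>_merge inner_add_left inner_sum_left b_inner if_distrib[of "(*) _"] cong: if_cong)
  have perp_merge: "perp (\<Psi> (merge B b' (y, z))) = (\<Sum>j<m. z (b j) *\<^sub>R b j)" for y z
    unfolding perp_def by (intro sum.cong refl) (simp add: inner_merge)
  have coords_merge: "crd (\<Psi> (merge B b' (y, z))) = (\<lambda>j\<in>{..<m}. z (b j))" for y z
    unfolding coords_def by (rule restrict_ext) (simp add: inner_merge)
  have diff_merge: "\<Psi> (merge B b' (y, z)) - perp (\<Psi> (merge B b' (y, z))) = (\<Sum>x\<in>B. y x *\<^sub>R x)" for y z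
    by (simp only: perp_merge) (simp add: \<Psi>_merge)
  have [measurable]: "\<Psi> \<in> measurable (\<Pi>\<^sub>M x\<in>B \<union> b'. lborel) borel"
    unfolding \<Psi>_def by measurable
  have m [measurable]: "(\<lambda>z. \<lambda>j\<in>{..<m}. z (b j)) \<in> measurable ?B' N"
    by (intro measurable_restrict measurable_component_singleton) (auto simp: b'_def)
  have [measurable]: "?S \<in> sets borel"
    by measurable
  have "emeasure lborel ?S =
      (\<integral>\<^sup>+x. indicator ?S x \<partial>(distr (\<Pi>\<^sub>M x\<in>B \<union> b'. lborel) borel \<Psi>))"
    unfolding \<Psi>_def lborel_eq_orthonormal[OF C, symmetric] by simp
  also have "\<dots> = (\<integral>\<^sup>+c. indicator ?S (\<Psi> c) \<partial>(\<Pi>\<^sub>M x\<in>B \<union> b'. lborel))"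
    by (rule nn_integral_distr) measurable
  also have "\<dots> = (\<integral>\<^sup>+y. \<integral>\<^sup>+z. indicator ?S (\<Psi> (merge B b' (y, z)))
      \<partial>?B' \<partial>?B)"
    by (rule product_nn_integral_fold[OF disj fin]) measurable
  also have "\<dots> = (\<integral>\<^sup>+y. \<integral>\<^sup>+z. indicator Z (\<Sum>x\<in>B. y x *\<^sub>R x) * indicator A (\<lambda>j\<in>{..<m}. z (b j))
      \<partial>?B' \<partial>?B)"
    by (intro nn_integral_cong) (simp add: indicator_def diff_merge coords_merge of_bool_conj)
  also have "\<dots> = (\<integral>\<^sup>+y. indicator Z (\<Sum>x\<in>B. y x *\<^sub>R x) \<partial>?B) *
      (\<integral>\<^sup>+z. indicator A (\<lambda>j\<in>{..<m}. z (b j)) \<partial>?B')"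
    by (simp add: nn_integral_cmult nn_integral_multc)
  also have "(\<integral>\<^sup>+y. indicator Z (\<Sum>x\<in>B. y x *\<^sub>R x) \<partial>?B) = emeasure (subspace_lebesgue V) Z"
    unfolding B(2) by (subst nn_integral_indicator[symmetric], simp, subst nn_integral_distr) simp_all
  also have "(\<integral>\<^sup>+z. indicator A (\<lambda>j\<in>{..<m}. z (b j)) \<partial>?B') = emeasure N A"
  \<comment> \<open>The complement coordinates have so far been indexed by the vectors b j; this
    passes back to the indices j.\<close>
  proof -
    have "bij_betw b {..<m} b'" using inj_b by (simp add: b'_def bij_betw_def)
    from distr_PiM_lborel_reindex[OF this finite_lessThan]
    have "emeasure N A = (\<integral>\<^sup>+c. indicator A c
        \<partial>distr ?B' N (\<lambda>z. \<lambda>j\<in>{..<m}. z (b j)))"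
      by simp
    also have "\<dots> = (\<integral>\<^sup>+z. indicator A (\<lambda>j\<in>{..<m}. z (b j)) \<partial>?B')"
      by (rule nn_integral_distr[OF m]) simp
    finally show ?thesis by simp
  qed
  finally show ?thesis .
qed

end

section \<open>Fundamental domains and periodic functions\<close>

lemma AE_lborel_shift:
  fixes a :: "'a::euclidean_space"
  assumes "AE x in lborel. Q x"
  shows "AE x in lborel. Q (x + a)"
proof -
  have "AE x in distr lborel borel ((+) a). Q x"
    unfolding lborel_distr_plus by (fact assms)
  from AE_distrD[OF _ this] show ?thesis
    by (simp add: add.commute)
qed

locale lattice_domain =
  fixes \<Gamma> L :: "'a::euclidean_space set" and m :: nat and b :: "nat \<Rightarrow> 'a"
  assumes group: "additive_subgroup \<Gamma>" and discrete: "discrete \<Gamma>"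
    and domain: "compact_fundamental_domain \<Gamma> L"
    and inj: "inj_on b {..<m}"
    and basis: "orthonormal_basis_of (b ` {..<m}) (orthogonal_comp (span \<Gamma>))"
begin

sublocale split_space "span \<Gamma>" m b
  by unfold_locales (simp_all add: inj basis)

abbreviation vol where "vol \<equiv> measure (subspace_lebesgue (span \<Gamma>)) L"

definition D where "D = full_domain \<Gamma> L"

lemma uniform_discrete_\<Gamma>: "uniform_discrete \<Gamma>"
  by (rule discrete_subgroup_uniform_discrete[OF group discrete])

lemma countable_\<Gamma>: "countable \<Gamma>"
  by (rule countable_uniform_discrete[OF uniform_discrete_\<Gamma>])

lemma L_cover: "(\<Union>\<gamma>\<in>\<Gamma>. (+) \<gamma> ` L) = span \<Gamma>"
  using domain by (simp add: compact_fundamental_domain_def)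

lemma L_overlap:
  "\<gamma> \<in> \<Gamma> \<Longrightarrow> \<gamma>' \<in> \<Gamma> \<Longrightarrow> \<gamma> \<noteq> \<gamma>' \<Longrightarrow>
    emeasure (subspace_lebesgue (span \<Gamma>)) ((+) \<gamma> ` L \<inter> (+) \<gamma>' ` L) = 0"
  using domain unfolding compact_fundamental_domain_def by blast

lemma L_subset: "L \<subseteq> span \<Gamma>"
proof
  fix x assume "x \<in> L"
  moreover have "0 \<in> \<Gamma>" using group by (simp add: additive_subgroup_def)
  ultimately have "x \<in> (\<Union>\<gamma>\<in>\<Gamma>. (+) \<gamma> ` L)" by (auto intro!: bexI[of _ 0])
  then show "x \<in> span \<Gamma>" unfolding L_cover .
qed

lemma compact_L: "compact L"
  using domain by (simp add: compact_fundamental_domain_def)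

lemma L_borel [measurable]: "L \<in> sets borel"
  using compact_L by (simp add: borel_closed compact_imp_closed)

lemma D_iff: "x \<in> D \<longleftrightarrow> x - perp x \<in> L"
proof
  assume "x \<in> D"
  then obtain y z where x: "x = y + z" "y \<in> L" "z \<in> orthogonal_comp (span \<Gamma>)"
    by (auto simp: D_def full_domain_def)
  have y: "y \<in> span \<Gamma>" using x(2) L_subset by blast
  have "perp z - z \<in> span \<Gamma>"
    using span_neg[OF diff_perp_in[of z]] by simp
  moreover have "perp z - z \<in> orthogonal_comp (span \<Gamma>)"
    using perp_in x(3) subspace_orthogonal_comp by (auto intro: subspace_diff)
  ultimately have "orthogonal (perp z - z) (perp z - z)"
    by (auto simp: orthogonal_comp_def)
  then have "perp z = z" by (simp add: orthogonal_self)
  then show "x - perp x \<in> L" using x y by (simp add: perp_add perp_V)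
next
  assume "x - perp x \<in> L"
  then show "x \<in> D"
    unfolding D_def full_domain_def using perp_in[of x]
    by (intro CollectI exI[of _ "x - perp x"] exI[of _ "perp x"]) simp
qed

lemma D_borel [measurable]: "D \<in> sets borel"
proof -
  have "D = {x. x - perp x \<in> L}" using D_iff by auto
  then show ?thesis by simp
qed

lemma perp_\<Gamma>: "\<gamma> \<in> \<Gamma> \<Longrightarrow> perp \<gamma> = 0"
  by (simp add: perp_V span_base)

lemma D_shift_iff: "\<gamma> \<in> \<Gamma> \<Longrightarrow> x - \<gamma> \<in> D \<longleftrightarrow> x - perp x \<in> (+) \<gamma> ` L"
proof -
  assume "\<gamma> \<in> \<Gamma>"
  then have "x - \<gamma> - perp (x - \<gamma>) = x - perp x - \<gamma>"
    by (simp add: perp_diff perp_\<Gamma>)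
  moreover have "y - \<gamma> \<in> L \<longleftrightarrow> y \<in> (+) \<gamma> ` L" for y
    by (auto simp: image_iff intro!: bexI[of _ "y - \<gamma>"])
  ultimately show ?thesis by (simp only: D_iff)
qed

lemma D_cover: "\<exists>\<gamma>\<in>\<Gamma>. x - \<gamma> \<in> D"
proof -
  have "x - perp x \<in> (\<Union>\<gamma>\<in>\<Gamma>. (+) \<gamma> ` L)"
    unfolding L_cover by (rule diff_perp_in)
  then obtain \<gamma> l where g: "\<gamma> \<in> \<Gamma>" "l \<in> L" "x - perp x = \<gamma> + l" by auto
  then have "x - \<gamma> \<in> D"
    unfolding D_shift_iff[OF g(1)] by simp
  then show ?thesis using g by blast
qed

lemma emeasure_split:
  assumes [measurable]: "Z \<in> sets borel"
  shows "emeasure lborel {x. x - perp x \<in> Z} = emeasure (subspace_lebesgue (span \<Gamma>)) Z * emeasure N (space N)"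
proof -
  have "crd x \<in> space N" for x
    using measurable_space[OF measurable_coords] by simp
  then show ?thesis
    using emeasure_lborel_split[OF assms sets.top] by simp
qed

lemma D_overlap:
  assumes "\<gamma> \<in> \<Gamma>" "\<gamma>' \<in> \<Gamma>" "\<gamma> \<noteq> \<gamma>'"
  shows "emeasure lborel {x. x - \<gamma> \<in> D \<and> x - \<gamma>' \<in> D} = 0"
proof -
  have "{x. x - \<gamma> \<in> D \<and> x - \<gamma>' \<in> D} = {x. x - perp x \<in> (+) \<gamma> ` L \<inter> (+) \<gamma>' ` L}"
    using assms by (simp add: D_shift_iff)
  moreover have "(+) \<gamma> ` L \<inter> (+) \<gamma>' ` L \<in> sets borel"
    using compact_L by (intro borel_closed closed_Int compact_imp_closed compact_translation)
  \<comment> \<open>For m > 0 the complement has infinite measure; in \<open>ennreal\<close> the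
    product with 0 is still 0.\<close>
  ultimately show ?thesis
    by (simp only: emeasure_split L_overlap[OF assms] mult_zero_left)
qed

section \<open>Domains up to null sets and integrals of periodic functions\<close>

abbreviation dual where "dual \<equiv> dual_lattice \<Gamma>"

text \<open>Unlike the notion defining \<open>L\<close>, this one lives in the ambient space and
  refers only to Lebesgue-almost all points, so that it is visibly stable under translation by
  arbitrary vectors.\<close>

definition ae_domain :: "'a set \<Rightarrow> bool" where
  "ae_domain E \<longleftrightarrow> E \<in> sets borel \<and> (AE x in lborel. \<exists>!\<gamma>. \<gamma> \<in> \<Gamma> \<and> x - \<gamma> \<in> E)"

text \<open>Covering holds at every point; uniqueness fails only on the pairwise overlaps, which are
  null and countable in number.\<close>

lemma ae_domain_D: "ae_domain D"
proof -
  have "AE x in lborel. \<not> (x - \<gamma> \<in> D \<and> x - \<gamma>' \<in> D)" if "\<gamma> \<in> \<Gamma>" "\<gamma>' \<in> \<Gamma>" "\<gamma> \<noteq> \<gamma>'" for \<gamma> \<gamma>'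
  proof (rule AE_I)
    show "emeasure lborel {x. x - \<gamma> \<in> D \<and> x - \<gamma>' \<in> D} = 0" by (rule D_overlap[OF that])
    show "{x. x - \<gamma> \<in> D \<and> x - \<gamma>' \<in> D} \<in> sets lborel" by measurable
  qed auto
  then have "AE x in lborel. \<forall>\<gamma>\<in>\<Gamma>. \<forall>\<gamma>'\<in>\<Gamma>. \<gamma> \<noteq> \<gamma>' \<longrightarrow> \<not> (x - \<gamma> \<in> D \<and> x - \<gamma>' \<in> D)"
    by (intro AE_ball_countable'[OF _ countable_\<Gamma>] AE_impI)
  then have "AE x in lborel. \<exists>!\<gamma>. \<gamma> \<in> \<Gamma> \<and> x - \<gamma> \<in> D"
  proof eventually_elim
    case (elim x)
    then show ?case using D_cover[of x] by blast
  qed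
  then show ?thesis by (simp add: ae_domain_def)
qed

lemma ae_domain_shift:
  assumes "ae_domain E"
  shows "ae_domain ((\<lambda>x. x - t) -` E)"
proof -
  have "(\<lambda>x. x - t) -` E \<in> sets borel"
    using assms measurable_sets_borel[of "\<lambda>x. x - t" borel E] by (simp add: ae_domain_def)
  moreover have "AE x in lborel. \<exists>!\<gamma>. \<gamma> \<in> \<Gamma> \<and> x + (- t) - \<gamma> \<in> E"
    using assms by (intro AE_lborel_shift[of "\<lambda>x. \<exists>!\<gamma>. \<gamma> \<in> \<Gamma> \<and> x - \<gamma> \<in> E"]) (simp add: ae_domain_def)
  ultimately show ?thesis by (simp add: ae_domain_def algebra_simps)
qed

text \<open>Unfolding: the sum of the indicators of F at x - \<gamma> equals 1 almost everywhere and
  may be inserted under the integral over \<open>A \<inter> E\<close>. After exchanging sum and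
  integral, the shift by \<gamma> swaps the roles of E and F, since A is invariant, and replacing
  \<gamma> by - \<gamma> folds the sum back.\<close>

lemma emeasure_ae_domain:
  assumes E: "ae_domain E" and F: "ae_domain F" and A [measurable]: "A \<in> sets borel"
    and inv: "\<And>x \<gamma>. \<gamma> \<in> \<Gamma> \<Longrightarrow> x + \<gamma> \<in> A \<longleftrightarrow> x \<in> A"
  shows "emeasure lborel (A \<inter> E) = emeasure lborel (A \<inter> F)"
proof -
  let ?n = "\<lambda>X x. (\<integral>\<^sup>+\<gamma>. indicator X (x - \<gamma>) \<partial>count_space \<Gamma>) :: ennreal"
  let ?J = "\<lambda>X Y \<gamma>. (\<integral>\<^sup>+x. indicator (A \<inter> X) x * indicator Y (x - \<gamma>) \<partial>lborel) :: ennreal"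
  have [measurable]: "E \<in> sets borel" "F \<in> sets borel"
    using E F by (auto simp: ae_domain_def)
  have count: "AE x in lborel. ?n X x = 1" if "ae_domain X" for X
    using that[unfolded ae_domain_def, THEN conjunct2]
  proof eventually_elim
    case (elim x)
    then obtain \<gamma>0 where g: "\<And>\<gamma>. \<gamma> \<in> \<Gamma> \<and> x - \<gamma> \<in> X \<longleftrightarrow> \<gamma> = \<gamma>0" by metis
    have "?n X x = (\<integral>\<^sup>+\<gamma>. indicator {\<gamma>0} \<gamma> \<partial>count_space \<Gamma>)"
    proof (rule nn_integral_cong)
      fix \<gamma> assume "\<gamma> \<in> space (count_space \<Gamma>)"
      then have "x - \<gamma> \<in> X \<longleftrightarrow> \<gamma> = \<gamma>0" using g[of \<gamma>] by simp
      then show "indicator X (x - \<gamma>) = (indicator {\<gamma>0} \<gamma> :: ennreal)"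
        by (simp add: indicator_def)
    qed
    then show ?case using g[of \<gamma>0] by simp
  qed
  have expand: "emeasure lborel (A \<inter> X) =
      (\<integral>\<^sup>+x. indicator (A \<inter> X) x * ?n Y x \<partial>lborel)"
    if [measurable]: "X \<in> sets borel" and Y: "ae_domain Y" for X Y
    by (subst nn_integral_indicator[symmetric], simp, rule nn_integral_cong_AE)
      (use count[OF Y] in \<open>eventually_elim, simp\<close>)
  have "emeasure lborel (A \<inter> E) = (\<integral>\<^sup>+x. indicator (A \<inter> E) x * ?n F x \<partial>lborel)"
    by (rule expand[OF \<open>E \<in> sets borel\<close> F])
  also have "\<dots> = (\<integral>\<^sup>+x. (\<integral>\<^sup>+\<gamma>. indicator (A \<inter> E) x * indicator F (x - \<gamma>) \<partial>count_space \<Gamma>) \<partial>lborel)"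
    by (simp add: nn_integral_cmult)
  also have "\<dots> = (\<integral>\<^sup>+\<gamma>. ?J E F \<gamma> \<partial>count_space \<Gamma>)"
    by (intro nn_integral_count_space_nn_integral countable_\<Gamma>) measurable
  also have "\<dots> = (\<integral>\<^sup>+\<gamma>. ?J F E (- \<gamma>) \<partial>count_space \<Gamma>)"
  proof (rule nn_integral_cong)
    fix \<gamma> assume "\<gamma> \<in> space (count_space \<Gamma>)"
    then have g: "\<gamma> \<in> \<Gamma>" by simp
    have "?J E F \<gamma> =
        (\<integral>\<^sup>+x. indicator (A \<inter> E) (\<gamma> + x) * indicator F (\<gamma> + x - \<gamma>) \<partial>lborel)"
      by (rule nn_integral_lborel_shift[symmetric]) measurable
    also have "\<dots> = ?J F E (- \<gamma>)"
      using inv[OF g] by (intro nn_integral_cong) (auto simp: indicator_def add.commute[of \<gamma>])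
    finally show "?J E F \<gamma> =
        ?J F E (- \<gamma>)" .
  qed
  also have "\<dots> = (\<integral>\<^sup>+\<gamma>. ?J F E \<gamma> \<partial>count_space \<Gamma>)"
  proof (rule nn_integral_bij_count_space)
    have "uminus ` \<Gamma> = \<Gamma>"
      using group by (auto simp: additive_subgroup_def image_iff) (metis minus_minus)
    then show "bij_betw uminus \<Gamma> \<Gamma>" by (simp add: bij_betw_def inj_on_def)
  qed
  also have "\<dots> = (\<integral>\<^sup>+x. (\<integral>\<^sup>+\<gamma>. indicator (A \<inter> F) x * indicator E (x - \<gamma>) \<partial>count_space \<Gamma>) \<partial>lborel)"
    by (intro nn_integral_count_space_nn_integral[symmetric] countable_\<Gamma>) measurable
  also have "\<dots> = (\<integral>\<^sup>+x. indicator (A \<inter> F) x * ?n E x \<partial>lborel)"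
    by (simp add: nn_integral_cmult)
  also have "\<dots> = emeasure lborel (A \<inter> F)"
    by (rule expand[OF \<open>F \<in> sets borel\<close> E, symmetric])
  finally show ?thesis .
qed

lemma AE_D_translates:
  assumes "AE x in lborel. x \<in> D \<longrightarrow> Q x"
  shows "AE x in lborel. \<forall>\<gamma>\<in>\<Gamma>. x - \<gamma> \<in> D \<longrightarrow> Q (x - \<gamma>)"
proof (rule AE_ball_countable'[OF _ countable_\<Gamma>])
  fix \<gamma> assume "\<gamma> \<in> \<Gamma>"
  show "AE x in lborel. x - \<gamma> \<in> D \<longrightarrow> Q (x - \<gamma>)"
    using AE_lborel_shift[OF assms, of "- \<gamma>"] by simp
qed

text \<open>Thickening L by the unit cube in the complement gives a bounded set of the ambient
  space. The cube has measure 1, so the finite Lebesgue measure of the thickened set is the measure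
  of L.\<close>

lemma emeasure_L_finite: "emeasure (subspace_lebesgue (span \<Gamma>)) L < \<infinity>"
proof -
  interpret product_sigma_finite "\<lambda>_::nat. lborel :: real measure" ..
  define A where "A = (\<Pi>\<^sub>E j\<in>{..<m}. {0..1::real})"
  have A: "A \<in> sets N" "emeasure N A = 1"
    unfolding A_def by (auto intro!: sets_PiM_I_finite simp: emeasure_PiM)
  obtain R where R: "\<And>x. x \<in> L \<Longrightarrow> norm x \<le> R"
    using compact_imp_bounded[OF compact_L] by (auto simp: bounded_iff)
  have "bounded {x. x - perp x \<in> L \<and> crd x \<in> A}"
    unfolding bounded_iff
  proof (intro exI[of _ "sqrt (R\<^sup>2 + m)"] ballI)
    fix x assume x: "x \<in> {x. x - perp x \<in> L \<and> crd x \<in> A}"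
    have "0 \<le> x \<bullet> b j \<and> x \<bullet> b j \<le> 1" if "j < m" for j
      using x that by (auto simp: A_def coords_def PiE_iff)
    then have "(\<Sum>j<m. (x \<bullet> b j)\<^sup>2) \<le> (\<Sum>j<m. 1)"
      by (intro sum_mono) (simp add: power_le_one)
    moreover have "(norm (x - perp x))\<^sup>2 \<le> R\<^sup>2"
      using x R by (intro power_mono) auto
    ultimately have "(norm x)\<^sup>2 \<le> R\<^sup>2 + m"
      using norm_split[of x] by simp
    then show "norm x \<le> sqrt (R\<^sup>2 + m)" by (rule real_le_rsqrt)
  qed
  then have "emeasure lborel {x. x - perp x \<in> L \<and> crd x \<in> A} < \<infinity>"
    by (rule emeasure_bounded_finite)
  then show ?thesis
    using emeasure_lborel_split[OF L_borel A(1)] A(2) by simp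
qed

lemma emeasure_L: "emeasure (subspace_lebesgue (span \<Gamma>)) L = ennreal vol"
  using emeasure_L_finite by (simp add: emeasure_eq_ennreal_measure)

text \<open>A null L would make D null, but countably many translates of D cover the space.\<close>

lemma vol_pos: "vol > 0"
proof (rule ccontr)
  assume "\<not> vol > 0"
  then have "vol = 0" using measure_nonneg[of "subspace_lebesgue (span \<Gamma>)" L] by linarith
  then have "emeasure lborel {x. x - perp x \<in> L} = 0"
    using emeasure_split[OF L_borel] emeasure_L by simp
  then have "AE x in lborel. x \<notin> D"
    using D_iff by (intro AE_I[of _ _ "{x. x - perp x \<in> L}"]) auto
  then have "AE x in lborel. \<forall>\<gamma>\<in>\<Gamma>. x - \<gamma> \<in> D \<longrightarrow> False"
    by (intro AE_D_translates) simp
  then have "AE x in (lborel :: 'a measure). False"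
    by eventually_elim (use D_cover in blast)
  then have "emeasure (lborel :: 'a measure) UNIV = 0"
    using emeasure_eq_0_AE[of "\<lambda>_. True" "lborel :: 'a measure"] by simp
  then show False by simp
qed

text \<open>The image of Lebesgue measure on D under the complement coordinates is
  \<open>vol\<close> times the product measure. Equality of measures yields the identity for each
  measurable h, integrable or not.\<close>

lemma integral_D_coords:
  fixes h :: "(nat \<Rightarrow> real) \<Rightarrow> real"
  assumes [measurable]: "h \<in> borel_measurable N"
  shows "(\<integral>x. indicator D x * h (crd x) \<partial>lborel) = vol * (\<integral>c. h c \<partial>N)"
proof -
  let ?\<mu> = "distr (density lborel (\<lambda>x. ennreal (indicator D x))) N crd"
  have eq: "?\<mu> = density N (\<lambda>_. ennreal vol)"
  proof (rule measure_eqI)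
    fix A assume "A \<in> sets ?\<mu>"
    then have A [measurable]: "A \<in> sets N" by simp
    have [measurable]: "crd -` A \<in> sets borel"
      using measurable_sets[OF measurable_coords A] by simp
    have "emeasure ?\<mu> A =
        (\<integral>\<^sup>+x. ennreal (indicator D x) * indicator (crd -` A) x \<partial>lborel)"
      by (subst emeasure_distr, simp, simp) (subst emeasure_density, simp_all)
    also have "\<dots> = (\<integral>\<^sup>+x. indicator {x. x - perp x \<in> L \<and> crd x \<in> A} x \<partial>lborel)"
      by (intro nn_integral_cong) (simp add: indicator_def D_iff)
    also have "\<dots> = emeasure lborel {x. x - perp x \<in> L \<and> crd x \<in> A}"
      by (rule nn_integral_indicator) measurable
    also have "\<dots> = ennreal vol * emeasure N A"
      by (simp add: emeasure_lborel_split emeasure_L)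
    finally show "emeasure ?\<mu> A =
        emeasure (density N (\<lambda>_. ennreal vol)) A"
      by (simp add: emeasure_density nn_integral_cmult)
  qed simp
  have "(\<integral>x. indicator D x * h (crd x) \<partial>lborel) = (\<integral>x. h (crd x) \<partial>density lborel (\<lambda>x. ennreal (indicator D x)))"
    by (subst integral_density) auto
  also have "\<dots> = (\<integral>c. h c \<partial>density N (\<lambda>_. ennreal vol))"
    unfolding eq[symmetric] by (subst integral_distr) auto
  also have "\<dots> = vol * (\<integral>c. h c \<partial>N)"
    by (subst integral_density) auto
  finally show ?thesis .
qed

text \<open>Translating by the integral parts of the coordinates moves every point into a half-open
  fundamental parallelepiped; \<open>\<Gamma>\<close>-periodic functions are those that factor through this map.\<close>

definition retract :: "'a set \<Rightarrow> ('a \<Rightarrow> 'a) \<Rightarrow> 'a \<Rightarrow> 'a" where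
  "retract W d x = x - (\<Sum>w\<in>W. of_int \<lfloor>d w \<bullet> x\<rfloor> *\<^sub>R w)"

lemma retract_measurable [measurable]: "retract W d \<in> borel_measurable borel"
  unfolding retract_def by measurable

lemma retract_translate:
  assumes "W \<subseteq> \<Gamma>"
  shows "\<exists>\<gamma>\<in>\<Gamma>. retract W d x = x + \<gamma>"
proof (intro bexI[of _ "- (\<Sum>w\<in>W. of_int \<lfloor>d w \<bullet> x\<rfloor> *\<^sub>R w)"])
  have "(\<Sum>w\<in>W. of_int \<lfloor>d w \<bullet> x\<rfloor> *\<^sub>R w) \<in> \<Gamma>"
    using assms by (intro additive_subgroup_sum[OF group] additive_subgroup_of_int_scaleR[OF group]) auto
  then show "- (\<Sum>w\<in>W. of_int \<lfloor>d w \<bullet> x\<rfloor> *\<^sub>R w) \<in> \<Gamma>"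
    using group by (simp add: additive_subgroup_def)
qed (simp add: retract_def)

lemma retract_periodic:
  assumes d: "\<And>w. w \<in> W \<Longrightarrow> d w \<in> dual"
    and rep: "\<And>x. x \<in> span \<Gamma> \<Longrightarrow> x = (\<Sum>w\<in>W. (d w \<bullet> x) *\<^sub>R w)"
    and g: "\<gamma> \<in> \<Gamma>"
  shows "retract W d (x + \<gamma>) = retract W d x"
proof -
  have int: "of_int \<lfloor>d w \<bullet> \<gamma>\<rfloor> = d w \<bullet> \<gamma>" if "w \<in> W" for w
    using d[OF that] g by (auto simp: dual_lattice_def)
  have "of_int \<lfloor>d w \<bullet> (x + \<gamma>)\<rfloor> = of_int \<lfloor>d w \<bullet> x\<rfloor> + d w \<bullet> \<gamma>" if "w \<in> W" for w
  proof -
    have "\<lfloor>d w \<bullet> x + of_int \<lfloor>d w \<bullet> \<gamma>\<rfloor>\<rfloor> = \<lfloor>d w \<bullet> x\<rfloor> + \<lfloor>d w \<bullet> \<gamma>\<rfloor>"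
      by (rule floor_add_int[symmetric])
    then show ?thesis using int[OF that] by (simp add: inner_add_right)
  qed
  then have "retract W d (x + \<gamma>) = x + \<gamma> - ((\<Sum>w\<in>W. of_int \<lfloor>d w \<bullet> x\<rfloor> *\<^sub>R w) + (\<Sum>w\<in>W. (d w \<bullet> \<gamma>) *\<^sub>R w))"
    by (simp add: retract_def scaleR_add_left sum.distrib)
  then show ?thesis
    using rep[of \<gamma>] g by (simp add: retract_def span_base)
qed

text \<open>A periodic f factors through \<open>retract\<close>, and preimages under
  \<open>retract\<close> are \<Gamma>-invariant sets. Hence Lebesgue measure restricted to E or to F
  has the same image under \<open>retract\<close>, and f has the same integral for both.\<close>

lemma integral_periodic_ae_domain:
  fixes f :: "'a \<Rightarrow> complex"
  assumes E: "ae_domain E" and F: "ae_domain F" and f [measurable]: "f \<in> borel_measurable borel"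
    and per: "\<And>x \<gamma>. \<gamma> \<in> \<Gamma> \<Longrightarrow> f (x + \<gamma>) = f x"
  shows "(\<integral>x. indicator E x *\<^sub>R f x \<partial>lborel) = (\<integral>x. indicator F x *\<^sub>R f x \<partial>lborel)"
proof -
  obtain W d where W: "finite W" "W \<subseteq> \<Gamma>" "\<And>w. w \<in> W \<Longrightarrow> d w \<in> dual"
    "\<And>x. x \<in> span \<Gamma> \<Longrightarrow> x = (\<Sum>w\<in>W. (d w \<bullet> x) *\<^sub>R w)"
    using lattice_dual_basis[OF group uniform_discrete_\<Gamma>] by metis
  let ?P = "retract W d"
  let ?\<mu> = "\<lambda>X. distr (density lborel (\<lambda>x. ennreal (indicator X x))) borel ?P"
  have [measurable]: "E \<in> sets borel" "F \<in> sets borel"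
    using E F by (auto simp: ae_domain_def)
  have fP: "f x = f (?P x)" for x
    using retract_translate[OF W(2), of d x] per by auto
  have dens: "emeasure (?\<mu> X) A = emeasure lborel (?P -` A \<inter> X)"
    if [measurable]: "X \<in> sets borel" "A \<in> sets borel" for X A
  proof -
    have A: "?P -` A \<in> sets borel"
      using measurable_sets[OF retract_measurable that(2)] by simp
    have "emeasure (?\<mu> X) A =
        (\<integral>\<^sup>+x. ennreal (indicator X x) * indicator (?P -` A) x \<partial>lborel)"
      by (subst emeasure_distr, simp, simp) (subst emeasure_density, use A in simp_all)
    also have "\<dots> = (\<integral>\<^sup>+x. indicator (?P -` A \<inter> X) x \<partial>lborel)"
      by (intro nn_integral_cong) (auto simp: indicator_def)
    finally show ?thesis using A by simp
  qed
  have eq: "?\<mu> E =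
      ?\<mu> F"
  proof (rule measure_eqI)
    fix A assume "A \<in> sets (?\<mu> E)"
    then have A [measurable]: "A \<in> sets borel" by simp
    have "?P -` A \<in> sets borel"
      using measurable_sets[OF retract_measurable A] by simp
    then show "emeasure (?\<mu> E) A =
        emeasure (?\<mu> F) A"
      unfolding dens[OF \<open>E \<in> sets borel\<close> A] dens[OF \<open>F \<in> sets borel\<close> A]
      by (intro emeasure_ae_domain E F) (simp_all add: retract_periodic[OF W(3,4)])
  qed simp
  have "(\<integral>x. indicator X x *\<^sub>R f x \<partial>lborel) = (\<integral>x. f x \<partial>?\<mu> X)"
    if [measurable]: "X \<in> sets borel" for X
    by (subst integral_distr, simp, simp, subst integral_density) (simp_all add: fP[symmetric])
  then show ?thesis using eq by simp
qed

definition trig :: "'a \<Rightarrow> 'a \<Rightarrow> complex" where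
  "trig \<delta> x = exp (2 * complex_of_real pi * \<i> * complex_of_real (\<delta> \<bullet> x))"

lemma measurable_trig [measurable]: "trig \<delta> \<in> borel_measurable borel"
  unfolding trig_def by measurable

lemma trig_add_right: "trig \<delta> (x + y) = trig \<delta> x * trig \<delta> y"
  by (simp add: trig_def inner_add_right distrib_left exp_add)

lemma trig_lattice: "\<delta> \<in> dual \<Longrightarrow> \<gamma> \<in> \<Gamma> \<Longrightarrow> trig \<delta> \<gamma> = 1"
proof -
  assume "\<delta> \<in> dual" "\<gamma> \<in> \<Gamma>"
  then obtain n where "\<delta> \<bullet> \<gamma> = of_int n" by (auto simp: dual_lattice_def Ints_def)
  then show ?thesis using exp_integer_2pi[of "of_int n"] by (simp add: trig_def mult_ac)
qed

text \<open>Translating the domain leaves the integral of a periodic function unchanged, yet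
  multiplies this integrand by a value of the character. Arranging that value to be -1 gives I = -
  I.\<close>

lemma integral_character_zero:
  fixes h :: "(nat \<Rightarrow> real) \<Rightarrow> real"
  assumes \<delta>: "\<delta> \<in> dual" "\<delta> \<noteq> 0" and [measurable]: "h \<in> borel_measurable N"
  shows "(\<integral>x. indicator D x *\<^sub>R (trig \<delta> x * complex_of_real (h (crd x))) \<partial>lborel) = 0" (is "?I = 0")
proof -
  define f where "f x = trig \<delta> x * complex_of_real (h (crd x))" for x
  have [measurable]: "f \<in> borel_measurable borel"
    unfolding f_def by measurable
  have f_shift: "f (x + y) = trig \<delta> y * f x" if "y \<in> span \<Gamma>" for x y
    by (simp add: f_def coords_add_V[OF that] trig_add_right)
  have per: "f (x + \<gamma>) = f x" if "\<gamma> \<in> \<Gamma>" for x \<gamma>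
    using f_shift[OF span_base[OF that]] trig_lattice[OF \<delta>(1) that] by simp
  \<comment> \<open>A half period of the character. It lies in the span, so the shift does not
    affect the complement coordinates.\<close>
  define t where "t = (1 / (2 * (\<delta> \<bullet> \<delta>))) *\<^sub>R \<delta>"
  have t: "t \<in> span \<Gamma>" "\<delta> \<bullet> t = 1 / 2"
    using \<delta> by (auto simp: t_def dual_lattice_def intro: span_scale)
  have "?I = (\<integral>x. indicator D x *\<^sub>R f x \<partial>lborel)" by (simp add: f_def)
  also have "\<dots> = (\<integral>x. indicator ((\<lambda>x. x - t) -` D) x *\<^sub>R f x \<partial>lborel)"
    by (intro integral_periodic_ae_domain ae_domain_D ae_domain_shift per) measurable
  also have "\<dots> = (\<integral>x. indicator ((\<lambda>x. x - t) -` D) (t + x) *\<^sub>R f (t + x) \<partial>lborel)"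
  proof -
    have [measurable]: "(\<lambda>x. x - t) -` D \<in> sets borel"
      using ae_domain_shift[OF ae_domain_D, of t] by (simp add: ae_domain_def)
    show ?thesis
      by (subst (1) lborel_distr_plus[of t, symmetric]) (simp add: integral_distr)
  qed
  also have "\<dots> = (\<integral>x. - (indicator D x *\<^sub>R f x) \<partial>lborel)"
    using f_shift[OF t(1)] t(2)
    by (intro Bochner_Integration.integral_cong refl) (simp add: add.commute[of t] indicator_def trig_def exp_pi_i)
  also have "\<dots> = - ?I" by (simp add: f_def)
  finally show "?I = 0" by simp
qed

end

section \<open>Convergence of Cauchy sequences in L2\<close>

text \<open>The subsequence is chosen with consecutive distances below 2^-k. Over a finite measure
  the L1 norms of the increments are then summable, so their sum is finite almost everywhere and the
  telescoping series converges absolutely there.\<close>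

lemma (in finite_measure) L2_Cauchy_subsequence:
  assumes u: "\<And>n::nat. sq_integrable M (u n)"
    and cauchy: "\<And>\<epsilon>. \<epsilon> > 0 \<Longrightarrow> \<exists>N. \<forall>i\<ge>N. \<forall>j\<ge>N. L2_seminorm M (\<lambda>x. u i x - u j x) < \<epsilon>"
  obtains r where "strict_mono r" "AE x in M. convergent (\<lambda>k. u (r k) x)"
proof -
  have "\<exists>N. \<forall>i\<ge>N. \<forall>j\<ge>N. L2_seminorm M (\<lambda>x. u i x - u j x) < (1 / 2) ^ k" for k :: nat
    by (rule cauchy) simp
  then obtain K where K: "\<And>k i j. i \<ge> K k \<Longrightarrow> j \<ge> K k \<Longrightarrow> L2_seminorm M (\<lambda>x. u i x - u j x) < (1 / 2) ^ k"
    by metis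
  \<comment> \<open>Partial sums of K dominate each K k, and the summand k makes the sequence
    strictly increasing.\<close>
  define r where "r k = (\<Sum>i\<le>k. K i) + k" for k
  have r: "strict_mono r" by (simp add: strict_mono_Suc_iff r_def)
  have rK: "r k \<ge> K k" for k
    unfolding r_def by (simp add: member_le_sum trans_le_add1)
  define a where "a k x = cmod (u (r (Suc k)) x - u (r k) x)" for k x
  have [measurable]: "u n \<in> borel_measurable M" for n
    using u by (simp add: sq_integrable_def)
  have [measurable]: "a k \<in> borel_measurable M" for k
    unfolding a_def by measurable
  have a_bound: "(\<integral>\<^sup>+x. ennreal (a k x) \<partial>M) \<le> ennreal ((measure M (space M) + 1) * (1 / 2) ^ k)" for k
  proof -
    have rs: "r (Suc k) \<ge> K k" "r k \<ge> K k"
      using rK[of k] strict_monoD[OF r, of k "Suc k"] by auto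
    have int: "integrable M (\<lambda>x. (a k x)\<^sup>2)"
      using sq_integrable_diff[OF u u] by (simp add: a_def sq_integrable_def)
    have "(\<integral>x. (a k x)\<^sup>2 \<partial>M) = (L2_seminorm M (\<lambda>x. u (r (Suc k)) x - u (r k) x))\<^sup>2"
      by (simp add: L2_seminorm_power2 a_def)
    also have "\<dots> \<le> ((1 / 2) ^ k)\<^sup>2"
      using K[OF rs] by (intro power_mono) auto
    finally have sq: "(\<integral>x. (a k x)\<^sup>2 \<partial>M) \<le> ((1 / 2) ^ k)\<^sup>2" .
    have "(\<integral>\<^sup>+x. ennreal (a k x) \<partial>M) \<le> (\<integral>\<^sup>+x. ennreal ((1 / 2) ^ k + 2 ^ k * (a k x)\<^sup>2) \<partial>M)"
    proof (intro nn_integral_mono ennreal_leI)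
      fix x
      \<comment> \<open>Completing the square trades the increment for 2^-k plus 2^k times its
        square; both parts integrate to at most a fixed multiple of 2^-k.\<close>
      have "0 \<le> (2 ^ k * a k x - 1 / 2)\<^sup>2" by simp
      then have "2 ^ k * a k x \<le> 1 + 2 ^ k * 2 ^ k * (a k x)\<^sup>2"
        by (simp add: power2_diff power_mult_distrib power2_eq_square algebra_simps)
      then show "a k x \<le> (1 / 2) ^ k + 2 ^ k * (a k x)\<^sup>2"
        by (simp add: field_simps power_divide)
    qed
    also have "\<dots> = ennreal (\<integral>x. (1 / 2) ^ k + 2 ^ k * (a k x)\<^sup>2 \<partial>M)"
      using int by (intro nn_integral_eq_integral) (auto simp: a_def)
    also have "(\<integral>x. (1 / 2) ^ k + 2 ^ k * (a k x)\<^sup>2 \<partial>M) = (1 / 2) ^ k * measure M (space M) + 2 ^ k * (\<integral>x. (a k x)\<^sup>2 \<partial>M)"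
      using int by simp
    also have "\<dots> \<le> (1 / 2) ^ k * measure M (space M) + 2 ^ k * ((1 / 2) ^ k)\<^sup>2"
      using sq by (intro add_left_mono mult_left_mono) auto
    also have "\<dots> = (measure M (space M) + 1) * (1 / 2) ^ k"
      by (simp add: power2_eq_square algebra_simps power_divide add_divide_distrib)
    finally show ?thesis by (simp add: ennreal_leI)
  qed
  have "(\<integral>\<^sup>+x. (\<Sum>k. ennreal (a k x)) \<partial>M) = (\<Sum>k. \<integral>\<^sup>+x. ennreal (a k x) \<partial>M)"
    by (rule nn_integral_suminf) simp
  also have "\<dots> \<le> (\<Sum>k. ennreal ((measure M (space M) + 1) * (1 / 2) ^ k))"
    by (intro suminf_le a_bound) auto
  also have "\<dots> = ennreal (\<Sum>k. (measure M (space M) + 1) * (1 / 2) ^ k)"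
    by (rule suminf_ennreal2) (auto intro!: summable_mult summable_geometric)
  also have "\<dots> < \<infinity>" by simp
  finally have "AE x in M. (\<Sum>k. ennreal (a k x)) \<noteq> \<infinity>"
    by (intro nn_integral_PInf_AE) auto
  then have "AE x in M. convergent (\<lambda>k. u (r k) x)"
  proof eventually_elim
    case (elim x)
    then have "summable (\<lambda>k. a k x)"
      by (intro summable_suminf_not_top) (auto simp: a_def)
    then have "summable (\<lambda>k. u (r (Suc k)) x - u (r k) x)"
      unfolding a_def by (rule summable_norm_cancel)
    then have "convergent (\<lambda>n. \<Sum>k<n. u (r (Suc k)) x - u (r k) x)"
      by (simp add: summable_iff_convergent)
    then have "convergent (\<lambda>n. u (r 0) x + (\<Sum>k<n. u (r (Suc k)) x - u (r k) x))"
      by (intro convergent_add convergent_const)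
    then show ?case by (simp add: sum_lessThan_telescope[of "\<lambda>k. u (r k) x"])
  qed
  then show thesis using r that by blast
qed

text \<open>Fatou's lemma, applied to u n - u (r k) as k grows, bounds the distance from u n to f by
  the Cauchy bound. Hence the whole sequence converges, not only the subsequence, and f is square
  integrable as a difference of two such functions.\<close>

lemma L2_limit_of_AE_limit:
  assumes u: "\<And>n::nat. sq_integrable M (u n)"
    and cauchy: "\<And>\<epsilon>. \<epsilon> > 0 \<Longrightarrow> \<exists>N. \<forall>i\<ge>N. \<forall>j\<ge>N. L2_seminorm M (\<lambda>x. u i x - u j x) < \<epsilon>"
    and r: "strict_mono r" and lim: "AE x in M. (\<lambda>k. u (r k) x) \<longlonglongrightarrow> f x"
    and [measurable]: "f \<in> borel_measurable M"
  shows "sq_integrable M f"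
    and "\<And>\<epsilon>. \<epsilon> > 0 \<Longrightarrow> \<exists>N. \<forall>n\<ge>N. L2_seminorm M (\<lambda>x. u n x - f x) < \<epsilon>"
proof -
  let ?I = "\<lambda>n. \<integral>\<^sup>+x. ennreal ((cmod (u n x - f x))\<^sup>2) \<partial>M"
  have [measurable]: "u n \<in> borel_measurable M" for n
    using u by (simp add: sq_integrable_def)
  have fatou: "\<exists>N. \<forall>n\<ge>N. ?I n \<le> ennreal (\<epsilon>\<^sup>2)" if eps: "\<epsilon> > 0" for \<epsilon>
  proof -
    obtain N where N: "\<And>i j. i \<ge> N \<Longrightarrow> j \<ge> N \<Longrightarrow> L2_seminorm M (\<lambda>x. u i x - u j x) < \<epsilon>"
      using cauchy[OF eps] by blast
    have "?I n \<le> ennreal (\<epsilon>\<^sup>2)" if n: "n \<ge> N" for n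
    proof -
      have "?I n =
          (\<integral>\<^sup>+x. liminf (\<lambda>k. ennreal ((cmod (u n x - u (r k) x))\<^sup>2)) \<partial>M)"
      proof (rule nn_integral_cong_AE)
        show "AE x in M. ennreal ((cmod (u n x - f x))\<^sup>2) = liminf (\<lambda>k. ennreal ((cmod (u n x - u (r k) x))\<^sup>2))"
          using lim
        proof eventually_elim
          case (elim x)
          have "(\<lambda>k. ennreal ((cmod (u n x - u (r k) x))\<^sup>2)) \<longlonglongrightarrow> ennreal ((cmod (u n x - f x))\<^sup>2)"
            by (intro tendsto_intros elim)
          then show ?case by (intro lim_imp_Liminf[symmetric]) auto
        qed
      qed
      also have "\<dots> \<le> liminf (\<lambda>k. \<integral>\<^sup>+x. ennreal ((cmod (u n x - u (r k) x))\<^sup>2) \<partial>M)"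
        by (rule nn_integral_liminf) measurable
      also have "\<dots> \<le> liminf (\<lambda>k. ennreal (\<epsilon>\<^sup>2))"
      proof (rule Liminf_mono)
        show "\<forall>\<^sub>F k in sequentially. (\<integral>\<^sup>+x. ennreal ((cmod (u n x - u (r k) x))\<^sup>2) \<partial>M) \<le> ennreal (\<epsilon>\<^sup>2)"
          using eventually_ge_at_top[of N]
        proof eventually_elim
          case (elim k)
          then have "r k \<ge> N" using seq_suble[OF r, of k] by linarith
          have "(\<integral>\<^sup>+x. ennreal ((cmod (u n x - u (r k) x))\<^sup>2) \<partial>M) = ennreal ((L2_seminorm M (\<lambda>x. u n x - u (r k) x))\<^sup>2)"
            unfolding L2_seminorm_power2 using sq_integrable_diff[OF u u]
            by (intro nn_integral_eq_integral) (auto simp: sq_integrable_def)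
          also have "\<dots> \<le> ennreal (\<epsilon>\<^sup>2)"
            using N[OF n \<open>r k \<ge> N\<close>] by (intro ennreal_leI power_mono) auto
          finally show ?case .
        qed
      qed
      also have "\<dots> = ennreal (\<epsilon>\<^sup>2)" by (simp add: Liminf_const)
      finally show ?thesis .
    qed
    then show ?thesis by blast
  qed
  have diff: "sq_integrable M (\<lambda>x. u n x - f x)"
    if "?I n \<le> ennreal c" for n c
    unfolding sq_integrable_def using that
    by (auto intro!: integrableI_nonneg intro: le_less_trans)
  obtain N where "?I N \<le> ennreal (1\<^sup>2)"
    using fatou[of 1] by auto
  from sq_integrable_diff[OF u[of N] diff[OF this]] show "sq_integrable M f" by simp
  fix \<epsilon> :: real assume "\<epsilon> > 0"
  then obtain N where N: "\<And>n. n \<ge> N \<Longrightarrow> ?I n \<le> ennreal ((\<epsilon> / 2)\<^sup>2)"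
    using fatou[of "\<epsilon> / 2"] by auto
  have "L2_seminorm M (\<lambda>x. u n x - f x) < \<epsilon>" if "n \<ge> N" for n
  proof -
    have "ennreal (\<integral>x. (cmod (u n x - f x))\<^sup>2 \<partial>M) \<le> ennreal ((\<epsilon> / 2)\<^sup>2)"
      using N[OF that] diff[OF N[OF that]]
      by (subst nn_integral_eq_integral[symmetric]) (auto simp: sq_integrable_def)
    then have "(L2_seminorm M (\<lambda>x. u n x - f x))\<^sup>2 \<le> (\<epsilon> / 2)\<^sup>2"
      by (simp add: L2_seminorm_power2)
    then have "L2_seminorm M (\<lambda>x. u n x - f x) \<le> \<epsilon> / 2"
      by (rule power2_le_imp_le) (use \<open>\<epsilon> > 0\<close> in simp)
    then show ?thesis using \<open>\<epsilon> > 0\<close> by simp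
  qed
  then show "\<exists>N. \<forall>n\<ge>N. L2_seminorm M (\<lambda>x. u n x - f x) < \<epsilon>" by blast
qed

section \<open>The Hilbert space of quasi-periodic functions\<close>

text \<open>The relation behind the quotient is partial and reflexive exactly on Borel functions, so
  the chosen representative is Borel.\<close>

lemma ae_fun_cases:
  obtains u where "f = abs_ae_fun u" "u \<in> borel_measurable borel"
proof
  show "f = abs_ae_fun (rep_ae_fun f)" "rep_ae_fun f \<in> borel_measurable borel"
    using Quotient3_abs_rep[OF Quotient3_ae_fun, of f] Quotient3_rep_reflp[OF Quotient3_ae_fun, of f] by auto
qed

lemma borel_measurable_cnj [measurable (raw)]:
  "f \<in> borel_measurable M \<Longrightarrow> (\<lambda>x. cnj (f x)) \<in> borel_measurable M"
  by (rule measurable_compose[OF _ borel_measurable_continuous_onI[OF continuous_on_cnj]]) auto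

lemma abs_ae_fun_eq_iff:
  assumes "f \<in> borel_measurable borel" "g \<in> borel_measurable borel"
  shows "abs_ae_fun f = abs_ae_fun g \<longleftrightarrow> (AE x in lborel. f x = g x)"
  using Quotient3_rel[OF Quotient3_ae_fun, of f g] assms by simp

locale quasi_periodic_space = lattice_domain \<Gamma> L m b
  for \<Gamma> L :: "'a::euclidean_space set" and m :: nat and b :: "nat \<Rightarrow> 'a" +
  fixes \<nu> :: real and chi :: "'a \<Rightarrow> complex" and v :: 'a
  assumes \<nu>_pos: "\<nu> > 0" and v: "v \<in> span \<Gamma>"
    and chi: "\<gamma> \<in> \<Gamma> \<Longrightarrow> chi \<gamma> = exp (2 * \<i> * complex_of_real pi * complex_of_real (\<gamma> \<bullet> v))"
begin

text \<open>Domain and weight are absorbed into one finite measure, so that norms and inner products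
  become those of plain L2 functions.\<close>

definition M :: "'a measure" where
  "M = density lborel (\<lambda>x. ennreal (indicator D x * exp (- \<nu> * (norm x)\<^sup>2)))"

definition multiplier :: "'a \<Rightarrow> 'a \<Rightarrow> complex" where
  "multiplier \<gamma> x = chi \<gamma> * of_real (exp (\<nu> * ((x + \<gamma> /\<^sub>R 2) \<bullet> \<gamma>)))"

definition QP :: "('a \<Rightarrow> complex) \<Rightarrow> bool" where
  "QP u \<longleftrightarrow> (\<forall>\<gamma>\<in>\<Gamma>. AE x in lborel. u (x + \<gamma>) = multiplier \<gamma> x * u x)"

abbreviation H where "H \<equiv> L2_space \<nu> \<Gamma> chi D"

lemma sets_M [measurable_cong, simp]: "sets M = sets borel"
  by (simp add: M_def)

lemma space_M [simp]: "space M = UNIV"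
  by (simp add: M_def)

lemma borel_measurable_M [simp]: "borel_measurable M = borel_measurable borel"
  by (rule measurable_cong_sets) simp_all

lemma AE_M_iff: "(AE x in M. Q x) \<longleftrightarrow> (AE x in lborel. x \<in> D \<longrightarrow> Q x)"
  unfolding M_def by (subst AE_density) (auto simp: indicator_def)

lemma AE_M: "AE x in lborel. Q x \<Longrightarrow> AE x in M. Q x"
  unfolding AE_M_iff by (erule eventually_mono) simp

lemma integral_M:
  fixes f :: "'a \<Rightarrow> 'b::{banach, second_countable_topology}"
  assumes "f \<in> borel_measurable borel"
  shows "(\<integral>x. f x \<partial>M) = (\<integral>x. (indicator D x * exp (- \<nu> * (norm x)\<^sup>2)) *\<^sub>R f x \<partial>lborel)"
  unfolding M_def using assms by (subst integral_density) auto

lemma integrable_M: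
  fixes f :: "'a \<Rightarrow> 'b::{banach, second_countable_topology}"
  assumes "f \<in> borel_measurable borel"
  shows "integrable M f \<longleftrightarrow> integrable lborel (\<lambda>x. (indicator D x * exp (- \<nu> * (norm x)\<^sup>2)) *\<^sub>R f x)"
  unfolding M_def using assms by (subst integrable_density) auto

text \<open>The case c = 0 gives finiteness of the measure; c = \<nu> / 2 provides the majorant for
  exponentials in the totality argument.\<close>

lemma integrable_exp_M:
  assumes "c < \<nu>"
  shows "integrable M (\<lambda>x. exp (c * (norm x)\<^sup>2))"
proof -
  have "integrable lborel (\<lambda>x. indicator D x *\<^sub>R exp (- (\<nu> - c) * (norm x)\<^sup>2))"
    using integrable_gaussian[of "\<nu> - c", where 'a = 'a] assms by (intro integrable_mult_indicator) auto
  moreover have "indicator D x *\<^sub>R exp (- (\<nu> - c) * (norm x)\<^sup>2) =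
      (indicator D x * exp (- \<nu> * (norm x)\<^sup>2)) *\<^sub>R exp (c * (norm x)\<^sup>2)" for x
    by (simp add: exp_add[symmetric] algebra_simps)
  ultimately have "integrable lborel (\<lambda>x. (indicator D x * exp (- \<nu> * (norm x)\<^sup>2)) *\<^sub>R exp (c * (norm x)\<^sup>2))"
    by (simp only:)
  then show ?thesis using integrable_M[of "\<lambda>x. exp (c * (norm x)\<^sup>2)"] by simp
qed

sublocale M: finite_measure M
proof
  have "integrable M (\<lambda>x. 1 :: real)"
    using integrable_exp_M[of 0] \<nu>_pos by simp
  then have "(\<integral>\<^sup>+x. ennreal 1 \<partial>M) < \<infinity>"
    by (simp add: integrable_iff_bounded)
  then show "emeasure M (space M) \<noteq> \<infinity>" by simp
qed

text \<open>The definitions integrate against the completed measure, which agrees with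
  \<open>lborel\<close> on Borel integrands. Writing the weight with \<open>of_real\<close> covers
  the real norm and the complex inner product at once.\<close>

lemma set_integral_eq_M:
  fixes f :: "'a \<Rightarrow> 'b::{banach, second_countable_topology, real_normed_algebra_1}"
  assumes [measurable]: "f \<in> borel_measurable borel"
  shows "set_lebesgue_integral lebesgue D (\<lambda>x. f x * of_real (exp (- \<nu> * (norm x)\<^sup>2))) = (\<integral>x. f x \<partial>M)"
    and "set_integrable lebesgue D (\<lambda>x. f x * of_real (exp (- \<nu> * (norm x)\<^sup>2))) \<longleftrightarrow> integrable M f"
proof -
  have eq: "indicator D x *\<^sub>R (f x * of_real (exp (- \<nu> * (norm x)\<^sup>2))) = (indicator D x * exp (- \<nu> * (norm x)\<^sup>2)) *\<^sub>R f x" for x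
    by (simp add: of_real_def mult.commute)
  have [measurable]: "(\<lambda>x. (indicator D x * exp (- \<nu> * (norm x)\<^sup>2)) *\<^sub>R f x) \<in> borel_measurable borel"
    by measurable
  show "set_lebesgue_integral lebesgue D (\<lambda>x. f x * of_real (exp (- \<nu> * (norm x)\<^sup>2))) = (\<integral>x. f x \<partial>M)"
    unfolding set_lebesgue_integral_def eq by (simp add: integral_M integral_completion)
  show "set_integrable lebesgue D (\<lambda>x. f x * of_real (exp (- \<nu> * (norm x)\<^sup>2))) \<longleftrightarrow> integrable M f"
    unfolding set_integrable_def eq by (simp add: integrable_M integrable_completion)
qed

lemma L2_inner_abs:
  assumes "f \<in> borel_measurable borel" "g \<in> borel_measurable borel"
  shows "L2_inner \<nu> D (abs_ae_fun f) (abs_ae_fun g) = (\<integral>x. f x * cnj (g x) \<partial>M)"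
  using assms set_integral_eq_M(1)[of "\<lambda>x. f x * cnj (g x)"]
  by (simp add: L2_inner.abs_eq)

lemma L2_norm_abs:
  assumes "f \<in> borel_measurable borel"
  shows "L2_norm \<nu> D (abs_ae_fun f) = L2_seminorm M f"
  using assms set_integral_eq_M(1)[of "\<lambda>x. (cmod (f x))\<^sup>2"]
  by (simp add: L2_norm.abs_eq L2_seminorm_def)

lemma in_H_iff:
  assumes "f \<in> borel_measurable borel"
  shows "abs_ae_fun f \<in> H \<longleftrightarrow> QP f \<and> sq_integrable M f"
  using assms set_integral_eq_M(2)[of "\<lambda>x. (cmod (f x))\<^sup>2"]
  by (simp add: L2_space_def quasi_periodic.abs_eq square_integrable_on.abs_eq sq_integrable_def QP_def multiplier_def)

lemma H_cases:
  assumes "f \<in> H"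
  obtains u where "f = abs_ae_fun u" "u \<in> borel_measurable borel" "QP u" "sq_integrable M u"
  using assms in_H_iff by (metis ae_fun_cases)

lemma QP_add: "QP f \<Longrightarrow> QP g \<Longrightarrow> QP (\<lambda>x. f x + g x)"
  unfolding QP_def by (intro ballI, drule (1) bspec, drule (1) bspec, erule (1) eventually_elim2)
    (simp add: distrib_left)

lemma QP_cmult: "QP f \<Longrightarrow> QP (\<lambda>x. c * f x)"
  unfolding QP_def by (intro ballI, drule (1) bspec, erule eventually_mono) simp

text \<open>Countability of \<Gamma> merges the exceptional sets of the separate \<gamma> into a
  single null set.\<close>

lemma QP_all:
  assumes "QP u"
  shows "AE x in lborel. \<forall>\<gamma>\<in>\<Gamma>. u x = multiplier \<gamma> (x - \<gamma>) * u (x - \<gamma>)"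
proof (rule AE_ball_countable'[OF _ countable_\<Gamma>])
  fix \<gamma> assume "\<gamma> \<in> \<Gamma>"
  then have "AE x in lborel. u (x + \<gamma>) = multiplier \<gamma> x * u x"
    using assms by (simp add: QP_def)
  from AE_lborel_shift[OF this, of "- \<gamma>"]
  show "AE x in lborel. u x = multiplier \<gamma> (x - \<gamma>) * u (x - \<gamma>)"
    by simp
qed

text \<open>The source of definiteness: every point is moved into D by some lattice vector, and the
  multiplicative law carries the value 0 back.\<close>

lemma QP_zero:
  assumes "QP u" "AE x in M. u x = 0"
  shows "AE x in lborel. u x = 0"
proof -
  have "AE x in lborel. \<forall>\<gamma>\<in>\<Gamma>. x - \<gamma> \<in> D \<longrightarrow> u (x - \<gamma>) = 0"
    using assms(2) by (intro AE_D_translates) (simp add: AE_M_iff)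
  with QP_all[OF assms(1)] show ?thesis
  proof eventually_elim
    case (elim x)
    obtain \<gamma> where g: "\<gamma> \<in> \<Gamma>" "x - \<gamma> \<in> D" using D_cover by blast
    have "u (x - \<gamma>) = 0" using elim(2) g by blast
    then show ?case using bspec[OF elim(1) g(1)] by simp
  qed
qed

lemma H_zero: "0 \<in> H"
  unfolding zero_ae_fun_def by (subst in_H_iff) (simp_all add: QP_def)

lemma H_add: "f \<in> H \<Longrightarrow> g \<in> H \<Longrightarrow> f + g \<in> H"
proof -
  assume "f \<in> H" "g \<in> H"
  then obtain u w where "f = abs_ae_fun u" "u \<in> borel_measurable borel" "QP u" "sq_integrable M u"
    "g = abs_ae_fun w" "w \<in> borel_measurable borel" "QP w" "sq_integrable M w"
    by (metis H_cases)
  then show ?thesis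
    by (simp add: plus_ae_fun.abs_eq in_H_iff QP_add sq_integrable_add)
qed

lemma H_scale: "f \<in> H \<Longrightarrow> scale_ae c f \<in> H"
proof -
  assume "f \<in> H"
  then obtain u where "f = abs_ae_fun u" "u \<in> borel_measurable borel" "QP u" "sq_integrable M u"
    by (rule H_cases)
  then show ?thesis
    by (simp add: scale_ae.abs_eq in_H_iff QP_cmult sq_integrable_cmult)
qed

lemma L2_inner_self: "(\<integral>x. u x * cnj (u x) \<partial>M) = of_real ((L2_seminorm M u)\<^sup>2)"
  unfolding L2_seminorm_power2 integral_complex_of_real[symmetric]
  by (simp add: complex_mult_cnj cmod_power2)

lemma ip_dist_abs:
  assumes "u \<in> borel_measurable borel" "w \<in> borel_measurable borel" "sq_integrable M u" "sq_integrable M w"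
  shows "ip_dist (L2_inner \<nu> D) (abs_ae_fun u) (abs_ae_fun w) = L2_seminorm M (\<lambda>x. u x - w x)"
  using assms
  by (simp add: ip_dist_def minus_ae_fun.abs_eq L2_inner_abs L2_inner_self del: complex_cnj_diff)

lemma L2_seminorm_zero:
  assumes "sq_integrable M u" "L2_seminorm M u = 0"
  shows "AE x in M. u x = 0"
proof -
  have "(\<integral>x. (cmod (u x))\<^sup>2 \<partial>M) = 0"
    using assms(2) by (simp add: L2_seminorm_def)
  then have "AE x in M. (cmod (u x))\<^sup>2 = 0"
    using assms(1) by (subst (asm) integral_nonneg_eq_0_iff_AE) (auto simp: sq_integrable_def)
  then show ?thesis by eventually_elim simp
qed

text \<open>Nonnegativity and symmetry are demanded for all classes, also outside H, and are
  therefore proved from Borel representatives alone; separation and the triangle inequality use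
  membership in H.\<close>

lemma Metric_space_H: "Metric_space H (ip_dist (L2_inner \<nu> D))"
proof
  let ?d = "ip_dist (L2_inner \<nu> D)"
  show "0 \<le> ?d f g" for f g
  proof -
    obtain u where u: "f - g = abs_ae_fun u" "u \<in> borel_measurable borel" by (rule ae_fun_cases)
    then show ?thesis by (simp add: ip_dist_def L2_inner_abs L2_inner_self)
  qed
  show "?d f g = ?d g f" for f g
  proof -
    obtain u where u: "f = abs_ae_fun u" "u \<in> borel_measurable borel" by (rule ae_fun_cases)
    obtain w where w: "g = abs_ae_fun w" "w \<in> borel_measurable borel" by (rule ae_fun_cases)
    have "(u x - w x) * cnj (u x - w x) = (w x - u x) * cnj (w x - u x)" for x
      by (simp add: algebra_simps)
    then show ?thesis
      using u w by (simp add: ip_dist_def minus_ae_fun.abs_eq L2_inner_abs del: complex_cnj_diff)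
  qed
  fix f g h assume f: "f \<in> H" and g: "g \<in> H"
  obtain u where u: "f = abs_ae_fun u" "u \<in> borel_measurable borel" "QP u" "sq_integrable M u"
    using f by (rule H_cases)
  obtain w where w: "g = abs_ae_fun w" "w \<in> borel_measurable borel" "QP w" "sq_integrable M w"
    using g by (rule H_cases)
  show "?d f g = 0 \<longleftrightarrow> f = g"
  proof
    assume "?d f g = 0"
    then have "AE x in M. u x - w x = 0"
      using u w by (intro L2_seminorm_zero sq_integrable_diff) (auto simp: ip_dist_abs)
    moreover have "QP (\<lambda>x. u x - w x)"
      using QP_add[OF u(3) QP_cmult[OF w(3), of "-1"]] by simp
    ultimately have "AE x in lborel. u x - w x = 0" by (intro QP_zero)
    then show "f = g" using u w by (simp add: abs_ae_fun_eq_iff)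
  next
    assume "f = g"
    have "?d (abs_ae_fun u) (abs_ae_fun u) = 0"
      using u(2,4) by (simp add: ip_dist_abs L2_seminorm_def)
    then show "?d f g = 0" using u(1) \<open>f = g\<close> by simp
  qed
  assume h: "h \<in> H"
  obtain z where z: "h = abs_ae_fun z" "z \<in> borel_measurable borel" "QP z" "sq_integrable M z"
    using h by (rule H_cases)
  show "?d f h \<le> ?d f g + ?d g h"
    using u w z L2_seminorm_triangle_diff[of M u w z] by (simp add: ip_dist_abs)
qed

text \<open>Convergence is known on D only. The law expresses u k (x) through u k (x - \<gamma>)
  with a multiplier independent of k, so convergence spreads to almost every point and the law
  survives in the limit.\<close>

lemma QP_limit:
  assumes u: "\<And>n::nat. QP (u n)" and conv: "AE x in M. convergent (\<lambda>k. u k x)"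
  shows "AE x in lborel. (\<lambda>k. u k x) \<longlonglongrightarrow> lim (\<lambda>k. u k x)" and "QP (\<lambda>x. lim (\<lambda>k. u k x))"
proof -
  have all: "AE x in lborel. \<forall>n. \<forall>\<gamma>\<in>\<Gamma>. u n x = multiplier \<gamma> (x - \<gamma>) * u n (x - \<gamma>)"
    unfolding AE_all_countable using QP_all[OF u] by blast
  have "AE x in lborel. \<forall>\<gamma>\<in>\<Gamma>. x - \<gamma> \<in> D \<longrightarrow> convergent (\<lambda>k. u k (x - \<gamma>))"
    using conv by (intro AE_D_translates) (simp add: AE_M_iff)
  with all have c: "AE x in lborel. convergent (\<lambda>k. u k x)"
  proof eventually_elim
    case (elim x)
    obtain \<gamma> where g: "\<gamma> \<in> \<Gamma>" "x - \<gamma> \<in> D" using D_cover by blast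
    then have "convergent (\<lambda>k. multiplier \<gamma> (x - \<gamma>) * u k (x - \<gamma>))"
      using elim(2) by (intro convergent_mult convergent_const) blast
    moreover have "u k x = multiplier \<gamma> (x - \<gamma>) * u k (x - \<gamma>)" for k
      using elim(1) g(1) by blast
    ultimately show ?case by simp
  qed
  then show lim: "AE x in lborel. (\<lambda>k. u k x) \<longlonglongrightarrow> lim (\<lambda>k. u k x)"
    by (simp add: convergent_LIMSEQ_iff)
  show "QP (\<lambda>x. lim (\<lambda>k. u k x))"
    unfolding QP_def
  proof
    fix \<gamma> assume g: "\<gamma> \<in> \<Gamma>"
    have "AE x in lborel. \<forall>n. u n (x + \<gamma>) = multiplier \<gamma> x * u n x"
      unfolding AE_all_countable using u g by (simp add: QP_def)
    with lim show "AE x in lborel. lim (\<lambda>k. u k (x + \<gamma>)) =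
        multiplier \<gamma> x * lim (\<lambda>k. u k x)"
    proof eventually_elim
      case (elim x)
      have "(\<lambda>k. u k (x + \<gamma>)) \<longlonglongrightarrow> multiplier \<gamma> x * lim (\<lambda>k. u k x)"
        unfolding spec[OF elim(2)] by (intro tendsto_intros elim(1))
      then show ?case by (rule limI)
    qed
  qed
qed

text \<open>Quasi-periodicity is a condition at almost every point of the whole space, invisible to
  the norm. The limit is therefore constructed pointwise along a subsequence, and only afterwards
  identified as the limit in norm.\<close>

lemma mcomplete_H: "Metric_space.mcomplete H (ip_dist (L2_inner \<nu> D))"
proof -
  let ?d = "ip_dist (L2_inner \<nu> D)"
  interpret Metric_space H ?d by (rule Metric_space_H)
  show ?thesis
    unfolding mcomplete_def
  proof (intro allI impI)
    fix \<sigma> assume \<sigma>: "MCauchy \<sigma>"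
    have "\<exists>u. \<sigma> n = abs_ae_fun u \<and> u \<in> borel_measurable borel \<and> QP u \<and> sq_integrable M u" for n
      using \<sigma> H_cases[of "\<sigma> n"] by (metis MCauchy_def rangeI subsetD)
    then obtain u where u: "\<And>n. \<sigma> n = abs_ae_fun (u n)" "\<And>n. u n \<in> borel_measurable borel"
      "\<And>n. QP (u n)" "\<And>n. sq_integrable M (u n)" by metis
    have cauchy: "\<exists>N. \<forall>i\<ge>N. \<forall>j\<ge>N. L2_seminorm M (\<lambda>x. u i x - u j x) < \<epsilon>" if "\<epsilon> > 0" for \<epsilon>
      using \<sigma> that u(2,4) unfolding MCauchy_def u(1) by (simp add: ip_dist_abs)
    obtain r where r: "strict_mono r" "AE x in M. convergent (\<lambda>k. u (r k) x)"
      using M.L2_Cauchy_subsequence[OF u(4) cauchy] by blast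
    define f where "f x = lim (\<lambda>k. u (r k) x)" for x
    have f_meas: "f \<in> borel_measurable borel"
      unfolding f_def using u(2) by (intro borel_measurable_lim_metric) auto
    have f_lim: "AE x in lborel. (\<lambda>k. u (r k) x) \<longlonglongrightarrow> f x" and "QP f"
      unfolding f_def using QP_limit[of "\<lambda>k. u (r k)"] u(3) r(2) by blast+
    note f = L2_limit_of_AE_limit[OF u(4) cauchy r(1) AE_M[OF f_lim]]
    have conv: "\<exists>N. \<forall>n\<ge>N. L2_seminorm M (\<lambda>x. u n x - f x) < \<epsilon>" if "\<epsilon> > 0" for \<epsilon>
      using f(2) f_meas that by simp
    have f2: "sq_integrable M f" using f(1) f_meas by simp
    have "abs_ae_fun f \<in> H" using f_meas \<open>QP f\<close> f2 by (simp add: in_H_iff)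
    moreover have "\<sigma> n \<in> H" for n using u by (simp add: in_H_iff)
    moreover have "\<exists>N. \<forall>n\<ge>N. ?d (\<sigma> n) (abs_ae_fun f) < \<epsilon>" if "\<epsilon> > 0" for \<epsilon>
      using conv[OF that] u f_meas f2 by (simp add: ip_dist_abs)
    ultimately show "\<exists>x. limitin mtopology \<sigma> x sequentially"
      unfolding limit_metric_sequentially by blast
  qed
qed

theorem hilbert_space_H: "hilbert_space scale_ae H (L2_inner \<nu> D)"
  unfolding hilbert_space_def
proof (intro conjI ballI allI impI)
  show "vector_space scale_ae" by (rule ae.vector_space_axioms)
  show "ae.subspace H" by (intro ae.subspaceI H_zero H_add H_scale)
  show "Metric_space.mcomplete H (ip_dist (L2_inner \<nu> D))" by (rule mcomplete_H)
  fix f assume "f \<in> H"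
  then obtain u where u: "f = abs_ae_fun u" "u \<in> borel_measurable borel" "QP u" "sq_integrable M u"
    by (rule H_cases)
  {
    assume "f \<noteq> 0"
    have "L2_seminorm M u \<noteq> 0"
    proof
      assume "L2_seminorm M u = 0"
      then have "AE x in lborel. u x = 0" using L2_seminorm_zero QP_zero u by blast
      then have "f = 0" using u by (simp add: zero_ae_fun_def abs_ae_fun_eq_iff)
      then show False using \<open>f \<noteq> 0\<close> by simp
    qed
    then show "Re (L2_inner \<nu> D f f) > 0"
      using u by (simp add: L2_inner_abs L2_inner_self)
  }
  fix g assume "g \<in> H"
  then obtain w where w: "g = abs_ae_fun w" "w \<in> borel_measurable borel" "QP w" "sq_integrable M w"
    by (rule H_cases)
  show "L2_inner \<nu> D (scale_ae c f) g = c * L2_inner \<nu> D f g" for c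
    using u w by (simp add: scale_ae.abs_eq L2_inner_abs mult.assoc)
  show "L2_inner \<nu> D g f = cnj (L2_inner \<nu> D f g)"
  proof -
    have "cnj (\<integral>x. u x * cnj (w x) \<partial>M) = (\<integral>x. cnj (u x * cnj (w x)) \<partial>M)"
      by (simp only: Bochner_Integration.integral_cnj)
    then show ?thesis using u w by (simp add: L2_inner_abs mult.commute)
  qed
  fix h assume "h \<in> H"
  then obtain z where z: "h = abs_ae_fun z" "z \<in> borel_measurable borel" "QP z" "sq_integrable M z"
    by (rule H_cases)
  show "L2_inner \<nu> D (f + g) h = L2_inner \<nu> D f h + L2_inner \<nu> D g h"
    using u w z sq_integrable_mult_integrable[OF u(4) z(4)] sq_integrable_mult_integrable[OF w(4) z(4)]
    by (simp add: plus_ae_fun.abs_eq L2_inner_abs distrib_right)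
qed

end

section \<open>Orthogonality\<close>

lemma borel_measurable_poly [measurable]: "(\<lambda>x::real. poly p x) \<in> borel_measurable borel"
  by (intro borel_measurable_continuous_onI continuous_intros)

context quasi_periodic_space
begin

definition herm :: "(nat \<Rightarrow> nat) \<Rightarrow> 'a \<Rightarrow> real" where
  "herm k x = (\<Prod>j<m. poly (hermite_poly (k j)) (sqrt \<nu> * (x \<bullet> b j)))"

definition factor :: "'a \<Rightarrow> complex" where
  "factor x = of_real (exp (\<nu> / 2 * (norm (x - perp x))\<^sup>2)) * trig v x"

abbreviation e where "e \<equiv> e_fun \<nu> \<Gamma> v m b"
abbreviation ec where "ec \<equiv> e_class \<nu> \<Gamma> v m b"

text \<open>As \<open>v + \<delta>\<close> lies in the span, pairing it with x or with the span
  component of x gives the same value.\<close>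

lemma e_eq:
  assumes "\<delta> \<in> dual"
  shows "e \<delta> k x = factor x * (trig \<delta> x * of_real (herm k x))"
proof -
  have "v + \<delta> \<in> span \<Gamma>"
    using v assms by (auto simp: dual_lattice_def intro: span_add)
  then have "(v + \<delta>) \<bullet> (x - perp x) = v \<bullet> x + \<delta> \<bullet> x"
    using V_orthogonal_perp[of "v + \<delta>" x] by (simp add: inner_diff_right inner_add_left)
  then show ?thesis
    by (simp add: e_fun_def orth_proj_eq hermite_eq_prod perp_inner factor_def trig_def herm_def
        power2_norm_eq_inner Let_def exp_add exp_of_real[symmetric] distrib_left del: exp_of_real)
qed

lemma measurable_herm [measurable]: "herm k \<in> borel_measurable borel"
  unfolding herm_def by measurable

lemma measurable_factor [measurable]: "factor \<in> borel_measurable borel"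
  unfolding factor_def by measurable

lemma measurable_e: "\<delta> \<in> dual \<Longrightarrow> e \<delta> k \<in> borel_measurable borel"
  by (subst measurable_cong[OF e_eq]) simp_all

lemma norm_trig [simp]: "cmod (trig \<delta> x) = 1"
  by (simp add: trig_def)

lemma trig_add: "trig (\<delta> + \<delta>') x = trig \<delta> x * trig \<delta>' x"
  by (simp add: trig_def inner_add_left distrib_left exp_add)

lemma trig_mult_cnj: "trig \<delta> x * cnj (trig \<delta>' x) = trig (\<delta> - \<delta>') x"
  by (simp add: trig_def exp_cnj inner_diff_left exp_add[symmetric] algebra_simps)

lemma norm_factor: "cmod (factor x) = exp (\<nu> / 2 * (norm (x - perp x))\<^sup>2)"
  by (simp add: factor_def norm_mult)

lemma factor_nonzero: "factor x \<noteq> 0"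
  using norm_factor[of x] by auto

text \<open>The exponent \<nu> / 2 |x1 + \<gamma>|^2 exceeds \<nu> / 2 |x1|^2 by \<nu> (x +
  \<gamma>/2, \<gamma>), the exponent in the multiplier, while \<open>trig v\<close> contributes the
  character.\<close>

lemma factor_shift:
  assumes "\<gamma> \<in> \<Gamma>"
  shows "factor (x + \<gamma>) = multiplier \<gamma> x * factor x"
proof -
  have g: "\<gamma> \<in> span \<Gamma>" using assms by (rule span_base)
  have "\<gamma> \<bullet> perp x = 0" by (rule V_orthogonal_perp[OF g])
  then have "(norm (x + \<gamma> - perp (x + \<gamma>)))\<^sup>2 = (norm (x - perp x))\<^sup>2 + 2 * (x \<bullet> \<gamma>) + \<gamma> \<bullet> \<gamma>"
    by (simp add: perp_add perp_V[OF g] power2_norm_eq_inner inner_diff_left inner_diff_right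
        inner_add_left inner_add_right inner_commute)
  then have "\<nu> / 2 * (norm (x + \<gamma> - perp (x + \<gamma>)))\<^sup>2 = \<nu> / 2 * (norm (x - perp x))\<^sup>2 + \<nu> * ((x + \<gamma> /\<^sub>R 2) \<bullet> \<gamma>)"
    by (simp add: inner_add_left algebra_simps)
  then have "exp (\<nu> / 2 * (norm (x + \<gamma> - perp (x + \<gamma>)))\<^sup>2) =
      exp (\<nu> / 2 * (norm (x - perp x))\<^sup>2) * exp (\<nu> * ((x + \<gamma> /\<^sub>R 2) \<bullet> \<gamma>))"
    by (simp only: exp_add)
  moreover have "trig v \<gamma> = chi \<gamma>"
    by (simp add: trig_def chi[OF assms] inner_commute mult_ac)
  ultimately show ?thesis
    by (simp only: factor_def multiplier_def trig_add_right of_real_mult mult_ac)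
qed

lemma QP_factor_iff:
  "QP (\<lambda>x. factor x * g x) \<longleftrightarrow> (\<forall>\<gamma>\<in>\<Gamma>. AE x in lborel. g (x + \<gamma>) = g x)"
proof -
  have "(AE x in lborel. factor (x + \<gamma>) * g (x + \<gamma>) =
      multiplier \<gamma> x * (factor x * g x)) \<longleftrightarrow>
      (AE x in lborel. g (x + \<gamma>) = g x)" if "\<gamma> \<in> \<Gamma>" for \<gamma>
  proof -
    have "factor (x + \<gamma>) * g (x + \<gamma>) =
        multiplier \<gamma> x * (factor x * g x) \<longleftrightarrow> g (x + \<gamma>) = g x" for x
      using factor_nonzero[of "x + \<gamma>"] unfolding mult.assoc[symmetric] factor_shift[OF that, symmetric] by simp
    then show ?thesis by simp
  qed
  then show ?thesis by (simp add: QP_def)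
qed

lemma herm_shift: "\<gamma> \<in> \<Gamma> \<Longrightarrow> herm k (x + \<gamma>) = herm k x"
  by (simp add: herm_def inner_add_left b_orthogonal span_base)

lemma QP_e:
  assumes "\<delta> \<in> dual"
  shows "QP (e \<delta> k)"
proof -
  have "e \<delta> k = (\<lambda>x. factor x * (trig \<delta> x * of_real (herm k x)))"
    using e_eq[OF assms] by blast
  then show ?thesis
    by (simp only: QP_factor_iff) (simp add: trig_add_right trig_lattice assms herm_shift)
qed

definition hermite_weight :: "(nat \<Rightarrow> nat) \<Rightarrow> (nat \<Rightarrow> nat) \<Rightarrow> (nat \<Rightarrow> real) \<Rightarrow> real" where
  "hermite_weight k k' c = (\<Prod>j<m. poly (hermite_poly (k j)) (sqrt \<nu> * c j) *
     poly (hermite_poly (k' j)) (sqrt \<nu> * c j) * exp (- \<nu> * (c j)\<^sup>2))"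

lemma measurable_hermite_weight [measurable]: "hermite_weight k k' \<in> borel_measurable N"
  unfolding hermite_weight_def by measurable

lemma integral_hermite_weight:
  "(\<integral>c. hermite_weight k k' c \<partial>N) = (\<Prod>j<m. if k j = k' j then sqrt (pi / \<nu>) * 2 ^ k j * fact (k j) else 0)"
proof -
  interpret product_sigma_finite "\<lambda>_::nat. lborel :: real measure" ..
  show ?thesis
    unfolding hermite_weight_def
    by (subst product_integral_prod) (rule finite_lessThan, rule hermite_orthogonal_scaled(2)[OF \<nu>_pos],
      simp only: hermite_orthogonal_scaled(1)[OF \<nu>_pos])
qed

text \<open>The squared modulus of \<open>factor\<close> cancels the weight in the direction of the
  span, leaving the character of \<delta> - \<delta>' times a function of the complement
  coordinates. Distinct frequencies integrate to 0; equal ones leave \<open>vol\<close> times a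
  product of one-variable Hermite integrals.\<close>

lemma integral_e_mult_cnj:
  assumes \<delta>: "\<delta> \<in> dual" "\<delta>' \<in> dual"
  shows "(\<integral>x. e \<delta> k x * cnj (e \<delta>' k' x) \<partial>M) =
    (if \<delta> = \<delta>' then of_real (vol * (\<Prod>j<m. if k j = k' j then sqrt (pi / \<nu>) * 2 ^ k j * fact (k j) else 0)) else 0)"
proof -
  have [measurable]: "e \<delta> k \<in> borel_measurable borel" "e \<delta>' k' \<in> borel_measurable borel"
    using measurable_e \<delta> by blast+
  have factor: "factor x * cnj (factor x) = of_real (exp (\<nu> * (norm (x - perp x))\<^sup>2))" for x
    by (simp add: complex_norm_square[symmetric] norm_factor exp_double[symmetric] del: of_real_power of_real_exp exp_of_real)
  have pw: "(indicator D x * exp (- \<nu> * (norm x)\<^sup>2)) *\<^sub>R (e \<delta> k x * cnj (e \<delta>' k' x)) =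
      indicator D x *\<^sub>R (trig (\<delta> - \<delta>') x * of_real (hermite_weight k k' (crd x)))" for x
  proof -
    have "exp (- \<nu> * (norm x)\<^sup>2) * exp (\<nu> * (norm (x - perp x))\<^sup>2) = (\<Prod>j<m. exp (- \<nu> * (x \<bullet> b j)\<^sup>2))"
      by (simp add: norm_split[of x] exp_add[symmetric] exp_sum[symmetric] sum_distrib_left sum_negf algebra_simps)
    then have w: "exp (- \<nu> * (norm x)\<^sup>2) * exp (\<nu> * (norm (x - perp x))\<^sup>2) * (herm k x * herm k' x) = hermite_weight k k' (crd x)"
      by (simp add: herm_def hermite_weight_def coords_def prod.distrib[symmetric] mult_ac)
    have "e \<delta> k x * cnj (e \<delta>' k' x) = (factor x * cnj (factor x)) * (trig \<delta> x * cnj (trig \<delta>' x)) *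
        of_real (herm k x * herm k' x)"
      by (simp add: e_eq[OF \<delta>(1)] e_eq[OF \<delta>(2)] mult_ac)
    also have "\<dots> = of_real (exp (\<nu> * (norm (x - perp x))\<^sup>2) * (herm k x * herm k' x)) * trig (\<delta> - \<delta>') x"
      unfolding factor trig_mult_cnj by (simp add: mult_ac)
    finally have "e \<delta> k x * cnj (e \<delta>' k' x) = \<dots>" .
    then show ?thesis
      unfolding w[symmetric] scaleR_conv_of_real by (simp add: mult_ac)
  qed
  have eq: "(\<integral>x. e \<delta> k x * cnj (e \<delta>' k' x) \<partial>M) =
      (\<integral>x. indicator D x *\<^sub>R (trig (\<delta> - \<delta>') x * of_real (hermite_weight k k' (crd x))) \<partial>lborel)"
    by (subst integral_M) (simp_all only: pw, measurable)
  show ?thesis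
  proof (cases "\<delta> = \<delta>'")
    case True
    have "(\<integral>x. e \<delta> k x * cnj (e \<delta>' k' x) \<partial>M) = (\<integral>x. of_real (indicator D x * hermite_weight k k' (crd x)) \<partial>lborel)"
      unfolding eq by (intro Bochner_Integration.integral_cong refl)
        (simp add: True trig_def scaleR_conv_of_real)
    also have "\<dots> = of_real (\<integral>x. indicator D x * hermite_weight k k' (crd x) \<partial>lborel)"
      by (rule integral_complex_of_real)
    finally show ?thesis
      using True by (simp only: integral_D_coords[OF measurable_hermite_weight] integral_hermite_weight simp_thms if_True)
  next
    case False
    have "\<delta> - \<delta>' \<in> dual"
      using \<delta> by (auto simp: dual_lattice_def inner_diff_left intro: span_diff)
    then show ?thesis
      using integral_character_zero[OF _ _ measurable_hermite_weight, of "\<delta> - \<delta>'" k k'] False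
      unfolding eq by simp
  qed
qed

lemma L2_norm_e:
  assumes "\<delta> \<in> dual"
  shows "(L2_seminorm M (e \<delta> k))\<^sup>2 = vol * (\<Prod>j<m. sqrt (pi / \<nu>) * 2 ^ k j * fact (k j))"
proof -
  have "(\<integral>x. e \<delta> k x * cnj (e \<delta> k x) \<partial>M) = of_real ((L2_seminorm M (e \<delta> k))\<^sup>2)"
    by (rule L2_inner_self)
  then show ?thesis
    unfolding integral_e_mult_cnj[OF assms assms] by (simp only: if_True refl of_real_eq_iff)
qed

lemma L2_norm_e_pos: "\<delta> \<in> dual \<Longrightarrow> (L2_seminorm M (e \<delta> k))\<^sup>2 > 0"
  unfolding L2_norm_e using vol_pos \<nu>_pos by (intro mult_pos_pos prod_pos) auto

text \<open>A Bochner integral is 0 when the integrand is not integrable, so the positive value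
  already computed for the squared norm proves integrability.\<close>

lemma sq_integrable_e:
  assumes "\<delta> \<in> dual"
  shows "sq_integrable M (e \<delta> k)"
proof -
  have "integrable M (\<lambda>x. (cmod (e \<delta> k x))\<^sup>2)"
    using L2_norm_e_pos[OF assms, of k] unfolding L2_seminorm_power2
    by (metis not_integrable_integral_eq less_irrefl)
  then show ?thesis
    using measurable_e[OF assms] by (simp add: sq_integrable_def)
qed

lemma e_class_eq: "ec \<delta> k = abs_ae_fun (e \<delta> k)"
  by (simp add: e_class_def)

lemma e_class_in_H:
  assumes "\<delta> \<in> dual"
  shows "ec \<delta> k \<in> H"
  using assms by (simp add: e_class_eq in_H_iff measurable_e QP_e sq_integrable_e)

lemma e_class_norm:
  assumes "\<delta> \<in> dual"
  shows "(L2_norm \<nu> D (ec \<delta> k))\<^sup>2 =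
    vol * (pi / \<nu>) powr (real m / 2) * 2 ^ (\<Sum>j<m. k j) * (\<Prod>j<m. fact (k j))"
proof -
  have "sqrt (pi / \<nu>) ^ m = (pi / \<nu>) powr (real m / 2)"
    using \<nu>_pos by (simp add: powr_half_sqrt[symmetric] powr_realpow[symmetric] powr_powr)
  then show ?thesis
    using assms by (simp add: e_class_eq L2_norm_abs measurable_e L2_norm_e prod.distrib power_sum)
qed

lemma e_class_nonzero:
  assumes "\<delta> \<in> dual"
  shows "ec \<delta> k \<noteq> 0"
proof
  assume "ec \<delta> k = 0"
  then have "(L2_norm \<nu> D (ec \<delta> k))\<^sup>2 = (L2_seminorm M (\<lambda>x. 0))\<^sup>2"
    by (simp add: zero_ae_fun_def L2_norm_abs)
  then show False
    using assms L2_norm_e_pos[OF assms, of k]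
    by (simp add: e_class_eq L2_norm_abs measurable_e L2_seminorm_def[of _ "\<lambda>x. 0"])
qed

lemma e_class_orthogonal:
  assumes \<delta>: "\<delta> \<in> dual" "\<delta>' \<in> dual"
    and k: "k \<in> multi_indices m" "k' \<in> multi_indices m" and ne: "(\<delta>, k) \<noteq> (\<delta>', k')"
  shows "L2_inner \<nu> D (ec \<delta> k) (ec \<delta>' k') = 0"
proof (cases "\<delta> = \<delta>'")
  case True
  then have "k \<noteq> k'" using ne by simp
  \<comment> \<open>Multi-indices are extensional, so distinct ones differ at some index below
    m.\<close>
  then obtain j where "j < m" "k j \<noteq> k' j"
    using PiE_ext[OF k[unfolded multi_indices_def]] by auto
  then have "(\<Prod>j<m. if k j = k' j then sqrt (pi / \<nu>) * 2 ^ k j * fact (k j) else 0) = 0"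
    by (intro prod_zero) auto
  then show ?thesis
    using \<delta> by (simp only: e_class_eq L2_inner_abs measurable_e integral_e_mult_cnj) simp
next
  case False
  then show ?thesis
    using \<delta> by (simp add: e_class_eq L2_inner_abs measurable_e integral_e_mult_cnj)
qed

end

section \<open>Totality\<close>

text \<open>A span of functions rather than classes, so that pointwise products and bounds remain
  available.\<close>

inductive_set fun_span :: "('a \<Rightarrow> complex) set \<Rightarrow> ('a \<Rightarrow> complex) set" for W where
  zero: "(\<lambda>x. 0) \<in> fun_span W"
| step: "w \<in> W \<Longrightarrow> f \<in> fun_span W \<Longrightarrow> (\<lambda>x. c * w x + f x) \<in> fun_span W"

lemma fun_span_cmult_base: "w \<in> W \<Longrightarrow> (\<lambda>x. c * w x) \<in> fun_span W"
  using fun_span.step[OF _ fun_span.zero, of w W c] by simp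

lemma fun_span_add:
  assumes "f \<in> fun_span W" "g \<in> fun_span W"
  shows "(\<lambda>x. f x + g x) \<in> fun_span W"
  using assms(1)
proof induction
  case zero
  then show ?case using assms(2) by simp
next
  case (step w f c)
  show ?case using fun_span.step[OF step(1,3), of c] by (simp add: add.assoc)
qed

lemma fun_span_cmult:
  assumes "f \<in> fun_span W"
  shows "(\<lambda>x. c * f x) \<in> fun_span W"
  using assms
proof induction
  case zero
  show ?case using fun_span.zero by simp
next
  case (step w f a)
  show ?case using fun_span.step[OF step(1,3), of "c * a"] by (simp add: algebra_simps)
qed

lemma fun_span_sum:
  assumes "\<And>i. i \<in> I \<Longrightarrow> f i \<in> fun_span W"
  shows "(\<lambda>x. \<Sum>i\<in>I. f i x) \<in> fun_span W"
  using assms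
proof (induction I rule: infinite_finite_induct)
  case (insert i I)
  have "(\<lambda>x. f i x + (\<Sum>i\<in>I. f i x)) \<in> fun_span W"
    by (rule fun_span_add) (simp_all add: insert)
  then show ?case using insert.hyps by simp
qed (simp_all add: fun_span.zero)

lemma fun_span_mult:
  assumes "f \<in> fun_span W" "g \<in> fun_span W"
    and W: "\<And>u w. u \<in> W \<Longrightarrow> w \<in> W \<Longrightarrow> (\<lambda>x. u x * w x) \<in> W"
  shows "(\<lambda>x. f x * g x) \<in> fun_span W"
proof -
  have base: "(\<lambda>x. u x * g x) \<in> fun_span W" if u: "u \<in> W" for u
    using assms(2)
  proof induction
    case zero
    show ?case using fun_span.zero by simp
  next
    case (step w f a)
    show ?case using fun_span.step[OF W[OF u step(1)] step(3), of a] by (simp add: algebra_simps)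
  qed
  show ?thesis
    using assms(1)
  proof induction
    case zero
    show ?case using fun_span.zero by simp
  next
    case (step w f a)
    show ?case
      using fun_span_add[OF fun_span_cmult[OF base[OF step(1)], of a] step(3)] by (simp add: algebra_simps)
  qed
qed

lemma fun_span_L2_closure:
  assumes "f \<in> fun_span W" "\<And>w. w \<in> W \<Longrightarrow> w \<in> L2_closure M (fun_span V)"
  shows "f \<in> L2_closure M (fun_span V)"
  using assms(1)
proof induction
  case zero
  show ?case by (rule L2_closure_base[OF fun_span.zero]) simp
next
  case (step w f c)
  show ?case
    by (rule L2_closure_add[OF L2_closure_cmult[OF assms(2)[OF step(1)] fun_span_cmult] step(3) fun_span_add])
qed

text \<open>Multiplication by h is Lipschitz for the seminorm with constant C. With h =
  \<open>factor\<close> it turns approximations of periodic functions into approximations of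
  quasi-periodic ones.\<close>

lemma L2_closure_mult_bounded:
  assumes f: "f \<in> L2_closure M E" and h: "h \<in> borel_measurable M" and C: "AE x in M. cmod (h x) \<le> C" "C > 0"
    and E: "\<And>g. g \<in> E \<Longrightarrow> (\<lambda>x. h x * g x) \<in> F"
  shows "(\<lambda>x. h x * f x) \<in> L2_closure M F"
proof -
  have bound: "AE x in M. (cmod (h x * g x))\<^sup>2 \<le> C\<^sup>2 * (cmod (g x))\<^sup>2" for g
    using C(1)
  proof eventually_elim
    case (elim x)
    then show ?case
      unfolding norm_mult power_mult_distrib by (intro mult_right_mono power_mono) auto
  qed
  have mult: "sq_integrable M (\<lambda>x. h x * g x)" if "sq_integrable M g" for g
    using that h by (intro sq_integrable_bound[OF _ _ bound, of g]) (auto simp: sq_integrable_def)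
  have f2: "sq_integrable M f" using f by (rule L2_closure_sq_integrable)
  show ?thesis
    unfolding L2_closure_def
  proof (intro CollectI conjI allI impI mult f2)
    fix \<epsilon> :: real assume "\<epsilon> > 0"
    then obtain g where g: "g \<in> E" "sq_integrable M g" "L2_seminorm M (\<lambda>x. f x - g x) < \<epsilon> / C"
      using f C(2) unfolding L2_closure_def by (auto dest!: spec[of _ "\<epsilon> / C"])
    have d: "sq_integrable M (\<lambda>x. f x - g x)" by (rule sq_integrable_diff[OF f2 g(2)])
    have "(L2_seminorm M (\<lambda>x. h x * (f x - g x)))\<^sup>2 \<le> (\<integral>x. C\<^sup>2 * (cmod (f x - g x))\<^sup>2 \<partial>M)"
      unfolding L2_seminorm_power2 using mult[OF d] d
      by (intro integral_mono_AE bound) (auto simp: sq_integrable_def)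
    also have "\<dots> = (C * L2_seminorm M (\<lambda>x. f x - g x))\<^sup>2"
      by (simp add: L2_seminorm_power2 power_mult_distrib)
    finally have "L2_seminorm M (\<lambda>x. h x * (f x - g x)) \<le> C * L2_seminorm M (\<lambda>x. f x - g x)"
      by (rule power2_le_imp_le) (use C(2) in simp)
    also have "\<dots> < \<epsilon>" using g(3) C(2) by (simp add: field_simps)
    finally show "\<exists>g\<in>F. sq_integrable M g \<and> L2_seminorm M (\<lambda>x. h x * f x - g x) < \<epsilon>"
      using E[OF g(1)] mult[OF g(2)] by (intro bexI[of _ "\<lambda>x. h x * g x"]) (simp_all add: right_diff_distrib)
  qed
qed

definition exp_partial :: "nat \<Rightarrow> complex \<Rightarrow> complex" where
  "exp_partial n z = (\<Sum>p\<le>n. z ^ p /\<^sub>R fact p)"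

lemma exp_partial_bound: "cmod (exp_partial n z) \<le> exp (cmod z)"
proof -
  have "cmod (exp_partial n z) \<le> (\<Sum>p\<le>n. cmod z ^ p /\<^sub>R fact p)"
    unfolding exp_partial_def by (rule order_trans[OF norm_sum]) (simp add: norm_power)
  also have "\<dots> \<le> (\<Sum>p. cmod z ^ p /\<^sub>R fact p)"
    by (rule sum_le_suminf[OF summable_exp_generic]) auto
  finally show ?thesis by (simp add: exp_def)
qed

context quasi_periodic_space
begin

text \<open>The basis functions after division by \<open>factor\<close>.\<close>

definition hermite_system :: "('a \<Rightarrow> complex) set" where
  "hermite_system = {\<lambda>x. trig \<delta> x * of_real (herm k x) | \<delta> k. \<delta> \<in> dual \<and> k \<in> multi_indices m}"

definition wave :: "'a \<Rightarrow> (nat \<Rightarrow> real) \<Rightarrow> 'a \<Rightarrow> complex" where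
  "wave \<delta> \<xi> x = trig \<delta> x * exp (\<i> * of_real (\<Sum>j<m. \<xi> j * (x \<bullet> b j)))"

definition waves :: "('a \<Rightarrow> complex) set" where
  "waves = {wave \<delta> \<xi> | \<delta> \<xi>. \<delta> \<in> dual}"

lemma measurable_wave [measurable]: "wave \<delta> \<xi> \<in> borel_measurable borel"
  unfolding wave_def by measurable

lemma factor_ge_1: "cmod (factor x) \<ge> 1"
  unfolding norm_factor using \<nu>_pos by simp

lemma factor_bounded: "\<exists>C>0. AE x in M. cmod (factor x) \<le> C"
proof -
  obtain R where R: "\<And>x. x \<in> L \<Longrightarrow> norm x \<le> R"
    using compact_imp_bounded[OF compact_L] by (auto simp: bounded_iff)
  have "cmod (factor x) \<le> exp (\<nu> / 2 * R\<^sup>2)" if "x \<in> D" for x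
    unfolding norm_factor using that R[of "x - perp x"] \<nu>_pos
    by (auto simp: D_iff intro!: mult_left_mono power_mono)
  then show ?thesis
    by (intro exI[of _ "exp (\<nu> / 2 * R\<^sup>2)"]) (auto simp: AE_M_iff)
qed

text \<open>Each truncated exponential is a polynomial in one coordinate and so a combination of
  Hermite polynomials of degree at most n. Multiplying out over the coordinates yields one term for
  each multi-index with entries at most n.\<close>

lemma exp_polynomial_in_span:
  assumes \<delta>: "\<delta> \<in> dual"
  shows "(\<lambda>x. trig \<delta> x * (\<Prod>j<m. exp_partial n (\<i> * of_real (\<xi> j * (x \<bullet> b j)))))
    \<in> fun_span hermite_system"
proof -
  have "\<exists>a. monom 1 p = (\<Sum>i\<le>n. smult (a i) (hermite_poly i))" if "p \<le> n" for p
    using that by (intro hermite_poly_expansion) (simp add: degree_monom_eq)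
  then obtain a where a: "\<And>p. p \<le> n \<Longrightarrow> monom 1 p = (\<Sum>i\<le>n. smult (a p i) (hermite_poly i))"
    by metis
  have pow: "t ^ p = (\<Sum>i\<le>n. a p i * poly (hermite_poly i) t)" if "p \<le> n" for p t
    using arg_cong[OF a[OF that], of "\<lambda>q. poly q t"] by (simp add: poly_monom poly_sum)
  \<comment> \<open>The factor 1 / sqrt \<nu> compensates for evaluating the Hermite polynomials at
    \<open>sqrt \<nu> * t\<close>.\<close>
  define z where "z j = \<i> * of_real (\<xi> j / sqrt \<nu>)" for j
  define A where "A j q = (\<Sum>p\<le>n. z j ^ p /\<^sub>R fact p * of_real (a p q))" for j q
  have factor: "exp_partial n (\<i> * of_real (\<xi> j * t)) =
      (\<Sum>q\<le>n. A j q * of_real (poly (hermite_poly q) (sqrt \<nu> * t)))" for j t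
  proof -
    have split: "\<i> * of_real (\<xi> j * t) = z j * of_real (sqrt \<nu> * t)"
      using \<nu>_pos by (simp add: z_def)
    have "exp_partial n (\<i> * of_real (\<xi> j * t)) =
        (\<Sum>p\<le>n. z j ^ p /\<^sub>R fact p * of_real ((sqrt \<nu> * t) ^ p))"
      unfolding split exp_partial_def by (simp only: power_mult_distrib of_real_power of_real_mult mult_scaleR_left)
    also have "\<dots> = (\<Sum>p\<le>n. \<Sum>q\<le>n. z j ^ p /\<^sub>R fact p * of_real (a p q)
        * of_real (poly (hermite_poly q) (sqrt \<nu> * t)))"
    proof (rule sum.cong[OF refl])
      fix p assume "p \<in> {..n}"
      then have p: "p \<le> n" by simp
      show "z j ^ p /\<^sub>R fact p * of_real ((sqrt \<nu> * t) ^ p) =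
        (\<Sum>q\<le>n. z j ^ p /\<^sub>R fact p * of_real (a p q)
        * of_real (poly (hermite_poly q) (sqrt \<nu> * t)))"
        unfolding pow[OF p] of_real_sum sum_distrib_left of_real_mult mult.assoc ..
    qed
    also have "\<dots> = (\<Sum>q\<le>n. A j q * of_real (poly (hermite_poly q) (sqrt \<nu> * t)))"
      unfolding A_def sum_distrib_right by (rule sum.swap)
    finally show ?thesis .
  qed
  define S where "S = PiE {..<m} (\<lambda>_. {..n})"
  have S: "finite S" "S \<subseteq> multi_indices m"
    unfolding S_def multi_indices_def by (auto intro!: finite_PiE)
  have "(\<lambda>x. trig \<delta> x * (\<Prod>j<m. exp_partial n (\<i> * of_real (\<xi> j * (x \<bullet> b j))))) =
      (\<lambda>x. \<Sum>k\<in>S. (\<Prod>j<m. A j (k j)) * (trig \<delta> x * of_real (herm k x)))"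
  proof
    fix x
    have "(\<Prod>j<m. exp_partial n (\<i> * of_real (\<xi> j * (x \<bullet> b j)))) =
        (\<Sum>k\<in>S. \<Prod>j<m. A j (k j) * of_real (poly (hermite_poly (k j)) (sqrt \<nu> * (x \<bullet> b j))))"
      unfolding factor S_def by (rule prod_sum_PiE) auto
    then show "trig \<delta> x * (\<Prod>j<m. exp_partial n (\<i> * of_real (\<xi> j * (x \<bullet> b j)))) =
        (\<Sum>k\<in>S. (\<Prod>j<m. A j (k j)) * (trig \<delta> x * of_real (herm k x)))"
      by (simp add: prod.distrib herm_def sum_distrib_left mult_ac)
  qed
  also have "\<dots> \<in> fun_span hermite_system"
  proof (rule fun_span_sum)
    fix k assume "k \<in> S"
    then have "(\<lambda>x. trig \<delta> x * of_real (herm k x)) \<in> hermite_system"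
      using S(2) \<delta> by (auto simp: hermite_system_def)
    then show "(\<lambda>x. (\<Prod>j<m. A j (k j)) * (trig \<delta> x * of_real (herm k x))) \<in> fun_span hermite_system"
      by (rule fun_span_cmult_base)
  qed
  finally show ?thesis .
qed

lemma sq_integrable_hermite_system:
  assumes "w \<in> hermite_system"
  shows "sq_integrable M w"
proof -
  obtain \<delta> k where \<delta>: "\<delta> \<in> dual" and w: "w = (\<lambda>x. trig \<delta> x * of_real (herm k x))"
    using assms by (auto simp: hermite_system_def)
  show ?thesis
  proof (rule sq_integrable_bound[of M "\<lambda>x. (cmod (e \<delta> k x))\<^sup>2"])
    show "integrable M (\<lambda>x. (cmod (e \<delta> k x))\<^sup>2)"
      using sq_integrable_e[OF \<delta>] by (simp add: sq_integrable_def)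
    show "w \<in> borel_measurable M" unfolding w by simp
    have "cmod (w x) \<le> cmod (e \<delta> k x)" for x
      using mult_right_mono[OF factor_ge_1[of x] norm_ge_zero, of "w x"]
      by (simp add: e_eq[OF \<delta>] w norm_mult)
    then show "AE x in M. (cmod (w x))\<^sup>2 \<le> (cmod (e \<delta> k x))\<^sup>2"
      by (intro AE_I2 power_mono) auto
  qed
qed

lemma sq_integrable_fun_span:
  assumes "f \<in> fun_span hermite_system"
  shows "sq_integrable M f"
  using assms
proof induction
  case (step w f c)
  show ?case
    by (rule sq_integrable_add[OF sq_integrable_cmult[OF sq_integrable_hermite_system[OF step(1)]] step(3)])
qed simp

text \<open>Taylor sums of the exponentials converge pointwise and are bounded by the product of exp
  |\<xi> j x j|. The square of this product grows more slowly than exp (\<nu> / 2 |x|^2), which the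
  weight still makes integrable.\<close>

lemma wave_in_closure:
  assumes \<delta>: "\<delta> \<in> dual"
  shows "wave \<delta> \<xi> \<in> L2_closure M (fun_span hermite_system)"
proof -
  define u where "u n x = trig \<delta> x * (\<Prod>j<m. exp_partial n (\<i> * of_real (\<xi> j * (x \<bullet> b j))))" for n x
  \<comment> \<open>From 2 |\<xi> t| \<le> 2 \<xi>^2 / \<nu> + \<nu> / 2 t^2, obtained by expanding
    (2 |\<xi>| - \<nu> |t|)^2 \<ge> 0; C collects the terms free of t.\<close>
  define C where "C = (\<Sum>j<m. 2 * (\<xi> j)\<^sup>2 / \<nu>)"
  show ?thesis
  proof (rule L2_closure_dominated[of u])
    show "u n \<in> L2_closure M (fun_span hermite_system)" for n
      using exp_polynomial_in_span[OF \<delta>, where n = n and \<xi> = \<xi>] sq_integrable_fun_span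
      unfolding u_def by (intro L2_closure_base)
    show "wave \<delta> \<xi> \<in> borel_measurable M"
      by simp
    show "AE x in M. (\<lambda>n. u n x) \<longlonglongrightarrow> wave \<delta> \<xi> x"
    proof (rule AE_I2)
      fix x
      have "(\<lambda>n. exp_partial n z) \<longlonglongrightarrow> exp z" for z
        using exp_converges[of z] unfolding sums_def_le exp_partial_def .
      then have "(\<lambda>n. u n x) \<longlonglongrightarrow> trig \<delta> x * (\<Prod>j<m. exp (\<i> * of_real (\<xi> j * (x \<bullet> b j))))"
        unfolding u_def by (intro tendsto_intros)
      then show "(\<lambda>n. u n x) \<longlonglongrightarrow> wave \<delta> \<xi> x"
        by (simp add: wave_def exp_sum[symmetric] sum_distrib_left)
    qed
    show "integrable M (\<lambda>x. exp C * exp (\<nu> / 2 * (norm x)\<^sup>2))"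
      using \<nu>_pos by (intro integrable_mult_right integrable_exp_M) simp
    show "AE x in M. (cmod (u n x))\<^sup>2 \<le> exp C * exp (\<nu> / 2 * (norm x)\<^sup>2)" for n
    proof (rule AE_I2)
      fix x
      have "cmod (u n x) \<le> (\<Prod>j<m. exp (\<bar>\<xi> j * (x \<bullet> b j)\<bar>))"
        unfolding u_def norm_mult norm_trig mult_1_left prod_norm[symmetric]
        by (intro prod_mono conjI norm_ge_zero order_trans[OF exp_partial_bound]) (simp add: norm_mult)
      then have "(cmod (u n x))\<^sup>2 \<le> (exp (\<Sum>j<m. \<bar>\<xi> j * (x \<bullet> b j)\<bar>))\<^sup>2"
        by (intro power_mono) (simp_all add: exp_sum)
      also have "\<dots> = exp (\<Sum>j<m. 2 * \<bar>\<xi> j * (x \<bullet> b j)\<bar>)"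
        by (simp add: exp_double[symmetric] sum_distrib_left)
      also have "\<dots> \<le> exp (C + \<nu> / 2 * (norm x)\<^sup>2)"
      proof -
        have "2 * \<bar>\<xi> j * t\<bar> \<le> 2 * (\<xi> j)\<^sup>2 / \<nu> + \<nu> / 2 * t\<^sup>2" for j t
        proof -
          have "0 \<le> (2 * \<bar>\<xi> j\<bar> - \<nu> * \<bar>t\<bar>)\<^sup>2" by simp
          then have "4 * \<nu> * \<bar>\<xi> j * t\<bar> \<le> 4 * (\<xi> j)\<^sup>2 + \<nu>\<^sup>2 * t\<^sup>2"
            by (simp add: power2_diff power_mult_distrib abs_mult algebra_simps)
          then show ?thesis using \<nu>_pos by (simp add: field_simps power2_eq_square)
        qed
        then have "(\<Sum>j<m. 2 * \<bar>\<xi> j * (x \<bullet> b j)\<bar>) \<le> C + \<nu> / 2 * (\<Sum>j<m. (x \<bullet> b j)\<^sup>2)"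
          unfolding C_def sum_distrib_left sum.distrib[symmetric] by (intro sum_mono)
        also have "\<dots> \<le> C + \<nu> / 2 * (norm x)\<^sup>2"
          using norm_split[of x] \<nu>_pos by (intro add_left_mono mult_left_mono) auto
        finally show ?thesis by simp
      qed
      finally show "(cmod (u n x))\<^sup>2 \<le> exp C * exp (\<nu> / 2 * (norm x)\<^sup>2)"
        by (simp only: exp_add)
    qed
  qed
qed

lemma zero_in_dual: "0 \<in> dual"
  by (simp add: dual_lattice_def span_zero)

lemma add_in_dual: "\<delta> \<in> dual \<Longrightarrow> \<delta>' \<in> dual \<Longrightarrow> \<delta> + \<delta>' \<in> dual"
  by (auto simp: dual_lattice_def inner_add_left intro: span_add)

lemma uminus_in_dual: "\<delta> \<in> dual \<Longrightarrow> - \<delta> \<in> dual"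
  by (auto simp: dual_lattice_def intro: span_neg)

lemma wave_mult: "wave \<delta> \<xi> x * wave \<delta>' \<xi>' x = wave (\<delta> + \<delta>') (\<lambda>j. \<xi> j + \<xi>' j) x"
  by (simp add: wave_def trig_add exp_add[symmetric] distrib_right sum.distrib algebra_simps)

lemma waves_algebra: "bounded_function_algebra M (fun_span waves)"
proof
  have one: "(\<lambda>x. 1) \<in> waves"
    unfolding waves_def using zero_in_dual
    by (intro CollectI exI[of _ 0] exI[of _ "\<lambda>_. 0"]) (auto simp: wave_def trig_def)
  show "(\<lambda>x. c) \<in> fun_span waves" for c
    using fun_span_cmult_base[OF one, of c] by simp
  show "(\<lambda>x. f x + g x) \<in> fun_span waves" if "f \<in> fun_span waves" "g \<in> fun_span waves" for f g
    by (rule fun_span_add[OF that])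
  show "(\<lambda>x. f x * g x) \<in> fun_span waves" if "f \<in> fun_span waves" "g \<in> fun_span waves" for f g
  proof (rule fun_span_mult[OF that])
    fix u w assume "u \<in> waves" "w \<in> waves"
    then show "(\<lambda>x. u x * w x) \<in> waves"
      using add_in_dual by (fastforce simp: waves_def wave_mult)
  qed
  show "f \<in> borel_measurable M" if "f \<in> fun_span waves" for f
    using that
  proof induction
    case (step w f c)
    then have "w \<in> borel_measurable borel" by (auto simp: waves_def)
    then show ?case using step(3) by simp
  qed simp
  show "\<exists>C. \<forall>x\<in>space M. cmod (f x) \<le> C" if "f \<in> fun_span waves" for f
    using that
  proof induction
    case (step w f c)
    then obtain C where C: "\<And>x. cmod (f x) \<le> C" by auto
    have "cmod (w x) = 1" for x
      using step(1) by (auto simp: waves_def wave_def norm_mult)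
    then have "cmod (c * w x + f x) \<le> cmod c + C" for x
      using C[of x] norm_triangle_ineq[of "c * w x" "f x"] by (simp add: norm_mult)
    then show ?case by blast
  qed auto
qed

sublocale waves: bounded_function_algebra M "fun_span waves"
  by (rule waves_algebra)

section \<open>The \<sigma>-algebra generated by the waves\<close>

abbreviation "wave_algebra \<equiv> sigma UNIV waves.bd_approximable"

lemma measurable_wave_algebraI:
  assumes "(\<lambda>x. complex_of_real (g x)) \<in> fun_span waves"
  shows "g \<in> borel_measurable wave_algebra"
  unfolding borel_measurable_iff_greater
  using waves.superlevel_bd_approximable[OF assms] by auto

definition phase :: "'a \<Rightarrow> (nat \<Rightarrow> real) \<Rightarrow> 'a \<Rightarrow> real" where
  "phase \<delta> \<xi> x = 2 * pi * (\<delta> \<bullet> x) + (\<Sum>j<m. \<xi> j * (x \<bullet> b j))"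

text \<open>Euler's formulas: negating both frequencies gives the conjugate wave, so real and
  imaginary parts lie in the algebra.\<close>

lemma measurable_cos_sin:
  assumes "\<delta> \<in> dual"
  shows "(\<lambda>x. cos (phase \<delta> \<xi> x)) \<in> borel_measurable wave_algebra"
    and "(\<lambda>x. sin (phase \<delta> \<xi> x)) \<in> borel_measurable wave_algebra"
proof -
  have w: "wave \<delta> \<xi> \<in> waves" "wave (- \<delta>) (\<lambda>j. - \<xi> j) \<in> waves"
    using assms uminus_in_dual unfolding waves_def by blast+
  have eq: "wave \<delta> \<xi> x = exp (\<i> * of_real (phase \<delta> \<xi> x))" "wave (- \<delta>) (\<lambda>j. - \<xi> j) x = exp (- (\<i> * of_real (phase \<delta> \<xi> x)))" for x
    by (simp_all add: wave_def trig_def phase_def exp_add[symmetric] sum_negf algebra_simps)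
  have "(\<lambda>x. (1 / 2) * wave \<delta> \<xi> x + (1 / 2) * wave (- \<delta>) (\<lambda>j. - \<xi> j) x) \<in> fun_span waves"
    by (intro fun_span.step fun_span_cmult_base w)
  moreover have "(1 / 2) * wave \<delta> \<xi> x + (1 / 2) * wave (- \<delta>) (\<lambda>j. - \<xi> j) x = of_real (cos (phase \<delta> \<xi> x))" for x
    unfolding eq cos_of_real[symmetric] cos_exp_eq by (simp add: add_divide_distrib)
  ultimately show "(\<lambda>x. cos (phase \<delta> \<xi> x)) \<in> borel_measurable wave_algebra"
    by (intro measurable_wave_algebraI) simp
  have "(\<lambda>x. (1 / (2 * \<i>)) * wave \<delta> \<xi> x + (- 1 / (2 * \<i>)) * wave (- \<delta>) (\<lambda>j. - \<xi> j) x) \<in> fun_span waves"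
    by (intro fun_span.step fun_span_cmult_base w)
  moreover have "(1 / (2 * \<i>)) * wave \<delta> \<xi> x + (- 1 / (2 * \<i>)) * wave (- \<delta>) (\<lambda>j. - \<xi> j) x = of_real (sin (phase \<delta> \<xi> x))" for x
    unfolding eq sin_of_real[symmetric] sin_exp_eq by (simp add: algebra_simps diff_divide_distrib)
  ultimately show "(\<lambda>x. sin (phase \<delta> \<xi> x)) \<in> borel_measurable wave_algebra"
    by (intro measurable_wave_algebraI) simp
qed

text \<open>A coordinate is unbounded and not itself a combination of waves; it is the pointwise
  limit of n sin (t / n), where arbitrary real frequencies in the complement are essential.\<close>

lemma measurable_coordinate:
  assumes j: "j < m"
  shows "(\<lambda>x. x \<bullet> b j) \<in> borel_measurable wave_algebra"
proof (rule borel_measurable_LIMSEQ_real)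
  define s where "s n x = real (Suc n) * sin (x \<bullet> b j / real (Suc n))" for n x
  have "(\<Sum>i<m. (if i = j then 1 / real (Suc n) else 0) * (x \<bullet> b i)) = x \<bullet> b j / real (Suc n)" for n x
    using j by (simp add: if_distrib[of "\<lambda>c. c * _"] cong: if_cong)
  then have "(\<lambda>x. sin (x \<bullet> b j / real (Suc n))) \<in> borel_measurable wave_algebra" for n
    using measurable_cos_sin(2)[OF zero_in_dual, of "\<lambda>i. if i = j then 1 / real (Suc n) else 0"] by (simp add: phase_def)
  then show "s n \<in> borel_measurable wave_algebra" for n
    unfolding s_def by (intro borel_measurable_times borel_measurable_const)
  show "(\<lambda>n. s n x) \<longlonglongrightarrow> x \<bullet> b j" for x
  proof -
    have "(\<lambda>n. real (Suc n) * sin (t / real (Suc n))) \<longlonglongrightarrow> t" for t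
    proof -
      have "((\<lambda>h. sin (h * t)) has_real_derivative t) (at 0)"
        by (auto intro!: derivative_eq_intros)
      then have "((\<lambda>h. sin (h * t) / h) \<longlongrightarrow> t) (at 0)"
        unfolding DERIV_def by simp
      moreover have "filterlim (\<lambda>n. inverse (real (Suc n))) (at 0) sequentially"
        unfolding filterlim_at using LIMSEQ_inverse_real_of_nat by simp
      ultimately have "(\<lambda>n. sin (inverse (real (Suc n)) * t) / inverse (real (Suc n))) \<longlonglongrightarrow> t"
        by (rule filterlim_compose)
      then show ?thesis by (simp add: field_simps)
    qed
    then show ?thesis unfolding s_def .
  qed
qed

text \<open>The cosine fixes the angle up to reflection and the sign of the sine selects the half
  circle. Both points with vanishing sine, s = 0 and s = 1/2, fall under the first branch.\<close>

lemma frac_eq_arccos: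
  "frac t = (if sin (2 * pi * t) \<ge> 0 then arccos (cos (2 * pi * t)) / (2 * pi) else 1 - arccos (cos (2 * pi * t)) / (2 * pi))"
proof -
  define s where "s = frac t"
  have s: "0 \<le> s" "s < 1" by (simp_all add: s_def frac_lt_1)
  have t: "2 * pi * t = 2 * pi * s + 2 * pi * of_int \<lfloor>t\<rfloor>"
    by (simp add: s_def frac_def algebra_simps)
  have c: "cos (2 * pi * t) = cos (2 * pi * s)" "sin (2 * pi * t) = sin (2 * pi * s)"
    unfolding t cos_add sin_add cos_int_2pin sin_int_2pin by simp_all
  show ?thesis
  proof (cases "s \<le> 1 / 2")
    case True
    have "arccos (cos (2 * pi * s)) = 2 * pi * s"
      using s True by (intro arccos_cos) (auto simp: field_simps)
    moreover have "sin (2 * pi * s) \<ge> 0"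
      using s True by (intro sin_ge_zero) (auto simp: field_simps)
    ultimately show ?thesis unfolding c s_def[symmetric] by simp
  next
    case False
    have "cos (2 * pi * s) = cos (2 * pi - 2 * pi * s)" by (simp add: cos_diff)
    moreover have "arccos (cos (2 * pi - 2 * pi * s)) = 2 * pi - 2 * pi * s"
      using s False by (intro arccos_cos) (auto simp: field_simps)
    moreover have "sin (2 * pi - 2 * pi * s) > 0"
      using s False by (intro sin_gt_zero) (auto simp: field_simps)
    ultimately show ?thesis
      unfolding c s_def[symmetric] by (simp add: sin_diff field_simps)
  qed
qed

lemma measurable_frac:
  assumes "\<delta> \<in> dual"
  shows "(\<lambda>x. frac (\<delta> \<bullet> x)) \<in> borel_measurable wave_algebra"
proof -
  have [measurable]: "(\<lambda>x. cos (2 * pi * (\<delta> \<bullet> x))) \<in> borel_measurable wave_algebra"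
    "(\<lambda>x. sin (2 * pi * (\<delta> \<bullet> x))) \<in> borel_measurable wave_algebra"
    using measurable_cos_sin[OF assms, of "\<lambda>_. 0"] by (simp_all add: phase_def)
  \<comment> \<open>Clamping to [-1, 1] extends arccos continuously to the line without changing its
    values at cosines.\<close>
  have "continuous_on UNIV (\<lambda>t. arccos (max (- 1) (min 1 t)))"
    by (intro continuous_intros) auto
  then have [measurable]: "(\<lambda>t. arccos (max (- 1) (min 1 t))) \<in> borel_measurable borel"
    by (rule borel_measurable_continuous_onI)
  have "max (- 1) (min 1 (cos y)) = cos y" for y :: real
    using cos_le_one[of y] cos_ge_minus_one[of y] by linarith
  moreover have "(\<lambda>x. arccos (max (- 1) (min 1 (cos (2 * pi * (\<delta> \<bullet> x)))))) \<in> borel_measurable wave_algebra"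
    by measurable
  ultimately have [measurable]: "(\<lambda>x. arccos (cos (2 * pi * (\<delta> \<bullet> x)))) \<in> borel_measurable wave_algebra"
    by simp
  show ?thesis
    unfolding frac_eq_arccos by measurable
qed

text \<open>Subtracting the integral parts leaves the fractional parts of the lattice coordinates
  plus the untouched complement component, all measurable by the preceding results.\<close>

lemma measurable_retract:
  assumes W: "finite W" "\<And>w. w \<in> W \<Longrightarrow> d w \<in> dual"
    and rep: "\<And>x. x \<in> span \<Gamma> \<Longrightarrow> x = (\<Sum>w\<in>W. (d w \<bullet> x) *\<^sub>R w)"
  shows "retract W d \<in> borel_measurable wave_algebra"
proof -
  have "retract W d x = (\<Sum>w\<in>W. frac (d w \<bullet> x) *\<^sub>R w) + (\<Sum>j<m. (x \<bullet> b j) *\<^sub>R b j)" for x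
  proof -
    have "d w \<bullet> (x - perp x) = d w \<bullet> x" if "w \<in> W" for w
      using V_orthogonal_perp[of "d w" x] W(2)[OF that] by (simp add: dual_lattice_def inner_diff_right)
    then have "x - perp x = (\<Sum>w\<in>W. (d w \<bullet> x) *\<^sub>R w)"
      by (subst rep[OF diff_perp_in]) (simp cong: sum.cong)
    then have "x = (\<Sum>w\<in>W. (d w \<bullet> x) *\<^sub>R w) + perp x" by (simp add: algebra_simps)
    then show ?thesis
      by (subst (asm) perp_def) (simp add: retract_def frac_def scaleR_left_diff_distrib sum_subtractf algebra_simps)
  qed
  moreover have "(\<lambda>x. (\<Sum>w\<in>W. frac (d w \<bullet> x) *\<^sub>R w) + (\<Sum>j<m. (x \<bullet> b j) *\<^sub>R b j)) \<in> borel_measurable wave_algebra"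
    using measurable_frac[OF W(2)] measurable_coordinate
    by (intro borel_measurable_add borel_measurable_sum borel_measurable_scaleR borel_measurable_const) auto
  ultimately show ?thesis by (simp cong: measurable_cong)
qed

text \<open>Periodicity holds almost everywhere for each \<gamma>, hence off one null set for all of
  them. There f agrees with its composition with \<open>retract\<close>, and this composition is
  measurable for the small \<sigma>-algebra without exception.\<close>

lemma periodic_in_closure:
  assumes f: "f \<in> borel_measurable borel" and per: "\<And>\<gamma>. \<gamma> \<in> \<Gamma> \<Longrightarrow> AE x in lborel. f (x + \<gamma>) = f x"
    and f2: "sq_integrable M f"
  shows "f \<in> L2_closure M (fun_span waves)"
proof -
  obtain W d where W: "finite W" "W \<subseteq> \<Gamma>" "\<And>w. w \<in> W \<Longrightarrow> d w \<in> dual"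
    "\<And>x. x \<in> span \<Gamma> \<Longrightarrow> x = (\<Sum>w\<in>W. (d w \<bullet> x) *\<^sub>R w)"
    using lattice_dual_basis[OF group uniform_discrete_\<Gamma>] by metis
  let ?g = "\<lambda>x. f (retract W d x)"
  have "AE x in lborel. \<forall>\<gamma>\<in>\<Gamma>. f (x + \<gamma>) = f x"
    by (rule AE_ball_countable'[OF per countable_\<Gamma>])
  then have eq: "AE x in lborel. f x = ?g x"
  proof eventually_elim
    case (elim x)
    then show ?case using retract_translate[OF W(2), of d x] by auto
  qed
  have g_borel: "?g \<in> borel_measurable borel"
    by (rule measurable_compose[OF retract_measurable f])
  have "?g \<in> borel_measurable wave_algebra"
    by (rule measurable_compose[OF measurable_retract[OF W(1,3,4)] f])
  moreover have "sq_integrable M ?g"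
    using sq_integrable_cong_AE[OF AE_M[OF eq] f2] g_borel by simp
  ultimately have "?g \<in> L2_closure M (fun_span waves)"
    using waves.dense_in_L2[of ?g] by simp
  moreover have "AE x in M. ?g x = f x"
    using AE_M[OF eq] by eventually_elim simp
  ultimately show ?thesis
    by (rule L2_closure_cong_AE) (use f in simp)
qed

text \<open>Measurability is carried through the induction because \<open>abs_ae_fun\<close>
  respects sums and multiples of Borel functions only.\<close>

lemma e_span_in_span:
  assumes "g \<in> fun_span hermite_system"
  shows "(\<lambda>x. factor x * g x) \<in> borel_measurable borel \<and> abs_ae_fun (\<lambda>x. factor x * g x) \<in>
    ae.span ((\<lambda>(\<delta>, k). ec \<delta> k) ` (dual \<times> multi_indices m))" (is "_ \<and> _ \<in> ae.span ?E")
  using assms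
proof induction
  case zero
  show ?case using ae.span_zero[of ?E] by (simp add: zero_ae_fun_def)
next
  case (step w f c)
  obtain \<delta> k where \<delta>: "\<delta> \<in> dual" "k \<in> multi_indices m"
    and w: "w = (\<lambda>x. trig \<delta> x * of_real (herm k x))"
    using step(1) by (auto simp: hermite_system_def)
  have eq: "(\<lambda>x. factor x * (c * w x + f x)) = (\<lambda>x. c * e \<delta> k x + factor x * f x)"
    by (simp add: w e_eq[OF \<delta>(1)] algebra_simps)
  have meas: "e \<delta> k \<in> borel_measurable borel" "(\<lambda>x. factor x * f x) \<in> borel_measurable borel"
    using measurable_e[OF \<delta>(1)] step(3) by auto
  have "abs_ae_fun (\<lambda>x. c * e \<delta> k x + factor x * f x) =
      scale_ae c (ec \<delta> k) + abs_ae_fun (\<lambda>x. factor x * f x)"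
    using meas by (simp add: e_class_eq scale_ae.abs_eq plus_ae_fun.abs_eq)
  also have "\<dots> \<in> ae.span ?E"
    using step(3) \<delta> by (intro ae.span_add[OF ae.span_scale[OF ae.span_base]]) auto
  finally show ?case
    unfolding eq using meas by simp
qed

text \<open>Dividing by \<open>factor\<close> does not increase the modulus and makes the function
  periodic, so it lies in the closure of the waves and thus of \<open>hermite_system\<close>.
  Multiplying back is controlled by the bound for \<open>factor\<close> on D.\<close>

lemma e_class_total:
  assumes "f \<in> H" "\<epsilon> > 0"
  shows "\<exists>g \<in> ae.span ((\<lambda>(\<delta>, k). ec \<delta> k) ` (dual \<times> multi_indices m)).
    ip_dist (L2_inner \<nu> D) f g < \<epsilon>"
proof -
  obtain u where u: "f = abs_ae_fun u" "u \<in> borel_measurable borel" "QP u" "sq_integrable M u"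
    using assms(1) by (rule H_cases)
  define w where "w x = u x / factor x" for x
  have uw: "u = (\<lambda>x. factor x * w x)"
    using factor_nonzero by (simp add: w_def)
  have w_meas: "w \<in> borel_measurable borel"
    unfolding w_def using u(2) by measurable
  have "cmod (w x) \<le> cmod (u x)" for x
    using factor_ge_1[of x] unfolding w_def norm_divide
    by (metis div_by_1 divide_left_mono mult_pos_pos norm_ge_zero less_le_trans zero_less_one)
  then have "sq_integrable M w"
    using u(4) w_meas by (intro sq_integrable_bound[of M "\<lambda>x. (cmod (u x))\<^sup>2"] AE_I2 power_mono)
      (auto simp: sq_integrable_def)
  moreover have "AE x in lborel. w (x + \<gamma>) = w x" if "\<gamma> \<in> \<Gamma>" for \<gamma>
    using u(3) that unfolding uw QP_factor_iff by blast
  ultimately have "w \<in> L2_closure M (fun_span waves)"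
    using w_meas by (intro periodic_in_closure)
  moreover have "L2_closure M (fun_span waves) \<subseteq> L2_closure M (fun_span hermite_system)"
    by (rule L2_closure_mono_closure, erule fun_span_L2_closure) (auto simp: waves_def wave_in_closure)
  ultimately have w_cl: "w \<in> L2_closure M (fun_span hermite_system)" by blast
  obtain C where C: "C > 0" "AE x in M. cmod (factor x) \<le> C" using factor_bounded by blast
  have "u \<in> L2_closure M ((\<lambda>g x. factor x * g x) ` fun_span hermite_system)"
    unfolding uw by (rule L2_closure_mult_bounded[OF w_cl _ C(2,1)]) auto
  then obtain g where g: "g \<in> fun_span hermite_system" "sq_integrable M (\<lambda>x. factor x * g x)"
    "L2_seminorm M (\<lambda>x. u x - factor x * g x) < \<epsilon>"
    using assms(2) unfolding L2_closure_def by blast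
  then show ?thesis
    using e_span_in_span[OF g(1)] u by (intro bexI[of _ "abs_ae_fun (\<lambda>x. factor x * g x)"]) (auto simp: ip_dist_abs)
qed

theorem orthogonal_basis_e_class:
  "orthogonal_basis scale_ae H (L2_inner \<nu> D) (dual \<times> multi_indices m)
    (\<lambda>(\<delta>, k). ec \<delta> k)"
  unfolding orthogonal_basis_def
proof (intro conjI ballI allI impI)
  fix i assume i: "i \<in> dual \<times> multi_indices m"
  then show "(case i of (\<delta>, k) \<Rightarrow> ec \<delta> k) \<in> H"
    and "(case i of (\<delta>, k) \<Rightarrow> ec \<delta> k) \<noteq> 0"
    by (auto simp: e_class_in_H e_class_nonzero)
  fix j assume "j \<in> dual \<times> multi_indices m" "i \<noteq> j"
  with i show "L2_inner \<nu> D (case i of (\<delta>, k) \<Rightarrow> ec \<delta> k)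
      (case j of (\<delta>, k) \<Rightarrow> ec \<delta> k) = 0"
    by (cases i, cases j) (simp add: e_class_orthogonal)
qed (rule e_class_total)

end

theorem theorem2p1:
  fixes \<Gamma> L :: "'a::euclidean_space set" and \<nu> :: real and chi :: "'a \<Rightarrow> complex"
    and v :: 'a and r :: nat and b :: "nat \<Rightarrow> 'a"
    and m :: nat and D :: "'a set"
  assumes "additive_subgroup \<Gamma>" and "discrete \<Gamma>" and "dim (span \<Gamma>) = r" and "m = DIM('a) - r"
    and "\<nu> > 0"
    and "unitary_character \<Gamma> chi" and "v \<in> span \<Gamma>"
    and "\<And>\<gamma>. \<gamma> \<in> \<Gamma> \<Longrightarrow> chi \<gamma> = exp (2 * \<i> * complex_of_real pi * complex_of_real (\<gamma> \<bullet> v))"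
    and "compact_fundamental_domain \<Gamma> L" and "D = full_domain \<Gamma> L"
    and "inj_on b {..<m}" and "orthonormal_basis_of (b ` {..<m}) (orthogonal_comp (span \<Gamma>))"
  shows "hilbert_space scale_ae (L2_space \<nu> \<Gamma> chi D) (L2_inner \<nu> D) \<and>
    orthogonal_basis scale_ae (L2_space \<nu> \<Gamma> chi D) (L2_inner \<nu> D)
      (dual_lattice \<Gamma> \<times> multi_indices m) (\<lambda>(\<delta>, k). e_class \<nu> \<Gamma> v m b \<delta> k) \<and>
    (\<forall>\<delta> \<in> dual_lattice \<Gamma>. \<forall>k \<in> multi_indices m.
      (L2_norm \<nu> D (e_class \<nu> \<Gamma> v m b \<delta> k))\<^sup>2 =
        measure (subspace_lebesgue (span \<Gamma>)) L * (pi / \<nu>) powr (real m / 2)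
          * 2 ^ (\<Sum>j<m. k j) * (\<Prod>j<m. fact (k j)))"
proof -
  interpret Q: quasi_periodic_space \<Gamma> L m b \<nu> chi v
    by unfold_locales (rule assms; assumption)+
  have D: "D = Q.D" using assms(10) by (simp add: Q.D_def)
  show ?thesis
    unfolding D using Q.hilbert_space_H Q.orthogonal_basis_e_class Q.e_class_norm by blast
qed

end
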